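(* Let $\mathcal{G}$ be the (infinite) Ginibre ensemble on $\mathbb{C}$ and let $\mathcal{P}_2$ be the Poisson point process on $\mathbb{R}$ with constant intensity $2$ (with respect to Lebesgue measure). Then $$\big\{R(|z|-R):z\in\mathcal{G}\big\}\ \xrightarrow[R\to+\infty]{\mathrm{law}}\ \mathcal{P}_2.$$
   Context: Point processes: for a locally compact Polish space $X$, $\mathrm{Conf}(X)$ is the space of locally finite configurations $\xi=\sum_i\delta_{x_i}$ on $X$ (finite mass on pre-compact Borel sets), with the vague topology (the weakest topology making $\xi\mapsto\int f\,\mathrm{d}\xi$ continuous for every compactly supported continuous $f$). A point process on $X$ is a $\mathrm{Conf}(X)$-valued random variable, and convergence in law of point processes is convergence in law of $\mathrm{Conf}(X)$-valued random variables. The notation $\{T(z):z\in\mathscr{X}\}$ denotes the push-forward configuration $\sum_{z\in\mathscr{X}}\delta_{T(z)}$. Determinantal point processes: given a Radon measure $\mu$ on $X$ and measurable $K:X\times X\to\mathbb{C}$, a simple point process $\mathscr{X}$ (no multiple points; $\mathscr{X}(\Delta)$ is the number of points in $\Delta$) is determinantal with kernel $K$ with respect to the reference measure $\mu$ if for every $k\ge 1$ and all mutually disjoint pre-compact Borel sets $\Delta_1,\dots,\Delta_k\subset X$, $$\mathbb{E}\Big[\prod_{i=1}^k\mathscr{X}(\Delta_i)\Big]=\int_{\Delta_1\times\cdots\times\Delta_k}\det[K(x_i,x_j)]_{1\le i,j\le k}\,\mathrm{d}\mu(x_1)\cdots\mathrm{d}\mu(x_k).$$ Ginibre ensemble: $\mathcal{G}$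 is the determinantal point process on $\mathbb{C}$ with respect to Lebesgue measure $m$ with kernel $K_{\mathcal{G}}(z,w)=\frac{1}{\pi}e^{z\overline{w}-\frac{|z|^2}{2}-\frac{|w|^2}{2}}$ (equivalently, with reference measure $\frac1\pi e^{-|z|^2}\mathrm{d}m(z)$ and the kernel $e^{z\overline w}$ of the orthogonal projection onto the holomorphic functions). *)

theory Defs
  imports "HOL-Probability.Probability" "Jordan_Normal_Form.Determinant"
begin

text \<open>The metric carried by \<^class>\<open>polish_space\<close> plays no role beyond witnessing that the topology
  is Polish.\<close>

class locally_compact_polish_space = polish_space +
  assumes locally_compact: "\<exists>U. open U \<and> x \<in> U \<and> compact (closure U)"

instance euclidean_space \<subseteq> locally_compact_polish_space
proof
  fix x :: 'a
  have "open (ball x 1) \<and> x \<in> ball x 1 \<and> compact (closure (ball x 1))"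
    by simp
  then show "\<exists>U. open U \<and> x \<in> U \<and> compact (closure U)"
    by blast
qed

definition precompact_borel :: "'a::topological_space set \<Rightarrow> bool" where
  "precompact_borel B \<longleftrightarrow> B \<in> sets borel \<and> compact (closure B)"

definition radon_measure :: "'a::locally_compact_polish_space measure \<Rightarrow> bool" where
  "radon_measure \<mu> \<longleftrightarrow> sets \<mu> = sets borel \<and> (\<forall>B. precompact_borel B \<longrightarrow> emeasure \<mu> B < \<infinity>)"

text \<open>The measure \<open>distr (count_space I) borel x\<close> is the sum over \<open>i \<in> I\<close> of the Dirac masses at
  \<open>x i\<close>. By second countability a locally finite such sum has countably many terms, so index sets
  \<open>I\<close> of natural numbers suffice; points may be repeated.\<close>

definition is_configuration :: "'a::locally_compact_polish_space measure \<Rightarrow> bool" where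
  "is_configuration \<xi> \<longleftrightarrow>
     (\<exists>(I :: nat set) x. \<xi> = distr (count_space I) borel x) \<and>
     (\<forall>B. precompact_borel B \<longrightarrow> emeasure \<xi> B < \<infinity>)"

typedef (overloaded) ('a::locally_compact_polish_space) conf = "{\<xi> :: 'a measure. is_configuration \<xi>}"
  morphisms conf_measure Conf
proof
  show "distr (count_space ({} :: nat set)) borel (\<lambda>_. undefined) \<in> {\<xi> :: 'a measure. is_configuration \<xi>}"
    unfolding is_configuration_def by (auto simp: emeasure_distr precompact_borel_def)
qed

instantiation conf :: (locally_compact_polish_space) topological_space
begin

definition open_conf :: "'a conf set \<Rightarrow> bool" where
  "open_conf = generate_topology
     {{\<xi>. (\<integral>x. f x \<partial>conf_measure \<xi>) \<in> U} | (f :: 'a \<Rightarrow> real) U.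
        continuous_on UNIV f \<and> compact (closure {x. f x \<noteq> 0}) \<and> open U}"

instance
  by standard (auto simp: open_conf_def intro: generate_topology.intros)

end

definition num_points :: "'a::locally_compact_polish_space conf \<Rightarrow> 'a set \<Rightarrow> real" where
  "num_points \<xi> B = measure (conf_measure \<xi>) B"

text \<open>The push-forward is unspecified if the image points accumulate, i.e. if the image measure is
  not locally finite. It is a configuration whenever \<open>T\<close> is continuous and proper.\<close>

definition push_conf ::
  "('a::locally_compact_polish_space \<Rightarrow> 'b::locally_compact_polish_space) \<Rightarrow> 'a conf \<Rightarrow> 'b conf" where
  "push_conf T \<xi> = Conf (distr (conf_measure \<xi>) borel T)"

definition point_process :: "'w measure \<Rightarrow> ('w \<Rightarrow> 'a::locally_compact_polish_space conf) \<Rightarrow> bool" where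
  "point_process M X \<longleftrightarrow> prob_space M \<and> X \<in> M \<rightarrow>\<^sub>M borel"

definition simple_point_process :: "'w measure \<Rightarrow> ('w \<Rightarrow> 'a::locally_compact_polish_space conf) \<Rightarrow> bool" where
  "simple_point_process M X \<longleftrightarrow>
     point_process M X \<and> (AE \<omega> in M. \<forall>x. num_points (X \<omega>) {x} \<le> 1)"

text \<open>Both sides of the defining identity are required to be genuinely finite, because Bochner
  integrals of non-integrable functions are 0 by convention.\<close>

definition determinantal ::
  "'w measure \<Rightarrow> ('w \<Rightarrow> 'a::locally_compact_polish_space conf) \<Rightarrow> 'a measure \<Rightarrow> ('a \<Rightarrow> 'a \<Rightarrow> complex) \<Rightarrow> bool" where
  "determinantal M X \<mu> K \<longleftrightarrow>
     simple_point_process M X \<and> radon_measure \<mu> \<and> (\<lambda>(x, y). K x y) \<in> borel_measurable (borel \<Otimes>\<^sub>M borel) \<and>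
     (\<forall>k\<ge>1. \<forall>\<Delta> :: nat \<Rightarrow> 'a set.
        (\<forall>i<k. precompact_borel (\<Delta> i)) \<and> disjoint_family_on \<Delta> {..<k} \<longrightarrow>
        (let D = (\<lambda>x :: nat \<Rightarrow> 'a. Determinant.det (Matrix.mat k k (\<lambda>(i, j). K (x i) (x j))))
         in set_integrable (Pi\<^sub>M {..<k} (\<lambda>_. \<mu>)) (Pi\<^sub>E {..<k} \<Delta>) D \<and>
            has_bochner_integral M (\<lambda>\<omega>. complex_of_real (\<Prod>i<k. num_points (X \<omega>) (\<Delta> i)))
              (LINT x : Pi\<^sub>E {..<k} \<Delta> | Pi\<^sub>M {..<k} (\<lambda>_. \<mu>). D x)))"

definition ginibre_kernel :: "complex \<Rightarrow> complex \<Rightarrow> complex" where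
  "ginibre_kernel z w =
     of_real (1 / pi) * exp (z * cnj w - of_real ((cmod z)\<^sup>2 / 2) - of_real ((cmod w)\<^sup>2 / 2))"

definition ginibre_ensemble :: "'w measure \<Rightarrow> ('w \<Rightarrow> complex conf) \<Rightarrow> bool" where
  "ginibre_ensemble M X \<longleftrightarrow> determinantal M X lborel ginibre_kernel"

text \<open>The Poisson weights are written out, as \<^const>\<open>poisson_pmf\<close> excludes the parameter 0,
  which occurs here for \<open>\<Lambda>\<close>-null sets.\<close>

definition poisson_process ::
  "'w measure \<Rightarrow> ('w \<Rightarrow> 'a::locally_compact_polish_space conf) \<Rightarrow> 'a measure \<Rightarrow> bool" where
  "poisson_process M X \<Lambda> \<longleftrightarrow>
     point_process M X \<and> radon_measure \<Lambda> \<and>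
     (\<forall>\<Delta> n. precompact_borel \<Delta> \<longrightarrow>
        measure M {\<omega> \<in> space M. num_points (X \<omega>) \<Delta> = real n} =
          measure \<Lambda> \<Delta> ^ n / fact n * exp (- measure \<Lambda> \<Delta>)) \<and>
     (\<forall>k. \<forall>\<Delta> :: nat \<Rightarrow> 'a set.
        (\<forall>i<k. precompact_borel (\<Delta> i)) \<and> disjoint_family_on \<Delta> {..<k} \<longrightarrow>
        prob_space.indep_vars M (\<lambda>_. borel) (\<lambda>i \<omega>. num_points (X \<omega>) (\<Delta> i)) {..<k})"

text \<open>Measurability is required only eventually along \<open>F\<close>, since push-forwards may be
  ill-defined for exceptional parameter values.\<close>

definition converges_in_law ::
  "('i \<Rightarrow> 'w measure) \<Rightarrow> ('i \<Rightarrow> 'w \<Rightarrow> 's::topological_space) \<Rightarrow> 'v measure \<Rightarrow> ('v \<Rightarrow> 's) \<Rightarrow> 'i filter \<Rightarrow> bool" where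
  "converges_in_law M X N Y F \<longleftrightarrow>
     (\<forall>\<^sub>F i in F. prob_space (M i) \<and> X i \<in> M i \<rightarrow>\<^sub>M borel) \<and>
     prob_space N \<and> Y \<in> N \<rightarrow>\<^sub>M borel \<and>
     (\<forall>h :: 's \<Rightarrow> real. continuous_on UNIV h \<and> bounded (range h) \<longrightarrow>
        ((\<lambda>i. \<integral>\<omega>. h (X i \<omega>) \<partial>M i) \<longlongrightarrow> (\<integral>\<omega>. h (Y \<omega>) \<partial>N)) F)"

end

theory Submission
  imports Defs "HOL-Real_Asymp.Real_Asymp"
begin

text \<open>The kernel satisfies \<open>|K(z, w)| = exp (- |z - w|^2 / 2) / pi\<close>, and an annulus that is
  mapped to a fixed bounded set by \<open>z \<mapsto> R (|z| - R)\<close> has bounded area but is so thin that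
  \<open>exp (- |z - w|^2 / 2)\<close> integrates over it to \<open>O(1 / R)\<close>, uniformly in \<open>z\<close>. Hence all
  terms of the determinants except the diagonal one vanish in the limit, and the factorial moments of
  the number of points in the annulus tend to those of a Poisson variable. By Bonferroni's
  inequalities the void probabilities converge. Together with the convergence of the intensities this
  gives convergence in law: up to small probability a configuration lies in a compact set and has at
  most one point in each cell of a fine lattice, and the law of the set of empty cells is a linear
  combination of void probabilities.\<close>

section \<open>Configurations as families of points\<close>

text \<open>The intensity 2 is an area: the annulus mapped to \<open>[a, b)\<close> has area close
  to \<open>2 * pi * (b - a)\<close>, and Ginibre points have density \<open>1 / pi\<close>. The
  determinantal identity speaks only of products of counts over disjoint sets, whereas Bonferroni
  needs the factorial moments of one set. Cutting that set into small squares bridges the gap,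
  provided that the error estimate does not depend on the partition. Void probabilities suffice in
  the end because, with at most one point per lattice cell, occupied or empty is all that is left of
  a configuration after rounding. Cells with several points are excluded through the mean and the
  void probability of a cell, without second moments. The vague topology is given by a subbasis, not
  by a metric; coding configurations by families with a product metric supplies the compactness and
  the uniform continuity that let a continuous \<open>h\<close> be replaced by a function of
  finitely many cells.\<close>

lemma sets_conf_measure [measurable_cong, simp]: "sets (conf_measure \<xi>) = sets borel"
  and finite_conf_measure: "precompact_borel B \<Longrightarrow> emeasure (conf_measure \<xi>) B < \<infinity>"
  using conf_measure[of \<xi>] by (auto simp: is_configuration_def)

lemma precompact_borel_subset:
  "precompact_borel B \<Longrightarrow> A \<in> sets borel \<Longrightarrow> A \<subseteq> B \<Longrightarrow> precompact_borel A"
  unfolding precompact_borel_def by (metis closure_mono closed_closure compact_Int_closed inf.absorb_iff2)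

lemma precompact_borel_bounded:
  fixes B :: "'a::euclidean_space set"
  shows "precompact_borel B \<longleftrightarrow> B \<in> sets borel \<and> bounded B"
  by (simp add: precompact_borel_def)

lemma emeasure_distr_count_space:
  assumes "B \<in> sets borel"
  shows "emeasure (distr (count_space I) borel x) B = emeasure (count_space I) {i\<in>I. x i \<in> B}"
  using assms by (subst emeasure_distr) (auto intro!: arg_cong2[where f=emeasure])

lemma emeasure_count_space_less_top: "emeasure (count_space I) {i\<in>I. P i} < \<infinity> \<longleftrightarrow> finite {i\<in>I. P i}"
  by (cases "finite {i\<in>I. P i}") (auto simp: emeasure_count_space_finite emeasure_count_space_infinite of_nat_less_top)

definition locally_finite_points :: "'i set \<Rightarrow> ('i \<Rightarrow> 'a::topological_space) \<Rightarrow> bool" where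
  "locally_finite_points I x \<longleftrightarrow> (\<forall>B. precompact_borel B \<longrightarrow> finite {i\<in>I. x i \<in> B})"

text \<open>The index type is left free: naturals serve for given configurations, integers for
  lattice points, pairs for codes.\<close>

definition points_conf :: "'i set \<Rightarrow> ('i \<Rightarrow> 'a::locally_compact_polish_space) \<Rightarrow> 'a conf" where
  "points_conf I x = Conf (distr (count_space I) borel x)"

text \<open>\<open>is_configuration\<close> asks for natural indices, and \<open>to_nat\<close>
  carries any countable index set there. Local finiteness is what makes the image a configuration,
  so that \<open>Conf\<close> can be inverted.\<close>

lemma conf_measure_points_conf:
  fixes I :: "'i::countable set"
  assumes "locally_finite_points I x"
  shows "conf_measure (points_conf I x) = distr (count_space I) borel x"
proof -
  have "distr (count_space I) borel x = distr (count_space (to_nat ` I)) borel (x \<circ> from_nat)"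
  proof -
    have "count_space (to_nat ` I) = distr (count_space I) (count_space (to_nat ` I)) to_nat"
      by (rule distr_bij_count_space[symmetric]) (simp add: inj_on_imp_bij_betw)
    then have "distr (count_space (to_nat ` I)) borel (x \<circ> from_nat)
        = distr (distr (count_space I) (count_space (to_nat ` I)) to_nat) borel (x \<circ> from_nat)"
      by simp
    also have "\<dots> = distr (count_space I) borel x"
      by (subst distr_distr) (auto simp: o_def)
    finally show ?thesis ..
  qed
  moreover have "emeasure (distr (count_space I) borel x) B < \<infinity>" if "precompact_borel B" for B
    using assms that
    by (subst emeasure_distr_count_space)
      (auto simp only: emeasure_count_space_less_top locally_finite_points_def precompact_borel_def)
  ultimately show ?thesis
    unfolding points_conf_def by (subst Conf_inverse) (auto simp only: is_configuration_def mem_Collect_eq)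
qed

text \<open>Replaces the measure by a family of points, so that counts become cardinalities and
  integrals become sums.\<close>

lemma conf_exhaust:
  obtains I :: "nat set" and x where "locally_finite_points I x" "\<xi> = points_conf I x"
proof -
  obtain I :: "nat set" and x where *: "conf_measure \<xi> = distr (count_space I) borel x"
    using conf_measure[of \<xi>] by (auto simp: is_configuration_def)
  have "locally_finite_points I x"
    unfolding locally_finite_points_def
  proof (intro allI impI)
    fix B :: "'a set" assume "precompact_borel B"
    then have "emeasure (distr (count_space I) borel x) B < \<infinity>" "B \<in> sets borel"
      using finite_conf_measure[of B \<xi>] * by (auto simp: precompact_borel_def)
    then show "finite {i\<in>I. x i \<in> B}"
      by (simp only: emeasure_distr_count_space emeasure_count_space_less_top)
  qed
  moreover have "\<xi> = points_conf I x"
    by (simp add: points_conf_def conf_measure_inverse flip: *)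
  ultimately show ?thesis using that by blast
qed

lemma num_points_points_conf:
  fixes I :: "'i::countable set"
  assumes "locally_finite_points I x" and B: "precompact_borel B"
  shows "num_points (points_conf I x) B = real (card {i\<in>I. x i \<in> B})"
proof -
  have "finite {i\<in>I. x i \<in> B}" using assms by (simp add: locally_finite_points_def)
  then show ?thesis
    using B unfolding num_points_def conf_measure_points_conf[OF assms(1)] measure_def
    by (subst emeasure_distr_count_space) (auto simp: precompact_borel_def emeasure_count_space_finite)
qed

lemma integral_points_conf:
  fixes I :: "'i::countable set" and f :: "'a::locally_compact_polish_space \<Rightarrow> real"
  assumes I: "locally_finite_points I x"
    and f: "continuous_on UNIV f" "compact (closure {x. f x \<noteq> 0})"
    and F: "finite F" "{i\<in>I. f (x i) \<noteq> 0} \<subseteq> F" "F \<subseteq> I"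
  shows "(\<integral>u. f u \<partial>conf_measure (points_conf I x)) = (\<Sum>i\<in>F. f (x i))"
proof -
  have [measurable]: "f \<in> borel_measurable borel"
    using f by (rule_tac borel_measurable_continuous_onI)
  have "(\<integral>u. f u \<partial>conf_measure (points_conf I x)) = (\<integral>i. f (x i) \<partial>count_space I)"
    by (simp add: conf_measure_points_conf[OF I] integral_distr)
  also have "\<dots> = (\<Sum>i\<in>{i\<in>I. f (x i) \<noteq> 0}. f (x i))"
    using F by (intro lebesgue_integral_count_space_finite_support) (auto intro: finite_subset)
  also have "\<dots> = (\<Sum>i\<in>F. f (x i))"
    using F by (intro sum.mono_neutral_left) auto
  finally show ?thesis .
qed

lemma push_points_conf:
  fixes I :: "'i::countable set"
  assumes "locally_finite_points I x" and [measurable]: "T \<in> borel_measurable borel"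
  shows "push_conf T (points_conf I x) = points_conf I (T \<circ> x)"
  unfolding push_conf_def conf_measure_points_conf[OF assms(1)]
  by (simp add: distr_distr points_conf_def)

lemma points_conf_cong_bij:
  assumes "bij_betw g I J" "\<And>i. i \<in> I \<Longrightarrow> x i = y (g i)"
  shows "points_conf I x = points_conf J y"
proof -
  have g: "g \<in> measurable (count_space I) (count_space J)"
    using bij_betwE[OF assms(1)] by simp
  have "distr (count_space J) borel y = distr (distr (count_space I) (count_space J) g) borel y"
    using assms(1) by (simp add: distr_bij_count_space)
  also have "\<dots> = distr (count_space I) borel (y \<circ> g)"
    by (rule distr_distr[OF _ g]) simp
  also have "\<dots> = distr (count_space I) borel x"
    using assms(2) by (intro distr_cong) auto
  finally show ?thesis by (simp add: points_conf_def)
qed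

lemma num_points_nat:
  assumes "precompact_borel B"
  obtains n :: nat where "num_points \<xi> B = real n"
  by (metis conf_exhaust num_points_points_conf assms)

lemma num_points_UN:
  assumes "finite C" "\<And>c. c \<in> C \<Longrightarrow> precompact_borel (A c)" "disjoint_family_on A C"
  shows "num_points \<xi> (\<Union>c\<in>C. A c) = (\<Sum>c\<in>C. num_points \<xi> (A c))"
  unfolding num_points_def
  using assms finite_conf_measure[of _ \<xi>]
  by (intro measure_UNION') (auto simp: precompact_borel_def fmeasurable_def disjoint_family_on_def pairwise_def disjnt_def)

text \<open>Only finitely many points lie in \<open>B\<close>, and simplicity makes them distinct,
  so their pairwise distances have a positive minimum.\<close>

lemma simple_conf_separated:
  fixes \<xi> :: "'a::euclidean_space conf"
  assumes simple: "\<And>x. num_points \<xi> {x} \<le> 1" and B: "precompact_borel B"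
  obtains d where "d > 0"
    "\<And>A. A \<in> sets borel \<Longrightarrow> A \<subseteq> B \<Longrightarrow> (\<And>u v. u \<in> A \<Longrightarrow> v \<in> A \<Longrightarrow> dist u v < d) \<Longrightarrow> num_points \<xi> A \<le> 1"
proof -
  obtain I :: "nat set" and x where I: "locally_finite_points I x" and \<xi>: "\<xi> = points_conf I x"
    by (rule conf_exhaust)
  define F where "F = {i\<in>I. x i \<in> B}"
  have F: "finite F" using I B unfolding F_def locally_finite_points_def by blast
  have inj: "inj_on x I"
  proof (rule inj_onI)
    fix i j assume ij: "i \<in> I" "j \<in> I" "x i = x j"
    have pc: "precompact_borel {x i}" by (simp add: precompact_borel_bounded)
    then have "finite {k\<in>I. x k \<in> {x i}}" using I unfolding locally_finite_points_def by blast
    then have fin: "finite {k\<in>I. x k = x i}" by simp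
    have "card {k\<in>I. x k = x i} \<le> Suc 0"
      using simple[of "x i"] num_points_points_conf[OF I pc] by (simp add: \<xi>)
    then have "\<forall>k\<in>{k\<in>I. x k = x i}. \<forall>l\<in>{k\<in>I. x k = x i}. k = l"
      using card_le_Suc0_iff_eq[OF fin] by simp
    then show "i = j" using ij by fastforce
  qed
  \<comment> \<open>The extra element 1 keeps the set nonempty when \<open>B\<close> holds at most
    one point.\<close>
  define Dst where "Dst = insert 1 ((\<lambda>(i, j). dist (x i) (x j)) ` {(i, j) \<in> F \<times> F. i \<noteq> j})"
  have "finite {(i, j) \<in> F \<times> F. i \<noteq> j}"
    by (rule finite_subset[of _ "F \<times> F"]) (use F in auto)
  then have Dst: "finite Dst" "Dst \<noteq> {}"
    by (simp_all add: Dst_def)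
  have "0 < Min Dst"
    using Dst inj by (subst Min_gr_iff) (auto simp: Dst_def F_def inj_on_def)
  moreover have "num_points \<xi> A \<le> 1"
    if A: "A \<in> sets borel" "A \<subseteq> B" and d: "\<And>u v. u \<in> A \<Longrightarrow> v \<in> A \<Longrightarrow> dist u v < Min Dst" for A
  proof -
    have pc: "precompact_borel A" using precompact_borel_subset[OF B A] .
    have "i = j" if "i \<in> I" "x i \<in> A" "j \<in> I" "x j \<in> A" for i j
    proof (rule ccontr)
      assume "i \<noteq> j"
      then have "dist (x i) (x j) \<in> Dst" using that A by (auto simp: Dst_def F_def)
      then have "Min Dst \<le> dist (x i) (x j)" using Dst by auto
      then show False using d[OF that(2) that(4)] by simp
    qed
    moreover have "finite {i\<in>I. x i \<in> A}"
      using I pc unfolding locally_finite_points_def by blast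
    ultimately have "card {i\<in>I. x i \<in> A} \<le> Suc 0"
      by (subst card_le_Suc0_iff_eq) auto
    then show ?thesis by (simp add: \<xi> num_points_points_conf[OF I pc])
  qed
  ultimately show ?thesis using that by blast
qed

section \<open>Gaussian integrals over thin annuli\<close>

text \<open>\<open>lborel\<close> is characterised by the volumes of boxes, and a box in the complex
  plane has volume width times height.\<close>

lemma lborel_complex: "(lborel :: complex measure) = distr (lborel \<Otimes>\<^sub>M lborel) borel (\<lambda>(x, y). Complex x y)"
proof (rule lborel_eqI)
  have [measurable]: "(\<lambda>(x, y). Complex x y) \<in> borel_measurable (lborel \<Otimes>\<^sub>M lborel)"
    unfolding Complex_eq by measurable
  show "sets (distr (lborel \<Otimes>\<^sub>M lborel) borel (\<lambda>(x, y). Complex x y)) = sets borel" by simp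
  fix l u :: complex
  assume lu: "\<And>b. b \<in> Basis \<Longrightarrow> l \<bullet> b \<le> u \<bullet> b"
  have "Re l \<le> Re u" "Im l \<le> Im u"
    using lu[of 1] lu[of \<i>] by (auto simp: Basis_complex_def)
  moreover have "(\<lambda>(x, y). Complex x y) -` box l u \<inter> space (lborel \<Otimes>\<^sub>M lborel) = {Re l<..<Re u} \<times> {Im l<..<Im u}"
    by (auto simp: box_def Basis_complex_def space_pair_measure)
  ultimately show "emeasure (distr (lborel \<Otimes>\<^sub>M lborel) borel (\<lambda>(x, y). Complex x y)) (box l u) = (\<Prod>b\<in>Basis. (u - l) \<bullet> b)"
    by (simp add: emeasure_distr lborel.emeasure_pair_measure_Times ennreal_mult' Basis_complex_def del: lborel_prod)
qed

text \<open>Both orders of integration are provided, because the direction in which an annulus has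
  short slices is vertical at some points and horizontal at others.\<close>

lemma nn_integral_complex:
  fixes f :: "complex \<Rightarrow> ennreal"
  assumes [measurable]: "f \<in> borel_measurable borel"
  shows "(\<integral>\<^sup>+z. f z \<partial>lborel) = (\<integral>\<^sup>+x. \<integral>\<^sup>+y. f (Complex x y) \<partial>lborel \<partial>lborel)" (is ?A)
    and "(\<integral>\<^sup>+z. f z \<partial>lborel) = (\<integral>\<^sup>+y. \<integral>\<^sup>+x. f (Complex x y) \<partial>lborel \<partial>lborel)" (is ?B)
proof -
  have [measurable]: "(\<lambda>(x, y). Complex x y) \<in> borel_measurable (lborel \<Otimes>\<^sub>M lborel)"
    unfolding Complex_eq by measurable
  have "(\<integral>\<^sup>+z. f z \<partial>lborel) = (\<integral>\<^sup>+p. f (case p of (x, y) \<Rightarrow> Complex x y) \<partial>(lborel \<Otimes>\<^sub>M lborel))"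
    by (subst lborel_complex, subst nn_integral_distr) auto
  also have "\<dots> = (\<integral>\<^sup>+x. \<integral>\<^sup>+y. f (case (x, y) of (x, y) \<Rightarrow> Complex x y) \<partial>lborel \<partial>lborel)"
    by (rule lborel.nn_integral_fst[symmetric]) measurable
  finally show ?A by simp
  also have "\<dots> = (\<integral>\<^sup>+y. \<integral>\<^sup>+x. f (Complex x y) \<partial>lborel \<partial>lborel)"
    by (rule lborel_pair.Fubini'[symmetric]) (unfold Complex_eq, measurable)
  finally show ?B .
qed

text \<open>Up to sign, \<open>y\<close> runs between \<open>sqrt r\<close> and
  \<open>sqrt q\<close> with \<open>r = max p c\<close>, an interval of length
  \<open>(q - r) / (sqrt q + sqrt r)\<close>, where the denominator is at least
  \<open>sqrt c\<close>. The lower bound \<open>p\<close> may be negative.\<close>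

lemma emeasure_square_between_le:
  fixes p q c :: real
  assumes c: "0 < c" and pq: "p \<le> q"
  shows "emeasure lborel {y :: real. p \<le> y\<^sup>2 \<and> y\<^sup>2 \<le> q \<and> c \<le> y\<^sup>2} \<le> ennreal (2 * (q - p) / sqrt c)"
proof -
  define r where "r = max p c"
  have r: "0 < r" "p \<le> r" "c \<le> r" using c by (auto simp: r_def)
  show ?thesis
  proof (cases "r \<le> q")
    case False
    then have "{y :: real. p \<le> y\<^sup>2 \<and> y\<^sup>2 \<le> q \<and> c \<le> y\<^sup>2} = {}"
      by (auto simp: r_def max_def split: if_splits)
    then show ?thesis by (simp only: emeasure_empty zero_le)
  next
    case True
    have sub: "{y :: real. p \<le> y\<^sup>2 \<and> y\<^sup>2 \<le> q \<and> c \<le> y\<^sup>2} \<subseteq> {sqrt r..sqrt q} \<union> {- sqrt q..- sqrt r}"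
    proof
      fix y assume "y \<in> {y :: real. p \<le> y\<^sup>2 \<and> y\<^sup>2 \<le> q \<and> c \<le> y\<^sup>2}"
      then have "r \<le> y\<^sup>2" "y\<^sup>2 \<le> q" by (auto simp: r_def)
      then have "sqrt r \<le> \<bar>y\<bar>" "\<bar>y\<bar> \<le> sqrt q"
        by (metis real_sqrt_abs real_sqrt_le_mono)+
      then show "y \<in> {sqrt r..sqrt q} \<union> {- sqrt q..- sqrt r}" by auto
    qed
    have "sqrt c * (sqrt q - sqrt r) \<le> (sqrt q + sqrt r) * (sqrt q - sqrt r)"
      using r True by (intro mult_right_mono) (auto simp: add_increasing)
    also have "\<dots> = q - r"
      using r True by (simp add: algebra_simps)
    also have "\<dots> \<le> q - p" using r by simp
    finally have *: "sqrt q - sqrt r \<le> (q - p) / sqrt c"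
      using c by (simp add: field_simps)
    have "emeasure lborel {y :: real. p \<le> y\<^sup>2 \<and> y\<^sup>2 \<le> q \<and> c \<le> y\<^sup>2}
        \<le> emeasure lborel ({sqrt r..sqrt q} \<union> {- sqrt q..- sqrt r})"
      by (rule emeasure_mono[OF sub]) auto
    also have "\<dots> \<le> emeasure lborel {sqrt r..sqrt q} + emeasure lborel {- sqrt q..- sqrt r}"
      by (rule emeasure_subadditive) auto
    also have "\<dots> = ennreal (2 * (sqrt q - sqrt r))"
      using True by (simp flip: ennreal_plus)
    also have "\<dots> \<le> ennreal (2 * (q - p) / sqrt c)"
      using mult_left_mono[OF *, of 2] by (intro ennreal_leI) (simp only: times_divide_eq_right)
    finally show ?thesis .
  qed
qed

lemma nn_integral_gaussian: "(\<integral>\<^sup>+x. ennreal (exp (- (x - c)\<^sup>2 / 2)) \<partial>lborel) = ennreal (sqrt (2 * pi))"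
proof -
  have "(\<integral>\<^sup>+x. ennreal (exp (- (x - c)\<^sup>2 / 2)) \<partial>lborel)
      = (\<integral>\<^sup>+x. ennreal (sqrt (2 * pi)) * ennreal (normal_density c 1 x) \<partial>lborel)"
    by (intro nn_integral_cong) (simp add: normal_density_def flip: ennreal_mult)
  also have "\<dots> = ennreal (sqrt (2 * pi)) * (\<integral>\<^sup>+x. ennreal (normal_density c 1 x) \<partial>lborel)"
    by (rule nn_integral_cmult) auto
  also have "(\<integral>\<^sup>+x. ennreal (normal_density c 1 x) \<partial>lborel) = 1"
    by (subst nn_integral_eq_integral) (auto simp: integral_normal_density integrable_normal_density)
  finally show ?thesis by simp
qed

text \<open>On a point of a thin annulus of large radius one coordinate is of the order of the radius, and
  the slice of the annulus in the direction of that coordinate is short.\<close>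

lemma nn_integral_gaussian_annulus_le:
  fixes z :: complex and a b :: real
  assumes a: "0 < a" and ab: "a \<le> b"
  shows "(\<integral>\<^sup>+w. ennreal (exp (- (cmod (z - w))\<^sup>2 / 2)) * indicator {w. a \<le> (cmod w)\<^sup>2 \<and> (cmod w)\<^sup>2 \<le> b} w \<partial>lborel)
    \<le> ennreal (4 * sqrt (2 * pi) * (b - a) / sqrt (a / 2))"
proof -
  \<comment> \<open>The squares of the coordinates sum to at least \<open>a\<close>, so one of them
    is at least \<open>a / 2\<close>. The annulus is thus covered by \<open>X\<close> and
    \<open>Y\<close>.\<close>
  define Y where "Y = {w. a \<le> (cmod w)\<^sup>2 \<and> (cmod w)\<^sup>2 \<le> b \<and> a / 2 \<le> (Im w)\<^sup>2}"
  define X where "X = {w. a \<le> (cmod w)\<^sup>2 \<and> (cmod w)\<^sup>2 \<le> b \<and> a / 2 \<le> (Re w)\<^sup>2}"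
  have [measurable]: "X \<in> sets borel" "Y \<in> sets borel"
    unfolding X_def Y_def by measurable
  have "(\<integral>\<^sup>+w. ennreal (exp (- (cmod (z - w))\<^sup>2 / 2)) * indicator {w. a \<le> (cmod w)\<^sup>2 \<and> (cmod w)\<^sup>2 \<le> b} w \<partial>lborel)
    \<le> (\<integral>\<^sup>+w. (ennreal (exp (- (Re w - Re z)\<^sup>2 / 2)) * indicator Y w + ennreal (exp (- (Im w - Im z)\<^sup>2 / 2)) * indicator X w) \<partial>lborel)"
  proof (rule nn_integral_mono)
    fix w
    \<comment> \<open>The Gaussian factor in the slicing coordinate is dropped, which leaves a
      weight that is constant along each slice.\<close>
    have 1: "exp (- (cmod (z - w))\<^sup>2 / 2) \<le> exp (- (Re w - Re z)\<^sup>2 / 2)"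
      "exp (- (cmod (z - w))\<^sup>2 / 2) \<le> exp (- (Im w - Im z)\<^sup>2 / 2)"
      by (simp_all add: cmod_power2 power2_commute)
    have 2: "w \<in> X \<or> w \<in> Y" if "a \<le> (cmod w)\<^sup>2 \<and> (cmod w)\<^sup>2 \<le> b"
    proof (rule ccontr)
      assume "\<not> (w \<in> X \<or> w \<in> Y)"
      then have "(Re w)\<^sup>2 < a / 2" "(Im w)\<^sup>2 < a / 2" using that by (auto simp: X_def Y_def)
      then show False using that cmod_power2[of w] by linarith
    qed
    show "ennreal (exp (- (cmod (z - w))\<^sup>2 / 2)) * indicator {w. a \<le> (cmod w)\<^sup>2 \<and> (cmod w)\<^sup>2 \<le> b} w
      \<le> ennreal (exp (- (Re w - Re z)\<^sup>2 / 2)) * indicator Y w + ennreal (exp (- (Im w - Im z)\<^sup>2 / 2)) * indicator X w"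
    proof (cases "a \<le> (cmod w)\<^sup>2 \<and> (cmod w)\<^sup>2 \<le> b")
      case True
      then consider "w \<in> X" | "w \<in> Y" using 2 by auto
      then show ?thesis
      proof cases
        case 1
        with True \<open>exp (- (cmod (z - w))\<^sup>2 / 2) \<le> exp (- (Im w - Im z)\<^sup>2 / 2)\<close> show ?thesis
          by (auto intro!: add_increasing ennreal_leI)
      next
        case 2
        with True \<open>exp (- (cmod (z - w))\<^sup>2 / 2) \<le> exp (- (Re w - Re z)\<^sup>2 / 2)\<close> show ?thesis
          by (auto intro!: add_increasing2 ennreal_leI)
      qed
    qed auto
  qed
  also have "\<dots> = (\<integral>\<^sup>+w. ennreal (exp (- (Re w - Re z)\<^sup>2 / 2)) * indicator Y w \<partial>lborel)
      + (\<integral>\<^sup>+w. ennreal (exp (- (Im w - Im z)\<^sup>2 / 2)) * indicator X w \<partial>lborel)"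
    by (rule nn_integral_add) measurable
  also have "(\<integral>\<^sup>+w. ennreal (exp (- (Re w - Re z)\<^sup>2 / 2)) * indicator Y w \<partial>lborel)
      = (\<integral>\<^sup>+x. \<integral>\<^sup>+y. ennreal (exp (- (x - Re z)\<^sup>2 / 2)) * indicator Y (Complex x y) \<partial>lborel \<partial>lborel)"
    by (subst nn_integral_complex(1)) simp_all
  also have "\<dots> \<le> (\<integral>\<^sup>+x. ennreal (exp (- (x - Re z)\<^sup>2 / 2)) * ennreal (2 * (b - a) / sqrt (a / 2)) \<partial>lborel)"
  proof (rule nn_integral_mono)
    fix x :: real
    \<comment> \<open>Fixing \<open>x\<close> shifts both bounds by the square of \<open>x\<close>,
      so their difference is \<open>b - a\<close> on every slice.\<close>
    have eq: "indicator Y (Complex x y) = (indicator {y. a - x\<^sup>2 \<le> y\<^sup>2 \<and> y\<^sup>2 \<le> b - x\<^sup>2 \<and> a / 2 \<le> y\<^sup>2} y :: ennreal)" for y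
      by (auto simp: Y_def cmod_power2 indicator_def)
    have "(\<integral>\<^sup>+y. ennreal (exp (- (x - Re z)\<^sup>2 / 2)) * indicator Y (Complex x y) \<partial>lborel)
       = ennreal (exp (- (x - Re z)\<^sup>2 / 2)) * emeasure lborel {y. a - x\<^sup>2 \<le> y\<^sup>2 \<and> y\<^sup>2 \<le> b - x\<^sup>2 \<and> a / 2 \<le> y\<^sup>2}"
      unfolding eq by (subst nn_integral_cmult) auto
    also have "\<dots> \<le> ennreal (exp (- (x - Re z)\<^sup>2 / 2)) * ennreal (2 * ((b - x\<^sup>2) - (a - x\<^sup>2)) / sqrt (a / 2))"
      using a ab by (intro mult_left_mono emeasure_square_between_le) auto
    finally show "(\<integral>\<^sup>+y. ennreal (exp (- (x - Re z)\<^sup>2 / 2)) * indicator Y (Complex x y) \<partial>lborel)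
      \<le> ennreal (exp (- (x - Re z)\<^sup>2 / 2)) * ennreal (2 * (b - a) / sqrt (a / 2))" by simp
  qed
  also have "\<dots> = ennreal (sqrt (2 * pi)) * ennreal (2 * (b - a) / sqrt (a / 2))"
    using nn_integral_gaussian by (subst nn_integral_multc) auto
  also have "(\<integral>\<^sup>+w. ennreal (exp (- (Im w - Im z)\<^sup>2 / 2)) * indicator X w \<partial>lborel)
      = (\<integral>\<^sup>+y. \<integral>\<^sup>+x. ennreal (exp (- (y - Im z)\<^sup>2 / 2)) * indicator X (Complex x y) \<partial>lborel \<partial>lborel)"
    by (subst nn_integral_complex(2)) simp_all
  also have "\<dots> \<le> (\<integral>\<^sup>+y. ennreal (exp (- (y - Im z)\<^sup>2 / 2)) * ennreal (2 * (b - a) / sqrt (a / 2)) \<partial>lborel)"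
  proof (rule nn_integral_mono)
    fix y :: real
    have eq: "indicator X (Complex x y) = (indicator {x. a - y\<^sup>2 \<le> x\<^sup>2 \<and> x\<^sup>2 \<le> b - y\<^sup>2 \<and> a / 2 \<le> x\<^sup>2} x :: ennreal)" for x
      by (auto simp: X_def cmod_power2 indicator_def)
    have "(\<integral>\<^sup>+x. ennreal (exp (- (y - Im z)\<^sup>2 / 2)) * indicator X (Complex x y) \<partial>lborel)
       = ennreal (exp (- (y - Im z)\<^sup>2 / 2)) * emeasure lborel {x. a - y\<^sup>2 \<le> x\<^sup>2 \<and> x\<^sup>2 \<le> b - y\<^sup>2 \<and> a / 2 \<le> x\<^sup>2}"
      unfolding eq by (subst nn_integral_cmult) auto
    also have "\<dots> \<le> ennreal (exp (- (y - Im z)\<^sup>2 / 2)) * ennreal (2 * ((b - y\<^sup>2) - (a - y\<^sup>2)) / sqrt (a / 2))"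
      using a ab by (intro mult_left_mono emeasure_square_between_le) auto
    finally show "(\<integral>\<^sup>+x. ennreal (exp (- (y - Im z)\<^sup>2 / 2)) * indicator X (Complex x y) \<partial>lborel)
      \<le> ennreal (exp (- (y - Im z)\<^sup>2 / 2)) * ennreal (2 * (b - a) / sqrt (a / 2))" by simp
  qed
  also have "\<dots> = ennreal (sqrt (2 * pi)) * ennreal (2 * (b - a) / sqrt (a / 2))"
    using nn_integral_gaussian by (subst nn_integral_multc) auto
  also have "ennreal (sqrt (2 * pi)) * ennreal (2 * (b - a) / sqrt (a / 2)) + ennreal (sqrt (2 * pi)) * ennreal (2 * (b - a) / sqrt (a / 2))
      = ennreal (4 * sqrt (2 * pi) * (b - a) / sqrt (a / 2))"
    using ab a by (simp flip: ennreal_mult ennreal_plus add: field_simps)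
  finally show ?thesis by (simp add: add_mono)
qed

section \<open>Elementary symmetric sums over distinct cells\<close>

definition distinct_lists :: "'c set \<Rightarrow> nat \<Rightarrow> 'c list set" where
  "distinct_lists C k = {xs. length xs = k \<and> distinct xs \<and> set xs \<subseteq> C}"

lemma finite_distinct_lists: "finite C \<Longrightarrow> finite (distinct_lists C k)"
  unfolding distinct_lists_def
  by (rule finite_subset[OF _ finite_lists_length_eq[of C k]]) auto

lemma sum_distinct_lists_0: "(\<Sum>xs\<in>distinct_lists C 0. F xs) = F []"
proof -
  have "distinct_lists C 0 = {[]}" by (auto simp: distinct_lists_def)
  then show ?thesis by simp
qed

lemma sum_distinct_lists_Suc:
  assumes "finite C"
  shows "(\<Sum>xs\<in>distinct_lists C (Suc k). F xs) = (\<Sum>xs\<in>distinct_lists C k. \<Sum>c\<in>C - set xs. F (c # xs))"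
proof -
  have "(\<Sum>xs\<in>distinct_lists C k. \<Sum>c\<in>C - set xs. F (c # xs))
     = (\<Sum>(xs, c)\<in>Sigma (distinct_lists C k) (\<lambda>xs. C - set xs). F (c # xs))"
    using assms by (intro sum.Sigma) (auto simp: finite_distinct_lists)
  also have "\<dots> = (\<Sum>xs\<in>distinct_lists C (Suc k). F xs)"
    by (rule sum.reindex_bij_witness[where i="\<lambda>xs. (tl xs, hd xs)" and j="\<lambda>(xs, c). c # xs"])
      (auto simp: distinct_lists_def length_Suc_conv)
  finally show ?thesis ..
qed

text \<open>This is \<open>fact k\<close> times the elementary symmetric polynomial of degree
  \<open>k\<close>, as each set of \<open>k\<close> cells occurs in all its orders.\<close>

definition esum :: "'c set \<Rightarrow> ('c \<Rightarrow> real) \<Rightarrow> nat \<Rightarrow> real" where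
  "esum C a k = (\<Sum>xs\<in>distinct_lists C k. prod_list (map a xs))"

lemma esum_0 [simp]: "esum C a 0 = 1"
  by (simp add: esum_def sum_distinct_lists_0)

lemma esum_Suc:
  assumes "finite C"
  shows "esum C a (Suc k) = (\<Sum>xs\<in>distinct_lists C k. (sum a C - sum a (set xs)) * prod_list (map a xs))"
  unfolding esum_def sum_distinct_lists_Suc[OF assms]
proof (intro sum.cong refl)
  fix xs assume "xs \<in> distinct_lists C k"
  then have "set xs \<subseteq> C" by (simp add: distinct_lists_def)
  then show "(\<Sum>c\<in>C - set xs. prod_list (map a (c # xs))) = (sum a C - sum a (set xs)) * prod_list (map a xs)"
    using assms by (simp add: sum_diff flip: sum_distrib_right)
qed

lemma prod_list_map_nonneg: "(\<And>c. c \<in> set xs \<Longrightarrow> 0 \<le> a c) \<Longrightarrow> 0 \<le> prod_list (map a xs)" for a :: "'c \<Rightarrow> real"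
  by (induction xs) auto

lemma esum_nonneg:
  assumes "\<And>c. c \<in> C \<Longrightarrow> 0 \<le> a c"
  shows "0 \<le> esum C a k"
  unfolding esum_def using assms by (intro sum_nonneg prod_list_map_nonneg) (auto simp: distinct_lists_def)

text \<open>The falling factorial, whose expectation at a random count is the factorial moment of
  order \<open>k\<close>.\<close>

definition ffact :: "real \<Rightarrow> nat \<Rightarrow> real" where
  "ffact s k = (\<Prod>i<k. s - real i)"

lemma ffact_of_nat: "ffact (real n) k = fact k * real (n choose k)"
proof -
  have "real (n choose k) = (\<Prod>i<k. real n - real i) / fact k"
    by (simp add: binomial_gbinomial gbinomial_prod_rev atLeast0LessThan)
  then show ?thesis by (simp add: ffact_def)
qed

text \<open>If \<open>a\<close> counts points in cells, the left side counts \<open>k\<close>-tuples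
  of points from distinct cells and the right side all \<open>k\<close>-tuples of distinct
  points.\<close>

lemma esum_le_ffact:
  assumes C: "finite C" and a: "\<And>c. c \<in> C \<Longrightarrow> a c \<in> \<nat>"
  shows "esum C a k \<le> ffact (sum a C) k"
proof (induction k)
  case 0
  then show ?case by (simp add: ffact_def)
next
  case (Suc k)
  have nn: "0 \<le> a c" if "c \<in> C" for c using a[OF that] by (auto elim: Nats_cases)
  have "(sum a C - sum a (set xs)) * prod_list (map a xs) \<le> (sum a C - real k) * prod_list (map a xs)"
    if xs: "xs \<in> distinct_lists C k" for xs
  \<comment> \<open>A tuple with an empty cell has product 0. Otherwise each of its \<open>k\<close>
    cells holds at least one point, so at most \<open>sum a C - k\<close> points remain.\<close>
  proof (cases "\<exists>c\<in>set xs. a c = 0")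
    case True
    then have "prod_list (map a xs) = 0" by (force simp: prod_list_zero_iff)
    then show ?thesis by (simp only: mult_zero_right order_refl)
  next
    case False
    have "1 \<le> a c" if "c \<in> set xs" for c
    proof -
      have "a c \<in> \<nat>" using a that xs by (auto simp: distinct_lists_def)
      then obtain n where "a c = real n" by (auto elim: Nats_cases)
      then show ?thesis using False that by (cases n) auto
    qed
    then have "real k \<le> sum a (set xs)"
      using sum_bounded_below[of "set xs" 1 a] xs by (simp add: distinct_lists_def distinct_card)
    then show ?thesis
      using nn xs by (intro mult_right_mono prod_list_map_nonneg) (auto simp: distinct_lists_def)
  qed
  then have "esum C a (Suc k) \<le> (\<Sum>xs\<in>distinct_lists C k. (sum a C - real k) * prod_list (map a xs))"
    unfolding esum_Suc[OF C] by (rule sum_mono)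
  also have "\<dots> = (sum a C - real k) * esum C a k"
    by (simp add: esum_def sum_distrib_left)
  also have "\<dots> \<le> ffact (sum a C) (Suc k)"
  proof -
    have "sum a C \<in> \<nat>" using C a by (induction C rule: finite_induct) auto
    then obtain n where n: "sum a C = real n" by (auto elim: Nats_cases)
    show ?thesis
    proof (cases "k \<le> n")
      case True
      then show ?thesis using mult_left_mono[OF Suc.IH, of "real n - real k"]
        by (simp add: n ffact_def mult.commute)
    next
      \<comment> \<open>For \<open>k > n\<close> the factor is negative and the induction hypothesis
        cannot be multiplied by it; here the sign alone decides.\<close>
      case False
      then have "(sum a C - real k) * esum C a k \<le> 0"
        using esum_nonneg[of C a k] nn by (intro mult_nonpos_nonneg) (auto simp: n)
      also have "0 \<le> ffact (sum a C) (Suc k)"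
        unfolding n ffact_of_nat by simp
      finally show ?thesis .
    qed
  qed
  finally show ?case .
qed

text \<open>With at most one point per cell, distinct points lie in distinct cells, so the
  inequality \<open>esum_le_ffact\<close> is sharp.\<close>

lemma esum_eq_ffact:
  assumes C: "finite C" and a: "\<And>c. c \<in> C \<Longrightarrow> a c = 0 \<or> a c = 1"
  shows "esum C a k = ffact (sum a C) k"
proof (induction k)
  case 0
  then show ?case by (simp add: ffact_def)
next
  case (Suc k)
  have "(sum a C - sum a (set xs)) * prod_list (map a xs) = (sum a C - real k) * prod_list (map a xs)"
    if xs: "xs \<in> distinct_lists C k" for xs
  proof (cases "\<exists>c\<in>set xs. a c = 0")
    case True
    then have "prod_list (map a xs) = 0" by (force simp: prod_list_zero_iff)
    then show ?thesis by (simp only: mult_zero_right order_refl)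
  next
    case False
    then have "sum a (set xs) = sum (\<lambda>_. 1) (set xs)"
      using a xs by (intro sum.cong) (auto simp: distinct_lists_def)
    then show ?thesis
      using xs by (simp add: distinct_lists_def distinct_card)
  qed
  then have "esum C a (Suc k) = (\<Sum>xs\<in>distinct_lists C k. (sum a C - real k) * prod_list (map a xs))"
    unfolding esum_Suc[OF C] by (intro sum.cong) auto
  also have "\<dots> = (sum a C - real k) * esum C a k"
    by (simp add: esum_def sum_distrib_left)
  finally show ?case using Suc.IH by (simp add: ffact_def)
qed

text \<open>In the recursion the next cell avoids the \<open>k\<close> cells already used, whose
  total weight is at most \<open>k * d n\<close>. Passing from \<open>k\<close> to
  \<open>Suc k\<close> therefore multiplies the limit by \<open>s\<close>.\<close>

lemma tendsto_esum:
  fixes C :: "nat \<Rightarrow> 'c set" and a :: "nat \<Rightarrow> 'c \<Rightarrow> real" and d :: "nat \<Rightarrow> real"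
  assumes C: "\<And>n. finite (C n)" and a: "\<And>n c. c \<in> C n \<Longrightarrow> 0 \<le> a n c" "\<And>n c. c \<in> C n \<Longrightarrow> a n c \<le> d n"
    and s: "\<And>n. sum (a n) (C n) = s" and d: "d \<longlonglongrightarrow> 0"
  shows "(\<lambda>n. esum (C n) (a n) k) \<longlonglongrightarrow> s ^ k"
proof (induction k)
  case 0
  then show ?case by simp
next
  case (Suc k)
  have bounds: "(s - real k * d n) * esum (C n) (a n) k \<le> esum (C n) (a n) (Suc k)
      \<and> esum (C n) (a n) (Suc k) \<le> s * esum (C n) (a n) k" for n
  proof -
    have "(s - real k * d n) * prod_list (map (a n) xs) \<le> (s - sum (a n) (set xs)) * prod_list (map (a n) xs)
        \<and> (s - sum (a n) (set xs)) * prod_list (map (a n) xs) \<le> s * prod_list (map (a n) xs)"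
      if xs: "xs \<in> distinct_lists (C n) k" for xs
    proof -
      have "sum (a n) (set xs) \<le> real k * d n"
        using sum_bounded_above[of "set xs" "a n" "d n"] a(2)[of _ n] xs
        by (simp add: distinct_lists_def distinct_card subset_eq)
      moreover have "0 \<le> sum (a n) (set xs)"
        using a(1) xs by (intro sum_nonneg) (auto simp: distinct_lists_def)
      moreover have "0 \<le> prod_list (map (a n) xs)"
        using a(1) xs by (intro prod_list_map_nonneg) (auto simp: distinct_lists_def)
      ultimately show ?thesis by (auto intro!: mult_right_mono)
    qed
    then have "(\<Sum>xs\<in>distinct_lists (C n) k. (s - real k * d n) * prod_list (map (a n) xs))
        \<le> (\<Sum>xs\<in>distinct_lists (C n) k. (s - sum (a n) (set xs)) * prod_list (map (a n) xs))"
      "(\<Sum>xs\<in>distinct_lists (C n) k. (s - sum (a n) (set xs)) * prod_list (map (a n) xs))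
        \<le> (\<Sum>xs\<in>distinct_lists (C n) k. s * prod_list (map (a n) xs))"
      by (blast intro: sum_mono)+
    then show ?thesis
      unfolding esum_Suc[OF C] s by (simp add: esum_def sum_distrib_left)
  qed
  have "(\<lambda>n. (s - real k * d n) * esum (C n) (a n) k) \<longlonglongrightarrow> (s - real k * 0) * s ^ k"
    by (intro tendsto_intros Suc.IH d)
  then have 1: "(\<lambda>n. (s - real k * d n) * esum (C n) (a n) k) \<longlonglongrightarrow> s ^ Suc k"
    by simp
  have "(\<lambda>n. s * esum (C n) (a n) k) \<longlonglongrightarrow> s * s ^ k"
    by (intro tendsto_intros Suc.IH)
  then have 2: "(\<lambda>n. s * esum (C n) (a n) k) \<longlonglongrightarrow> s ^ Suc k"
    by simp
  show ?case
    by (rule tendsto_sandwich[OF _ _ 1 2]) (simp_all add: bounds)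
qed

lemma sum_alternating_binomial_Suc:
  "(\<Sum>j\<le>k. (-1) ^ j * real (Suc n choose j)) = (-1) ^ k * real (n choose k)"
  by (induction k) (auto simp: algebra_simps)

text \<open>Bonferroni's inequalities for a single count: by Pascal's rule the alternating sum
  telescopes, so for positive \<open>n\<close> the truncation error is exactly \<open>n - 1\<close>
  choose \<open>k\<close>, which is at most \<open>n\<close> choose \<open>k\<close>.\<close>

lemma zero_indicator_binomial_approx:
  "\<bar>of_bool (n = 0) - (\<Sum>j\<le>k. (-1) ^ j * real (n choose j))\<bar> \<le> real (n choose k)"
proof (cases n)
  case 0
  have "(\<Sum>j\<le>k. (-1) ^ j * real (0 choose j)) = 1"
    by (subst sum.atMost_shift) simp
  then show ?thesis using 0 by simp
next
  case (Suc m)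
  have "m choose k \<le> Suc m choose k" by (cases k) auto
  then show ?thesis unfolding Suc sum_alternating_binomial_Suc by (simp add: abs_mult)
qed

section \<open>Factorial moments of the Ginibre ensemble\<close>

definition gauss_pairs :: "nat \<Rightarrow> (nat \<Rightarrow> complex) \<Rightarrow> real" where
  "gauss_pairs k x = (\<Sum>j<k. \<Sum>i\<in>{..<k} - {j}. exp (- (cmod (x i - x j))\<^sup>2 / 2))"

definition ginibre_det :: "nat \<Rightarrow> (nat \<Rightarrow> complex) \<Rightarrow> complex" where
  "ginibre_det k x = Determinant.det (Matrix.mat k k (\<lambda>(i, j). ginibre_kernel (x i) (x j)))"

lemma norm_ginibre_kernel: "cmod (ginibre_kernel z w) = exp (- (cmod (z - w))\<^sup>2 / 2) / pi"
proof -
  have "(Re z * Re w + Im z * Im w) - (cmod z)\<^sup>2 / 2 - (cmod w)\<^sup>2 / 2 = - (cmod (z - w))\<^sup>2 / 2"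
    unfolding cmod_power2 by (simp add: power2_eq_square field_simps)
  then show ?thesis
    by (simp add: ginibre_kernel_def norm_mult norm_divide)
qed

lemma ginibre_kernel_self: "ginibre_kernel z z = of_real (1 / pi)"
  unfolding ginibre_kernel_def complex_norm_square[symmetric] by (simp flip: of_real_diff)

text \<open>In the Leibniz expansion the identity contributes \<open>(1 / pi) ^ k\<close>. Any other
  permutation moves some index, and the corresponding factor couples two different points.\<close>

lemma ginibre_det_approx: "cmod (ginibre_det k x - of_real ((1 / pi) ^ k)) \<le> fact k / pi ^ k * gauss_pairs k x"
proof -
  define t where "t p = signof p * (\<Prod>i = 0..<k. ginibre_kernel (x i) (x (p i)))" for p
  define P where "P = {p. p permutes {0..<k}}"
  have P: "finite P" "id \<in> P" "card P = fact k"
    by (auto simp: P_def finite_permutations permutes_id card_permutations)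
  have det: "ginibre_det k x = (\<Sum>p\<in>P. t p)"
    unfolding ginibre_det_def t_def P_def
    by (subst det_def'[of _ k]) (auto intro!: sum.cong prod.cong simp: permutes_in_image)
  have "t id = of_real ((1 / pi) ^ k)"
    by (simp add: t_def ginibre_kernel_self)
  then have "ginibre_det k x - of_real ((1 / pi) ^ k) = (\<Sum>p\<in>P - {id}. t p)"
    using P by (simp add: det sum.remove[of P id])
  also have "cmod \<dots> \<le> (\<Sum>p\<in>P - {id}. cmod (t p))" by (rule norm_sum)
  also have "\<dots> \<le> (\<Sum>p\<in>P - {id}. gauss_pairs k x / pi ^ k)"
  proof (rule sum_mono)
    fix p assume "p \<in> P - {id}"
    then have p: "p permutes {0..<k}" "p \<noteq> id" by (auto simp: P_def)
    then obtain i where i: "i < k" "p i \<noteq> i"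
      by (metis atLeastLessThan_iff eq_id_iff permutes_not_in zero_le)
    have pi: "p i < k" using permutes_in_image[OF p(1), of i] i by simp
    have sg: "cmod (signof p) = 1" by (simp add: sign_def)
    have "cmod (t p) = (\<Prod>i\<in>{0..<k}. exp (- (cmod (x i - x (p i)))\<^sup>2 / 2) / pi)"
      unfolding t_def norm_mult sg by (simp add: norm_ginibre_kernel flip: prod_norm)
    also have "\<dots> = (\<Prod>i\<in>{0..<k}. exp (- (cmod (x i - x (p i)))\<^sup>2 / 2)) / pi ^ k"
      by (simp add: prod_dividef)
    \<comment> \<open>One factor with \<open>p i \<noteq> i\<close> is kept; all the others are at
      most 1.\<close>
    also have "(\<Prod>i\<in>{0..<k}. exp (- (cmod (x i - x (p i)))\<^sup>2 / 2)) \<le> exp (- (cmod (x i - x (p i)))\<^sup>2 / 2)"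
    proof -
      have "(\<Prod>i\<in>{0..<k} - {i}. exp (- (cmod (x i - x (p i)))\<^sup>2 / 2)) \<le> 1"
        by (rule prod_le_1) auto
      then show ?thesis
        using i by (subst prod.remove[of _ i]) (auto intro: mult_left_le)
    qed
    \<comment> \<open>Enlarging the one remaining term to the sum over all pairs makes the bound
      independent of the permutation.\<close>
    also have "exp (- (cmod (x i - x (p i)))\<^sup>2 / 2) \<le> (\<Sum>l\<in>{..<k} - {p i}. exp (- (cmod (x l - x (p i)))\<^sup>2 / 2))"
      using i by (intro member_le_sum) auto
    also have "\<dots> \<le> gauss_pairs k x"
    proof -
      define g where "g j = (\<Sum>i\<in>{..<k} - {j}. exp (- (cmod (x i - x j))\<^sup>2 / 2))" for j
      have "g (p i) \<le> sum g {..<k}"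
        using pi by (intro member_le_sum) (auto simp: g_def intro: sum_nonneg)
      then show ?thesis by (simp add: g_def gauss_pairs_def)
    qed
    finally show "cmod (t p) \<le> gauss_pairs k x / pi ^ k"
      by (simp add: divide_right_mono)
  qed
  also have "\<dots> = real (card P - 1) * (gauss_pairs k x / pi ^ k)"
    using P by simp
  also have "\<dots> \<le> fact k * (gauss_pairs k x / pi ^ k)"
  proof (rule mult_right_mono)
    have "real (card P - 1) \<le> real (card P)" by simp
    then show "real (card P - 1) \<le> fact k" by (simp add: P)
    show "0 \<le> gauss_pairs k x / pi ^ k"
      unfolding gauss_pairs_def by (intro divide_nonneg_nonneg sum_nonneg) auto
  qed
  finally show ?thesis by simp
qed

lemma measurable_gauss_pair [measurable]:
  assumes "i \<in> I" "j \<in> I"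
  shows "(\<lambda>x. exp (- (cmod (x i - x j))\<^sup>2 / 2)) \<in> borel_measurable (Pi\<^sub>M I (\<lambda>_. lborel))"
proof -
  have [measurable]: "(\<lambda>x. x i) \<in> borel_measurable (Pi\<^sub>M I (\<lambda>_. lborel))"
    "(\<lambda>x. x j) \<in> borel_measurable (Pi\<^sub>M I (\<lambda>_. lborel))"
    using measurable_component_singleton[of i I "\<lambda>_. lborel"] measurable_component_singleton[of j I "\<lambda>_. lborel"] assms
    by simp_all
  show ?thesis by measurable
qed

text \<open>Integrating the coordinate \<open>j\<close> first costs at most \<open>s\<close>,
  uniformly in the position of \<open>x i\<close>. Each of the other \<open>k - 1\<close>
  coordinates then contributes the area \<open>m\<close>.\<close>

lemma nn_integral_gauss_pair_le:
  fixes D :: "complex set"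
  assumes [measurable]: "D \<in> sets borel" and m: "emeasure lborel D = ennreal m" "0 \<le> m"
    and s: "\<And>z. (\<integral>\<^sup>+w. ennreal (exp (- (cmod (z - w))\<^sup>2 / 2)) * indicator D w \<partial>lborel) \<le> ennreal s"
    and ij: "i < k" "j < k" "i \<noteq> j"
  shows "(\<integral>\<^sup>+x. ennreal (exp (- (cmod (x i - x j))\<^sup>2 / 2)) * indicator (Pi\<^sub>E {..<k} (\<lambda>_. D)) x \<partial>(Pi\<^sub>M {..<k} (\<lambda>_. lborel)))
    \<le> ennreal (m ^ (k - 1)) * ennreal s"
proof -
  interpret product_sigma_finite "\<lambda>_::nat. lborel :: complex measure" by standard
  define J where "J = {..<k} - {j}"
  have J: "finite J" "j \<notin> J" "insert j J = {..<k}" "i \<in> J" using ij by (auto simp: J_def)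
  have [measurable]: "Pi\<^sub>E I (\<lambda>_. D) \<in> sets (Pi\<^sub>M I (\<lambda>_. lborel))" if "finite I" for I :: "nat set"
    using that by (intro sets_PiM_I_finite) auto
  have "(\<integral>\<^sup>+x. ennreal (exp (- (cmod (x i - x j))\<^sup>2 / 2)) * indicator (Pi\<^sub>E {..<k} (\<lambda>_. D)) x \<partial>(Pi\<^sub>M {..<k} (\<lambda>_. lborel)))
     = (\<integral>\<^sup>+x. \<integral>\<^sup>+y. ennreal (exp (- (cmod ((x(j := y)) i - (x(j := y)) j))\<^sup>2 / 2)) * indicator (Pi\<^sub>E {..<k} (\<lambda>_. D)) (x(j := y)) \<partial>lborel
           \<partial>(Pi\<^sub>M J (\<lambda>_. lborel)))"
    unfolding J(3)[symmetric]
    by (rule product_nn_integral_insert[OF J(1,2)])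
      (intro borel_measurable_times_ennreal borel_measurable_indicator measurable_compose[OF measurable_gauss_pair measurable_ennreal], use J in auto)
  also have "\<dots> \<le> (\<integral>\<^sup>+x. indicator (Pi\<^sub>E J (\<lambda>_. D)) x * ennreal s \<partial>(Pi\<^sub>M J (\<lambda>_. lborel)))"
  proof (rule nn_integral_mono)
    fix x assume "x \<in> space (Pi\<^sub>M J (\<lambda>_. lborel :: complex measure))"
    then have x: "x \<in> extensional J" by (auto simp: space_PiM PiE_def)
    have ind: "indicator (Pi\<^sub>E {..<k} (\<lambda>_. D)) (x(j := y)) = (indicator (Pi\<^sub>E J (\<lambda>_. D)) x * indicator D y :: ennreal)" for y
    proof -
      have "x(j := y) \<in> Pi\<^sub>E {..<k} (\<lambda>_. D) \<longleftrightarrow> x \<in> Pi\<^sub>E J (\<lambda>_. D) \<and> y \<in> D"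
        using x J(2) unfolding J(3)[symmetric] by (auto simp: PiE_def Pi_iff extensional_def)
      then show ?thesis by (auto simp: indicator_def)
    qed
    have "(\<integral>\<^sup>+y. ennreal (exp (- (cmod ((x(j := y)) i - (x(j := y)) j))\<^sup>2 / 2)) * indicator (Pi\<^sub>E {..<k} (\<lambda>_. D)) (x(j := y)) \<partial>lborel)
      = (\<integral>\<^sup>+y. indicator (Pi\<^sub>E J (\<lambda>_. D)) x * (ennreal (exp (- (cmod (x i - y))\<^sup>2 / 2)) * indicator D y) \<partial>lborel)"
      using ij by (intro nn_integral_cong) (simp add: ind ac_simps)
    also have "\<dots> = indicator (Pi\<^sub>E J (\<lambda>_. D)) x * (\<integral>\<^sup>+y. ennreal (exp (- (cmod (x i - y))\<^sup>2 / 2)) * indicator D y \<partial>lborel)"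
      by (rule nn_integral_cmult) measurable
    also have "\<dots> \<le> indicator (Pi\<^sub>E J (\<lambda>_. D)) x * ennreal s"
      by (intro mult_left_mono s) auto
    finally show "(\<integral>\<^sup>+y. ennreal (exp (- (cmod ((x(j := y)) i - (x(j := y)) j))\<^sup>2 / 2)) * indicator (Pi\<^sub>E {..<k} (\<lambda>_. D)) (x(j := y)) \<partial>lborel)
      \<le> indicator (Pi\<^sub>E J (\<lambda>_. D)) x * ennreal s" .
  qed
  also have "\<dots> = emeasure (Pi\<^sub>M J (\<lambda>_. lborel)) (Pi\<^sub>E J (\<lambda>_. D)) * ennreal s"
    using J by (subst nn_integral_multc) auto
  also have "emeasure (Pi\<^sub>M J (\<lambda>_. lborel)) (Pi\<^sub>E J (\<lambda>_. D)) = ennreal (m ^ (k - 1))"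
    using J ij m by (subst emeasure_PiM) (auto simp: J_def ennreal_power)
  finally show ?thesis .
qed

lemma nn_integral_gauss_pairs_le:
  fixes D :: "complex set"
  assumes D[measurable]: "D \<in> sets borel" and m: "emeasure lborel D = ennreal m" "0 \<le> m" and "0 \<le> s"
    and s: "\<And>z. (\<integral>\<^sup>+w. ennreal (exp (- (cmod (z - w))\<^sup>2 / 2)) * indicator D w \<partial>lborel) \<le> ennreal s"
  shows "(\<integral>\<^sup>+x. ennreal (gauss_pairs k x) * indicator (Pi\<^sub>E {..<k} (\<lambda>_. D)) x \<partial>(Pi\<^sub>M {..<k} (\<lambda>_. lborel)))
    \<le> ennreal (real k * real k * m ^ (k - 1) * s)"
proof -
  have [measurable]: "Pi\<^sub>E {..<k} (\<lambda>_. D) \<in> sets (Pi\<^sub>M {..<k} (\<lambda>_. lborel))"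
    by (intro sets_PiM_I_finite) auto
  have "(\<integral>\<^sup>+x. ennreal (gauss_pairs k x) * indicator (Pi\<^sub>E {..<k} (\<lambda>_. D)) x \<partial>(Pi\<^sub>M {..<k} (\<lambda>_. lborel)))
    = (\<integral>\<^sup>+x. (\<Sum>j<k. \<Sum>i\<in>{..<k} - {j}. ennreal (exp (- (cmod (x i - x j))\<^sup>2 / 2)) * indicator (Pi\<^sub>E {..<k} (\<lambda>_. D)) x) \<partial>(Pi\<^sub>M {..<k} (\<lambda>_. lborel)))"
    by (simp add: gauss_pairs_def sum_nonneg sum_distrib_right flip: sum_ennreal)
  also have "\<dots> = (\<Sum>j<k. \<Sum>i\<in>{..<k} - {j}. \<integral>\<^sup>+x. ennreal (exp (- (cmod (x i - x j))\<^sup>2 / 2)) * indicator (Pi\<^sub>E {..<k} (\<lambda>_. D)) x \<partial>(Pi\<^sub>M {..<k} (\<lambda>_. lborel)))"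
  proof (subst nn_integral_sum)
    have meas: "(\<lambda>x. ennreal (exp (- (cmod (x i - x j))\<^sup>2 / 2)) * indicator (Pi\<^sub>E {..<k} (\<lambda>_. D)) x) \<in> borel_measurable (Pi\<^sub>M {..<k} (\<lambda>_. lborel))"
      if "i < k" "j < k" for i j
      using that
      by (intro borel_measurable_times_ennreal borel_measurable_indicator
          measurable_compose[OF measurable_gauss_pair measurable_ennreal]) auto
    show "(\<lambda>x. \<Sum>i\<in>{..<k} - {j}. ennreal (exp (- (cmod (x i - x j))\<^sup>2 / 2)) * indicator (Pi\<^sub>E {..<k} (\<lambda>_. D)) x)
        \<in> borel_measurable (Pi\<^sub>M {..<k} (\<lambda>_. lborel))" if "j \<in> {..<k}" for j
      using that by (intro borel_measurable_sum meas) auto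
    show "(\<Sum>j<k. \<integral>\<^sup>+x. (\<Sum>i\<in>{..<k} - {j}. ennreal (exp (- (cmod (x i - x j))\<^sup>2 / 2)) * indicator (Pi\<^sub>E {..<k} (\<lambda>_. D)) x) \<partial>(Pi\<^sub>M {..<k} (\<lambda>_. lborel)))
      = (\<Sum>j<k. \<Sum>i\<in>{..<k} - {j}. \<integral>\<^sup>+x. ennreal (exp (- (cmod (x i - x j))\<^sup>2 / 2)) * indicator (Pi\<^sub>E {..<k} (\<lambda>_. D)) x \<partial>(Pi\<^sub>M {..<k} (\<lambda>_. lborel)))"
      by (intro sum.cong refl nn_integral_sum meas) auto
  qed
  also have "\<dots> \<le> (\<Sum>j<k. \<Sum>i\<in>{..<k} - {j}. ennreal (m ^ (k - 1)) * ennreal s)"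
    using assms by (intro sum_mono nn_integral_gauss_pair_le) auto
  also have "\<dots> = (\<Sum>j<k. ennreal (\<Sum>i\<in>{..<k} - {j}. m ^ (k - 1) * s))"
    using m \<open>0 \<le> s\<close> unfolding ennreal_mult[symmetric, OF zero_le_power[OF m(2)] \<open>0 \<le> s\<close>]
    by (intro sum.cong sum_ennreal) auto
  also have "\<dots> = ennreal (\<Sum>j<k. \<Sum>i\<in>{..<k} - {j}. m ^ (k - 1) * s)"
    using m \<open>0 \<le> s\<close> by (intro sum_ennreal sum_nonneg) auto
  also have "\<dots> \<le> ennreal (real k * real k * m ^ (k - 1) * s)"
  proof (rule ennreal_leI)
    have "(\<Sum>j<k. \<Sum>i\<in>{..<k} - {j}. m ^ (k - 1) * s) \<le> (\<Sum>j<k. \<Sum>i<k. m ^ (k - 1) * s)"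
      using m \<open>0 \<le> s\<close> by (intro sum_mono sum_mono2) auto
    then show "(\<Sum>j<k. \<Sum>i\<in>{..<k} - {j}. m ^ (k - 1) * s) \<le> real k * real k * m ^ (k - 1) * s"
      by (simp add: mult.assoc)
  qed
  finally show ?thesis .
qed

lemma prod_list_map_nth:
  fixes a :: "'c \<Rightarrow> 'b::comm_monoid_mult"
  shows "prod_list (map a xs) = (\<Prod>i<length xs. a (xs ! i))"
  by (simp add: prod.list_conv_set_nth atLeast0LessThan)

text \<open>The error is left as an integral over the product set. When such errors are summed over
  tuples of disjoint cells, the product sets are disjoint and the integrals merge into a single
  one.\<close>

lemma ginibre_product_moment:
  fixes A :: "nat \<Rightarrow> complex set"
  assumes G: "ginibre_ensemble M G" and k: "1 \<le> k"
    and A: "\<And>i. i < k \<Longrightarrow> precompact_borel (A i)" "disjoint_family_on A {..<k}"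
  shows "integrable M (\<lambda>\<omega>. \<Prod>i<k. num_points (G \<omega>) (A i))"
    and "ennreal \<bar>(\<integral>\<omega>. (\<Prod>i<k. num_points (G \<omega>) (A i)) \<partial>M) - (1 / pi) ^ k * (\<Prod>i<k. measure lborel (A i))\<bar>
      \<le> (\<integral>\<^sup>+x. ennreal (fact k / pi ^ k * gauss_pairs k x) * indicator (Pi\<^sub>E {..<k} A) x \<partial>(Pi\<^sub>M {..<k} (\<lambda>_. lborel)))"
proof -
  interpret product_sigma_finite "\<lambda>_::nat. lborel :: complex measure" by standard
  let ?B = "Pi\<^sub>E {..<k} A" and ?N = "Pi\<^sub>M {..<k} (\<lambda>_. lborel :: complex measure)"
  have D: "set_integrable ?N ?B (ginibre_det k)"
    and H: "has_bochner_integral M (\<lambda>\<omega>. complex_of_real (\<Prod>i<k. num_points (G \<omega>) (A i))) (LINT x : ?B | ?N. ginibre_det k x)"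
    using G k A unfolding ginibre_ensemble_def determinantal_def Let_def ginibre_det_def[abs_def] by blast+
  have H': "has_bochner_integral M (\<lambda>\<omega>. \<Prod>i<k. num_points (G \<omega>) (A i)) (Re (LINT x : ?B | ?N. ginibre_det k x))"
    using has_bochner_integral_bounded_linear[OF bounded_linear_Re H] by (simp flip: of_real_prod)
  then show "integrable M (\<lambda>\<omega>. \<Prod>i<k. num_points (G \<omega>) (A i))"
    by (simp add: has_bochner_integral_iff)
  have Asets: "A i \<in> sets lborel" "emeasure lborel (A i) < \<infinity>" if "i < k" for i
    using A(1)[OF that] emeasure_bounded_finite[of "A i"] by (simp_all add: precompact_borel_bounded)
  have Bs[measurable]: "?B \<in> sets ?N" using Asets by (intro sets_PiM_I_finite) auto
  have eB: "emeasure ?N ?B = ennreal (\<Prod>i<k. measure lborel (A i))"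
    using Asets by (subst emeasure_PiM)
      (auto intro!: prod.cong simp: emeasure_eq_ennreal_measure less_top simp flip: prod_ennreal)
  then have mB: "measure ?N ?B = (\<Prod>i<k. measure lborel (A i))"
    by (simp add: measure_def prod_nonneg)
  have C: "set_integrable ?N ?B (\<lambda>_. complex_of_real ((1 / pi) ^ k))"
    unfolding set_integrable_def using eB by (intro integrable_scaleR_left) (auto intro: integrable_real_indicator)
  have c: "(LINT x : ?B | ?N. complex_of_real ((1 / pi) ^ k)) = complex_of_real ((1 / pi) ^ k * (\<Prod>i<k. measure lborel (A i)))"
    unfolding set_lebesgue_integral_def
    using eB by (subst integral_scaleR_left) (auto intro: integrable_real_indicator simp: mB scaleR_conv_of_real)
  have "Re (LINT x : ?B | ?N. ginibre_det k x - of_real ((1 / pi) ^ k))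
    = Re (LINT x : ?B | ?N. ginibre_det k x) - (1 / pi) ^ k * (\<Prod>i<k. measure lborel (A i))"
    unfolding set_integral_diff(2)[OF D C] c minus_complex.sel Re_complex_of_real ..
  then have "\<bar>(\<integral>\<omega>. (\<Prod>i<k. num_points (G \<omega>) (A i)) \<partial>M) - (1 / pi) ^ k * (\<Prod>i<k. measure lborel (A i))\<bar>
     = \<bar>Re (LINT x : ?B | ?N. ginibre_det k x - of_real ((1 / pi) ^ k))\<bar>"
    unfolding H'[THEN has_bochner_integral_integral_eq] by (simp only:)
  also have "\<dots> \<le> cmod (LINT x : ?B | ?N. ginibre_det k x - of_real ((1 / pi) ^ k))"
    by (rule abs_Re_le_cmod)
  finally have "ennreal \<bar>(\<integral>\<omega>. (\<Prod>i<k. num_points (G \<omega>) (A i)) \<partial>M) - (1 / pi) ^ k * (\<Prod>i<k. measure lborel (A i))\<bar>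
     \<le> ennreal (cmod (LINT x : ?B | ?N. ginibre_det k x - of_real ((1 / pi) ^ k)))"
    by (rule ennreal_leI)
  also have "\<dots> \<le> (\<integral>\<^sup>+x. ennreal (cmod (indicator ?B x *\<^sub>R (ginibre_det k x - of_real ((1 / pi) ^ k)))) \<partial>?N)"
    unfolding set_lebesgue_integral_def
    using set_integral_diff(1)[OF D C] unfolding set_integrable_def
    by (rule integral_norm_bound_ennreal)
  also have "\<dots> \<le> (\<integral>\<^sup>+x. ennreal (fact k / pi ^ k * gauss_pairs k x) * indicator ?B x \<partial>?N)"
  proof (rule nn_integral_mono)
    fix x
    show "ennreal (cmod (indicator ?B x *\<^sub>R (ginibre_det k x - of_real ((1 / pi) ^ k))))
        \<le> ennreal (fact k / pi ^ k * gauss_pairs k x) * indicator ?B x"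
      using ennreal_leI[OF ginibre_det_approx[of k x]]
      by (cases "x \<in> ?B") (simp_all only: simp_thms indicator_simps scaleR_one scaleR_zero_left norm_zero ennreal_0 mult_zero_right mult_1_right order_refl)
  qed
  finally show "ennreal \<bar>(\<integral>\<omega>. (\<Prod>i<k. num_points (G \<omega>) (A i)) \<partial>M) - (1 / pi) ^ k * (\<Prod>i<k. measure lborel (A i))\<bar>
     \<le> (\<integral>\<^sup>+x. ennreal (fact k / pi ^ k * gauss_pairs k x) * indicator ?B x \<partial>?N)" .
qed

lemma nth_distinct_lists: "xs \<in> distinct_lists C k \<Longrightarrow> i < k \<Longrightarrow> xs ! i \<in> C"
  unfolding distinct_lists_def using nth_mem[of i xs] by blast

lemma disjoint_family_on_distinct_lists:
  assumes "disjoint_family_on A C" and xs: "xs \<in> distinct_lists C k"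
  shows "disjoint_family_on (\<lambda>i. A (xs ! i)) {..<k}"
  unfolding disjoint_family_on_def
proof (intro ballI impI)
  fix i j assume ij: "i \<in> {..<k}" "j \<in> {..<k}" "i \<noteq> j"
  then have "xs ! i \<noteq> xs ! j"
    using xs by (simp add: distinct_lists_def nth_eq_iff_index_eq)
  then show "A (xs ! i) \<inter> A (xs ! j) = {}"
    using assms(1) nth_distinct_lists[OF xs] ij unfolding disjoint_family_on_def by blast
qed

text \<open>Products along different tuples of disjoint cells are disjoint: a point determines the
  cell of each of its coordinates.\<close>

lemma sum_indicator_distinct_lists_le:
  assumes C: "finite C" "\<And>c. c \<in> C \<Longrightarrow> A c \<subseteq> D" "disjoint_family_on A C"
  shows "(\<Sum>xs\<in>distinct_lists C k. indicator (Pi\<^sub>E {..<k} (\<lambda>i. A (xs ! i))) x)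
    \<le> (indicator (Pi\<^sub>E {..<k} (\<lambda>_. D)) x :: ennreal)"
proof (cases "\<exists>xs\<in>distinct_lists C k. x \<in> Pi\<^sub>E {..<k} (\<lambda>i. A (xs ! i))")
  case False
  then have "(\<Sum>xs\<in>distinct_lists C k. indicator (Pi\<^sub>E {..<k} (\<lambda>i. A (xs ! i))) x) = (0 :: ennreal)"
    by (intro sum.neutral) (simp add: indicator_eq_0_iff)
  then show ?thesis by (simp only: zero_le)
next
  case True
  then obtain xs where xs: "xs \<in> distinct_lists C k" "x \<in> Pi\<^sub>E {..<k} (\<lambda>i. A (xs ! i))" by blast
  have uniq: "ys = xs" if ys: "ys \<in> distinct_lists C k" "x \<in> Pi\<^sub>E {..<k} (\<lambda>i. A (ys ! i))" for ys
  proof (rule nth_equalityI)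
    show "length ys = length xs" using xs ys by (simp add: distinct_lists_def)
    fix i assume "i < length ys"
    then have i: "i < k" using ys by (simp add: distinct_lists_def)
    then have "x i \<in> A (ys ! i) \<inter> A (xs ! i)" using xs(2) ys(2) unfolding PiE_iff by blast
    then show "ys ! i = xs ! i"
      using C(3) nth_distinct_lists[OF xs(1) i] nth_distinct_lists[OF ys(1) i]
      unfolding disjoint_family_on_def by blast
  qed
  have "(\<Sum>ys\<in>distinct_lists C k. indicator (Pi\<^sub>E {..<k} (\<lambda>i. A (ys ! i))) x)
      = (\<Sum>ys\<in>{xs}. indicator (Pi\<^sub>E {..<k} (\<lambda>i. A (ys ! i))) x :: ennreal)"
  proof (rule sum.mono_neutral_right)
    show "\<forall>ys\<in>distinct_lists C k - {xs}. indicator (Pi\<^sub>E {..<k} (\<lambda>i. A (ys ! i))) x = (0 :: ennreal)"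
      using uniq unfolding indicator_eq_0_iff by blast
  qed (use xs finite_distinct_lists[OF C(1)] in auto)
  also have "\<dots> = indicator (Pi\<^sub>E {..<k} (\<lambda>i. A (xs ! i))) x"
    by (subst sum.insert) auto
  also have "\<dots> \<le> indicator (Pi\<^sub>E {..<k} (\<lambda>_. D)) x"
    using C(2) nth_distinct_lists[OF xs(1)] by (intro indicator_leI) (unfold PiE_iff, blast)
  finally show ?thesis .
qed

text \<open>The bound involves \<open>D\<close> and \<open>s\<close> but not the cells, so it
  survives every refinement of the partition.\<close>

lemma ginibre_esum_moment:
  fixes A :: "'c \<Rightarrow> complex set"
  assumes G: "ginibre_ensemble M G" and D: "precompact_borel D"
    and C: "finite C" "\<And>c. c \<in> C \<Longrightarrow> A c \<in> sets borel" "\<And>c. c \<in> C \<Longrightarrow> A c \<subseteq> D" "disjoint_family_on A C"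
    and s: "0 \<le> s" "\<And>z. (\<integral>\<^sup>+w. ennreal (exp (- (cmod (z - w))\<^sup>2 / 2)) * indicator D w \<partial>lborel) \<le> ennreal s"
  shows "integrable M (\<lambda>\<omega>. esum C (\<lambda>c. num_points (G \<omega>) (A c)) k)"
    and "\<bar>(\<integral>\<omega>. esum C (\<lambda>c. num_points (G \<omega>) (A c)) k \<partial>M) - (1 / pi) ^ k * esum C (\<lambda>c. measure lborel (A c)) k\<bar>
      \<le> fact k / pi ^ k * (real k * real k * measure lborel D ^ (k - 1) * s)"
proof -
  interpret prob_space M
    using G by (simp add: ginibre_ensemble_def determinantal_def simple_point_process_def point_process_def)
  let ?N = "Pi\<^sub>M {..<k} (\<lambda>_. lborel :: complex measure)"
  let ?B = "\<lambda>xs. Pi\<^sub>E {..<k} (\<lambda>i. A (xs ! i))"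
  have D': "D \<in> sets borel" "emeasure lborel D = ennreal (measure lborel D)"
    using D emeasure_bounded_finite[of D]
    by (auto simp: precompact_borel_bounded emeasure_eq_ennreal_measure less_top)
  show "integrable M (\<lambda>\<omega>. esum C (\<lambda>c. num_points (G \<omega>) (A c)) k)" (is ?I)
    and "\<bar>(\<integral>\<omega>. esum C (\<lambda>c. num_points (G \<omega>) (A c)) k \<partial>M) - (1 / pi) ^ k * esum C (\<lambda>c. measure lborel (A c)) k\<bar>
      \<le> fact k / pi ^ k * (real k * real k * measure lborel D ^ (k - 1) * s)" (is ?E)
  proof -
    \<comment> \<open>The determinantal identity starts at \<open>k = 1\<close>; for
      \<open>k = 0\<close> both sums are 1 and the error is 0.\<close>
    consider "k = 0" | "1 \<le> k" by linarith
    then have "?I \<and> ?E"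
    proof cases
      case 1
      then show ?thesis by (simp add: prob_space)
    next
      case k: 2
      have pre: "precompact_borel (A (xs ! i))" if "xs \<in> distinct_lists C k" "i < k" for xs i
      proof -
        have "xs ! i \<in> C" using that by (rule nth_distinct_lists)
        then show ?thesis using C(2,3) by (intro precompact_borel_subset[OF D])
      qed
      note disj = disjoint_family_on_distinct_lists[OF C(4)]
      note mom = ginibre_product_moment[OF G k, of "\<lambda>i. A (xs ! i)" for xs, OF pre disj]
      have eq: "prod_list (map a xs) = (\<Prod>i<k. a (xs ! i))" if "xs \<in> distinct_lists C k" for xs and a :: "'c \<Rightarrow> real"
        using that by (simp add: prod_list_map_nth distinct_lists_def)
      have int: "integrable M (\<lambda>\<omega>. prod_list (map (\<lambda>c. num_points (G \<omega>) (A c)) xs))" if "xs \<in> distinct_lists C k" for xs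
        unfolding eq[OF that] using mom(1) that by blast
      then have ?I unfolding esum_def by (intro Bochner_Integration.integrable_sum) auto
      have "(\<integral>\<omega>. esum C (\<lambda>c. num_points (G \<omega>) (A c)) k \<partial>M)
          = (\<Sum>xs\<in>distinct_lists C k. \<integral>\<omega>. (\<Prod>i<k. num_points (G \<omega>) (A (xs ! i))) \<partial>M)"
        unfolding esum_def using int
        by (subst Bochner_Integration.integral_sum) (auto intro!: sum.cong simp only: eq)
      moreover have "esum C (\<lambda>c. measure lborel (A c)) k = (\<Sum>xs\<in>distinct_lists C k. \<Prod>i<k. measure lborel (A (xs ! i)))"
        unfolding esum_def by (intro sum.cong refl eq)
      ultimately have "ennreal \<bar>(\<integral>\<omega>. esum C (\<lambda>c. num_points (G \<omega>) (A c)) k \<partial>M) - (1 / pi) ^ k * esum C (\<lambda>c. measure lborel (A c)) k\<bar>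
         = ennreal \<bar>\<Sum>xs\<in>distinct_lists C k. (\<integral>\<omega>. (\<Prod>i<k. num_points (G \<omega>) (A (xs ! i))) \<partial>M) - (1 / pi) ^ k * (\<Prod>i<k. measure lborel (A (xs ! i)))\<bar>"
        by (simp only: sum_subtractf sum_distrib_left)
      also have "\<dots> \<le> ennreal (\<Sum>xs\<in>distinct_lists C k. \<bar>(\<integral>\<omega>. (\<Prod>i<k. num_points (G \<omega>) (A (xs ! i))) \<partial>M) - (1 / pi) ^ k * (\<Prod>i<k. measure lborel (A (xs ! i)))\<bar>)"
        by (intro ennreal_leI sum_abs)
      also have "\<dots> = (\<Sum>xs\<in>distinct_lists C k. ennreal \<bar>(\<integral>\<omega>. (\<Prod>i<k. num_points (G \<omega>) (A (xs ! i))) \<partial>M) - (1 / pi) ^ k * (\<Prod>i<k. measure lborel (A (xs ! i)))\<bar>)"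
        by (rule sum_ennreal[symmetric]) auto
      also have "\<dots> \<le> (\<Sum>xs\<in>distinct_lists C k. \<integral>\<^sup>+x. ennreal (fact k / pi ^ k * gauss_pairs k x) * indicator (?B xs) x \<partial>?N)"
        using mom(2) by (intro sum_mono) auto
      also have "\<dots> = (\<integral>\<^sup>+x. (\<Sum>xs\<in>distinct_lists C k. ennreal (fact k / pi ^ k * gauss_pairs k x) * indicator (?B xs) x) \<partial>?N)"
      proof (rule nn_integral_sum[symmetric])
        fix xs assume xs: "xs \<in> distinct_lists C k"
        have [measurable]: "?B xs \<in> sets ?N"
          using pre[OF xs] by (intro sets_PiM_I_finite) (auto simp: precompact_borel_def)
        have [measurable]: "gauss_pairs k \<in> borel_measurable ?N"
          unfolding gauss_pairs_def[abs_def] by (intro borel_measurable_sum measurable_gauss_pair) auto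
        show "(\<lambda>x. ennreal (fact k / pi ^ k * gauss_pairs k x) * indicator (?B xs) x) \<in> borel_measurable ?N"
          by measurable
      qed
      \<comment> \<open>\<open>gauss_pairs\<close> does not depend on the tuple, so only the
        indicators are summed, and these add up to at most the indicator of the full
        product.\<close>
      also have "\<dots> \<le> (\<integral>\<^sup>+x. ennreal (fact k / pi ^ k) * (ennreal (gauss_pairs k x) * indicator (Pi\<^sub>E {..<k} (\<lambda>_. D)) x) \<partial>?N)"
      proof (rule nn_integral_mono)
        fix x
        have "(\<Sum>xs\<in>distinct_lists C k. indicator (?B xs) x) \<le> (indicator (Pi\<^sub>E {..<k} (\<lambda>_. D)) x :: ennreal)"
          by (rule sum_indicator_distinct_lists_le[OF C(1,3,4)])
        then have "ennreal (fact k / pi ^ k * gauss_pairs k x) * (\<Sum>xs\<in>distinct_lists C k. indicator (?B xs) x)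
            \<le> ennreal (fact k / pi ^ k * gauss_pairs k x) * indicator (Pi\<^sub>E {..<k} (\<lambda>_. D)) x"
          by (rule mult_left_mono) (rule zero_le)
        also have "\<dots> = ennreal (fact k / pi ^ k) * (ennreal (gauss_pairs k x) * indicator (Pi\<^sub>E {..<k} (\<lambda>_. D)) x)"
          by (subst ennreal_mult') (simp_all only: mult.assoc zero_le_divide_iff zero_le_power pi_ge_zero fact_ge_zero simp_thms)
        finally show "(\<Sum>xs\<in>distinct_lists C k. ennreal (fact k / pi ^ k * gauss_pairs k x) * indicator (?B xs) x)
            \<le> ennreal (fact k / pi ^ k) * (ennreal (gauss_pairs k x) * indicator (Pi\<^sub>E {..<k} (\<lambda>_. D)) x)"
          by (simp only: sum_distrib_left)
      qed
      also have "\<dots> = ennreal (fact k / pi ^ k) * (\<integral>\<^sup>+x. ennreal (gauss_pairs k x) * indicator (Pi\<^sub>E {..<k} (\<lambda>_. D)) x \<partial>?N)"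
      proof (rule nn_integral_cmult)
        have [measurable]: "Pi\<^sub>E {..<k} (\<lambda>_. D) \<in> sets ?N"
          using D' by (intro sets_PiM_I_finite) auto
        have [measurable]: "gauss_pairs k \<in> borel_measurable ?N"
          unfolding gauss_pairs_def[abs_def] by (intro borel_measurable_sum measurable_gauss_pair) auto
        show "(\<lambda>x. ennreal (gauss_pairs k x) * indicator (Pi\<^sub>E {..<k} (\<lambda>_. D)) x) \<in> borel_measurable ?N"
          by measurable
      qed
      also have "\<dots> \<le> ennreal (fact k / pi ^ k) * ennreal (real k * real k * measure lborel D ^ (k - 1) * s)"
        using s D' by (intro mult_left_mono nn_integral_gauss_pairs_le) auto
      also have "\<dots> = ennreal (fact k / pi ^ k * (real k * real k * measure lborel D ^ (k - 1) * s))"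
        using s by (intro ennreal_mult[symmetric]) auto
      finally have ?E
        using s by (subst (asm) ennreal_le_iff) auto
      with \<open>?I\<close> show ?thesis by blast
    qed
    then show ?I ?E by blast+
  qed
qed

section \<open>Partitions of the plane into squares of side \<open>1 / Suc n\<close>\<close>

definition grid_index :: "nat \<Rightarrow> complex \<Rightarrow> int \<times> int" where
  "grid_index n z = (\<lfloor>real (Suc n) * Re z\<rfloor>, \<lfloor>real (Suc n) * Im z\<rfloor>)"

definition grid_cell :: "complex set \<Rightarrow> nat \<Rightarrow> int \<times> int \<Rightarrow> complex set" where
  "grid_cell D n c = {z \<in> D. grid_index n z = c}"

lemma finite_grid_index:
  assumes "bounded D"
  shows "finite (grid_index n ` D)"
proof -
  obtain B where B: "\<And>z. z \<in> D \<Longrightarrow> cmod z \<le> B" using assms by (auto simp: bounded_iff)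
  define b where "b = real (Suc n) * B"
  have "grid_index n ` D \<subseteq> {\<lfloor>- b\<rfloor>..\<lfloor>b\<rfloor>} \<times> {\<lfloor>- b\<rfloor>..\<lfloor>b\<rfloor>}"
  proof
    fix c assume "c \<in> grid_index n ` D"
    then obtain z where z: "z \<in> D" "c = grid_index n z" by blast
    have "\<bar>Re z\<bar> \<le> B" "\<bar>Im z\<bar> \<le> B"
      using B[OF z(1)] abs_Re_le_cmod[of z] abs_Im_le_cmod[of z] by linarith+
    then have "real (Suc n) * \<bar>Re z\<bar> \<le> b" "real (Suc n) * \<bar>Im z\<bar> \<le> b"
      unfolding b_def by (auto intro!: mult_left_mono)
    then have "\<bar>real (Suc n) * Re z\<bar> \<le> b" "\<bar>real (Suc n) * Im z\<bar> \<le> b"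
      by (simp_all only: abs_mult abs_of_nat)
    then show "c \<in> {\<lfloor>- b\<rfloor>..\<lfloor>b\<rfloor>} \<times> {\<lfloor>- b\<rfloor>..\<lfloor>b\<rfloor>}"
      unfolding z(2) grid_index_def by (auto intro!: floor_mono simp only: mem_Sigma_iff atLeastAtMost_iff abs_le_iff)
  qed
  then show ?thesis by (rule finite_subset) simp
qed

lemma measurable_grid_index: "grid_index n \<in> measurable borel (count_space UNIV)"
proof -
  have "grid_index n \<in> measurable borel (count_space UNIV \<Otimes>\<^sub>M count_space UNIV)"
    unfolding grid_index_def[abs_def] by measurable
  then show ?thesis by (simp add: pair_measure_countable)
qed

lemma grid_cell_borel: "D \<in> sets borel \<Longrightarrow> grid_cell D n c \<in> sets borel"
proof -
  assume "D \<in> sets borel"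
  moreover have "grid_index n -` {c} \<inter> space borel \<in> sets borel"
    by (rule measurable_sets[OF measurable_grid_index]) simp
  moreover have "grid_cell D n c = D \<inter> (grid_index n -` {c} \<inter> space borel)"
    by (auto simp: grid_cell_def)
  ultimately show ?thesis by simp
qed

lemma grid_cell_bounds:
  assumes "z \<in> grid_cell D n (p, q)"
  shows "real_of_int p / real (Suc n) \<le> Re z" "Re z < (real_of_int p + 1) / real (Suc n)"
    "real_of_int q / real (Suc n) \<le> Im z" "Im z < (real_of_int q + 1) / real (Suc n)"
proof -
  have eq: "\<lfloor>real (Suc n) * Re z\<rfloor> = p" "\<lfloor>real (Suc n) * Im z\<rfloor> = q"
    using assms by (simp_all only: grid_cell_def grid_index_def mem_Collect_eq prod.inject)
  have "real_of_int p \<le> real (Suc n) * Re z" "real (Suc n) * Re z < real_of_int p + 1"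
    "real_of_int q \<le> real (Suc n) * Im z" "real (Suc n) * Im z < real_of_int q + 1"
    unfolding eq[symmetric] by linarith+
  then show "real_of_int p / real (Suc n) \<le> Re z" "Re z < (real_of_int p + 1) / real (Suc n)"
    "real_of_int q / real (Suc n) \<le> Im z" "Im z < (real_of_int q + 1) / real (Suc n)"
    by (simp_all only: pos_divide_le_eq pos_less_divide_eq of_nat_0_less_iff zero_less_Suc mult.commute)
qed

lemma grid_cell_dist:
  assumes "u \<in> grid_cell D n c" "v \<in> grid_cell D n c"
  shows "dist u v < 2 / real (Suc n)"
proof -
  obtain p q where c: "c = (p, q)" by (cases c)
  note u = grid_cell_bounds[OF assms(1)[unfolded c]] and v = grid_cell_bounds[OF assms(2)[unfolded c]]
  have "\<bar>Re (u - v)\<bar> < 1 / real (Suc n)" "\<bar>Im (u - v)\<bar> < 1 / real (Suc n)"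
    using u v by (simp_all only: abs_less_iff minus_complex.sel add_divide_distrib, linarith+)
  then show ?thesis
    using cmod_le[of "u - v"] unfolding dist_norm by linarith
qed

text \<open>The full square has area \<open>(1 / Suc n) ^ 2\<close>; the weaker bound stated here
  already tends to 0, as \<open>tendsto_esum\<close> requires.\<close>

lemma measure_grid_cell_le:
  assumes "D \<in> sets borel"
  shows "measure lborel (grid_cell D n c) \<le> 1 / real (Suc n)"
proof -
  obtain p q where c: "c = (p, q)" by (cases c)
  define l where "l = Complex (real_of_int p / real (Suc n)) (real_of_int q / real (Suc n))"
  define u where "u = Complex ((real_of_int p + 1) / real (Suc n)) ((real_of_int q + 1) / real (Suc n))"
  have "grid_cell D n c \<subseteq> cbox l u"
  proof
    fix z assume "z \<in> grid_cell D n c"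
    then show "z \<in> cbox l u"
      using grid_cell_bounds[of z D n p q] unfolding c in_cbox_complex_iff l_def u_def by auto
  qed
  then have "measure lborel (grid_cell D n c) \<le> measure lborel (cbox l u)"
    using assms by (intro measure_mono_fmeasurable grid_cell_borel) (auto simp: grid_cell_borel)
  also have "\<dots> = 1 / real (Suc n) * (1 / real (Suc n))"
    by (subst measure_lborel_cbox_eq)
      (auto simp: l_def u_def Basis_complex_def divide_right_mono simp flip: diff_divide_distrib)
  also have "\<dots> \<le> 1 / real (Suc n)"
    by (rule mult_left_le) auto
  finally show ?thesis .
qed

lemma Liminf_ennreal_le:
  fixes u :: "nat \<Rightarrow> ennreal"
  assumes "\<And>n. u n \<le> c"
  shows "liminf u \<le> c"
proof -
  have "liminf u \<le> liminf (\<lambda>_. c)" by (rule Liminf_mono) (simp add: assms)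
  then show ?thesis by (simp add: Liminf_const)
qed

text \<open>Measurability of counts is read off the determinantal identity for \<open>k = 1\<close>,
  which includes integrability. This bypasses the Borel structure of the vague topology.\<close>

lemma ginibre_num_points_measurable:
  assumes G: "ginibre_ensemble M G" and D: "precompact_borel D"
  shows "(\<lambda>\<omega>. num_points (G \<omega>) D) \<in> borel_measurable M"
  using borel_measurable_integrable[OF ginibre_product_moment(1)[OF G, of 1 "\<lambda>_. D"]] D
  by (simp add: disjoint_family_on_def)

text \<open>The determinantal identity only concerns products over disjoint sets. Summing it over the tuples
  of distinct cells of a grid and refining the grid gives the factorial moments of a single set.\<close>

lemma ginibre_factorial_moment:
  assumes G: "ginibre_ensemble M G" and D: "precompact_borel D"
    and s: "0 \<le> s" "\<And>z. (\<integral>\<^sup>+w. ennreal (exp (- (cmod (z - w))\<^sup>2 / 2)) * indicator D w \<partial>lborel) \<le> ennreal s"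
  shows "integrable M (\<lambda>\<omega>. ffact (num_points (G \<omega>) D) k)"
    and "\<bar>(\<integral>\<omega>. ffact (num_points (G \<omega>) D) k \<partial>M) - (measure lborel D / pi) ^ k\<bar>
      \<le> fact k / pi ^ k * (real k * real k * measure lborel D ^ (k - 1) * s)"
proof -
  interpret prob_space M
    using G by (simp add: ginibre_ensemble_def determinantal_def simple_point_process_def point_process_def)
  have simple: "AE \<omega> in M. \<forall>x. num_points (G \<omega>) {x} \<le> 1"
    using G by (simp add: ginibre_ensemble_def determinantal_def simple_point_process_def)
  define E where "E = fact k / pi ^ k * (real k * real k * measure lborel D ^ (k - 1) * s)"
  have D': "D \<in> sets borel" "bounded D" using D by (auto simp: precompact_borel_bounded)
  define C where "C n = grid_index n ` D" for n
  have fin: "finite (C n)" for n unfolding C_def by (rule finite_grid_index[OF D'(2)])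
  have pre: "precompact_borel (grid_cell D n c)" for n c
    by (rule precompact_borel_subset[OF D grid_cell_borel[OF D'(1)]]) (auto simp: grid_cell_def)
  have disj: "disjoint_family_on (grid_cell D n) (C n)" for n
    by (auto simp: disjoint_family_on_def grid_cell_def)
  have UN: "(\<Union>c\<in>C n. grid_cell D n c) = D" for n
    by (auto simp: C_def grid_cell_def)
  define f where "f n \<omega> = esum (C n) (\<lambda>c. num_points (G \<omega>) (grid_cell D n c)) k" for n \<omega>
  define e where "e n = esum (C n) (\<lambda>c. measure lborel (grid_cell D n c)) k" for n
  \<comment> \<open>The bound \<open>E\<close> is the same for all meshes \<open>n\<close> and
    therefore passes to the limit.\<close>
  have int_f: "integrable M (f n)" and f_bound: "\<bar>(\<integral>\<omega>. f n \<omega> \<partial>M) - (1 / pi) ^ k * e n\<bar> \<le> E" for n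
    using ginibre_esum_moment[OF G D fin[of n] grid_cell_borel[OF D'(1)] _ disj[of n] s, where k=k]
    unfolding f_def[abs_def] e_def E_def by (auto simp: grid_cell_def)
  have e_lim: "e \<longlonglongrightarrow> measure lborel D ^ k"
    unfolding e_def
  proof (rule tendsto_esum[OF fin])
    show "measure lborel (grid_cell D n c) \<le> 1 / real (Suc n)" for n c
      by (rule measure_grid_cell_le[OF D'(1)])
    show "(\<lambda>n. 1 / real (Suc n)) \<longlonglongrightarrow> 0" by (rule LIMSEQ_Suc[OF lim_1_over_n])
    show "(\<Sum>c\<in>C n. measure lborel (grid_cell D n c)) = measure lborel D" for n
    proof -
      have "measure lborel (\<Union>c\<in>C n. grid_cell D n c) = (\<Sum>c\<in>C n. measure lborel (grid_cell D n c))"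
        using fin disj pre emeasure_bounded_finite[of "grid_cell D n c" for c]
        by (intro measure_UNION') (auto simp: fmeasurable_def precompact_borel_bounded disjoint_family_on_def pairwise_def disjnt_def)
      then show ?thesis by (simp add: UN)
    qed
  qed auto
  have sum_N: "(\<Sum>c\<in>C n. num_points (G \<omega>) (grid_cell D n c)) = num_points (G \<omega>) D" for n \<omega>
    using num_points_UN[OF fin pre disj] by (simp add: UN)
  have f_nonneg: "0 \<le> f n \<omega>" for n \<omega>
    unfolding f_def by (rule esum_nonneg) (simp add: num_points_def)
  \<comment> \<open>Holds at every mesh, so the limit function itself serves as the majorant
    below.\<close>
  have f_le: "f n \<omega> \<le> ffact (num_points (G \<omega>) D) k" for n \<omega>
    unfolding f_def sum_N[of \<omega> n, symmetric]
  proof (rule esum_le_ffact[OF fin])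
    show "num_points (G \<omega>) (grid_cell D n c) \<in> \<nat>" for c
      by (rule num_points_nat[OF pre[of n c], of "G \<omega>"]) simp
  qed
  \<comment> \<open>Simplicity enters here: once the cells are smaller than the least gap between
    points of \<open>D\<close>, each holds at most one point.\<close>
  have f_eq: "AE \<omega> in M. eventually (\<lambda>n. f n \<omega> = ffact (num_points (G \<omega>) D) k) sequentially"
    using simple
  proof eventually_elim
    fix \<omega> assume simple: "\<forall>x. num_points (G \<omega>) {x} \<le> 1"
    obtain d where d: "d > 0" "\<And>A. A \<in> sets borel \<Longrightarrow> A \<subseteq> D \<Longrightarrow> (\<And>u v. u \<in> A \<Longrightarrow> v \<in> A \<Longrightarrow> dist u v < d) \<Longrightarrow> num_points (G \<omega>) A \<le> 1"
      using simple_conf_separated[OF _ D, of "G \<omega>"] simple by blast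
    have "(\<lambda>n. 2 * (1 / real (Suc n))) \<longlonglongrightarrow> 2 * 0"
      by (intro tendsto_intros LIMSEQ_Suc[OF lim_1_over_n])
    then have "eventually (\<lambda>n. 2 * (1 / real (Suc n)) < d) sequentially"
      using d(1) by (intro order_tendstoD) auto
    then show "eventually (\<lambda>n. f n \<omega> = ffact (num_points (G \<omega>) D) k) sequentially"
    proof eventually_elim
      fix n assume n: "2 * (1 / real (Suc n)) < d"
      show "f n \<omega> = ffact (num_points (G \<omega>) D) k"
        unfolding f_def sum_N[of \<omega> n, symmetric]
      proof (rule esum_eq_ffact[OF fin])
        fix c
        have "num_points (G \<omega>) (grid_cell D n c) \<le> 1"
        proof (rule d(2))
          show "dist u v < d" if "u \<in> grid_cell D n c" "v \<in> grid_cell D n c" for u v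
            using grid_cell_dist[OF that] n by simp
        qed (rule grid_cell_borel[OF D'(1)], auto simp: grid_cell_def)
        moreover obtain m :: nat where "num_points (G \<omega>) (grid_cell D n c) = real m"
          by (rule num_points_nat[OF pre])
        ultimately show "num_points (G \<omega>) (grid_cell D n c) = 0 \<or> num_points (G \<omega>) (grid_cell D n c) = 1"
          by (cases m) auto
      qed
    qed
  qed
  have [measurable]: "(\<lambda>\<omega>. ffact (num_points (G \<omega>) D) k) \<in> borel_measurable M"
    unfolding ffact_def using ginibre_num_points_measurable[OF G D] by measurable
  have [measurable]: "f n \<in> borel_measurable M" for n
    using int_f by (rule borel_measurable_integrable)
  obtain B where B: "\<And>n. e n \<le> B"
    using convergent_imp_Bseq[OF convergentI[OF e_lim]]
    by (metis Bseq_def abs_le_D1 real_norm_def)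
  show int: "integrable M (\<lambda>\<omega>. ffact (num_points (G \<omega>) D) k)"
  proof (rule integrableI_nonneg)
    show "AE \<omega> in M. 0 \<le> ffact (num_points (G \<omega>) D) k"
      using order_trans[OF f_nonneg f_le] by simp
    \<comment> \<open>Fatou's lemma gives the integrability that dominated convergence then
      presupposes; the means of \<open>f n\<close> are bounded because \<open>e\<close>
      converges.\<close>
    have "(\<integral>\<^sup>+\<omega>. ennreal (ffact (num_points (G \<omega>) D) k) \<partial>M) = (\<integral>\<^sup>+\<omega>. liminf (\<lambda>n. ennreal (f n \<omega>)) \<partial>M)"
    proof (rule nn_integral_cong_AE)
      show "AE \<omega> in M. ennreal (ffact (num_points (G \<omega>) D) k) = liminf (\<lambda>n. ennreal (f n \<omega>))"
        using f_eq
      proof eventually_elim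
        fix \<omega> assume "eventually (\<lambda>n. f n \<omega> = ffact (num_points (G \<omega>) D) k) sequentially"
        then have "(\<lambda>n. ennreal (f n \<omega>)) \<longlonglongrightarrow> ennreal (ffact (num_points (G \<omega>) D) k)"
          by (intro tendsto_eventually) (auto elim: eventually_mono)
        then show "ennreal (ffact (num_points (G \<omega>) D) k) = liminf (\<lambda>n. ennreal (f n \<omega>))"
          by (intro lim_imp_Liminf[symmetric]) auto
      qed
    qed
    also have "\<dots> \<le> liminf (\<lambda>n. \<integral>\<^sup>+\<omega>. ennreal (f n \<omega>) \<partial>M)"
      by (rule nn_integral_liminf) measurable
    also have "\<dots> \<le> ennreal ((1 / pi) ^ k * B + E)"
    proof (rule Liminf_ennreal_le)
      fix n
      have "(1 / pi) ^ k * e n \<le> (1 / pi) ^ k * B" using B by (intro mult_left_mono) auto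
      then have "(\<integral>\<omega>. f n \<omega> \<partial>M) \<le> (1 / pi) ^ k * B + E"
        using f_bound[of n] by linarith
      then show "(\<integral>\<^sup>+\<omega>. ennreal (f n \<omega>) \<partial>M) \<le> ennreal ((1 / pi) ^ k * B + E)"
        using f_nonneg by (subst nn_integral_eq_integral[OF int_f]) (auto intro: ennreal_leI)
    qed
    finally show "(\<integral>\<^sup>+\<omega>. ennreal (ffact (num_points (G \<omega>) D) k) \<partial>M) < \<infinity>"
      by (rule le_less_trans) simp
  qed measurable
  have "(\<lambda>n. \<integral>\<omega>. f n \<omega> \<partial>M) \<longlonglongrightarrow> (\<integral>\<omega>. ffact (num_points (G \<omega>) D) k \<partial>M)"
  proof (rule integral_dominated_convergence[OF _ _ int])
    show "AE \<omega> in M. (\<lambda>n. f n \<omega>) \<longlonglongrightarrow> ffact (num_points (G \<omega>) D) k"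
      using f_eq by eventually_elim (rule tendsto_eventually)
    show "AE \<omega> in M. norm (f n \<omega>) \<le> ffact (num_points (G \<omega>) D) k" for n
      using f_nonneg f_le by simp
  qed measurable
  then have "(\<lambda>n. \<bar>(\<integral>\<omega>. f n \<omega> \<partial>M) - (1 / pi) ^ k * e n\<bar>) \<longlonglongrightarrow>
      \<bar>(\<integral>\<omega>. ffact (num_points (G \<omega>) D) k \<partial>M) - (1 / pi) ^ k * measure lborel D ^ k\<bar>"
    by (intro tendsto_intros e_lim)
  then have "\<bar>(\<integral>\<omega>. ffact (num_points (G \<omega>) D) k \<partial>M) - (1 / pi) ^ k * measure lborel D ^ k\<bar> \<le> E"
    by (rule LIMSEQ_le_const2) (use f_bound in auto)
  then show "\<bar>(\<integral>\<omega>. ffact (num_points (G \<omega>) D) k \<partial>M) - (measure lborel D / pi) ^ k\<bar>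
      \<le> fact k / pi ^ k * (real k * real k * measure lborel D ^ (k - 1) * s)"
    by (simp add: E_def power_divide)
qed

text \<open>Truncating at a fixed level \<open>k\<close> leaves an error whose limit along
  \<open>F\<close> is \<open>l ^ k / fact k\<close>. So \<open>k\<close> is chosen first and the
  limit is taken afterwards, with no uniformity in \<open>k\<close>.\<close>

lemma void_probability_limit:
  fixes N :: "'i \<Rightarrow> 'w \<Rightarrow> real"
  assumes M: "prob_space M"
    and meas: "\<And>i. N i \<in> borel_measurable M" and nat: "\<And>i \<omega>. N i \<omega> \<in> \<nat>"
    and int: "\<And>i k. integrable M (\<lambda>\<omega>. ffact (N i \<omega>) k)"
    and lim: "\<And>k. ((\<lambda>i. \<integral>\<omega>. ffact (N i \<omega>) k \<partial>M) \<longlongrightarrow> l ^ k) F"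
  shows "((\<lambda>i. measure M {\<omega>\<in>space M. N i \<omega> = 0}) \<longlongrightarrow> exp (- l)) F"
proof (rule tendstoI)
  interpret prob_space M by fact
  note meas[measurable]
  fix \<epsilon> :: real assume "\<epsilon> > 0"
  define S where "S k i = (\<Sum>j\<le>k. (-1) ^ j / fact j * (\<integral>\<omega>. ffact (N i \<omega>) j \<partial>M))" for k i
  have approx: "\<bar>measure M {\<omega>\<in>space M. N i \<omega> = 0} - S k i\<bar> \<le> (\<integral>\<omega>. ffact (N i \<omega>) k \<partial>M) / fact k" for i k
  proof -
    have ind: "integrable M (\<lambda>\<omega>. indicator {\<omega>\<in>space M. N i \<omega> = 0} \<omega> :: real)"
      by (rule integrable_real_indicator) (auto simp: emeasure_eq_measure)
    have intS: "integrable M (\<lambda>\<omega>. \<Sum>j\<le>k. (-1) ^ j / fact j * ffact (N i \<omega>) j)"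
      using int by (intro Bochner_Integration.integrable_sum integrable_mult_right)
    have "measure M {\<omega>\<in>space M. N i \<omega> = 0} - S k i
        = (\<integral>\<omega>. indicator {\<omega>\<in>space M. N i \<omega> = 0} \<omega> - (\<Sum>j\<le>k. (-1) ^ j / fact j * ffact (N i \<omega>) j) \<partial>M)"
      using int by (subst Bochner_Integration.integral_diff[OF ind intS])
        (simp add: S_def Int_absorb1)
    also have "\<bar>\<dots>\<bar> \<le> (\<integral>\<omega>. \<bar>indicator {\<omega>\<in>space M. N i \<omega> = 0} \<omega> - (\<Sum>j\<le>k. (-1) ^ j / fact j * ffact (N i \<omega>) j)\<bar> \<partial>M)"
      by (rule integral_abs_bound)
    also have "\<dots> \<le> (\<integral>\<omega>. ffact (N i \<omega>) k / fact k \<partial>M)"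
    proof (rule integral_mono)
      show "integrable M (\<lambda>\<omega>. \<bar>indicator {\<omega>\<in>space M. N i \<omega> = 0} \<omega> - (\<Sum>j\<le>k. (-1) ^ j / fact j * ffact (N i \<omega>) j)\<bar>)"
        by (intro integrable_abs Bochner_Integration.integrable_diff ind intS)
      show "integrable M (\<lambda>\<omega>. ffact (N i \<omega>) k / fact k)" using int by simp
      fix \<omega> assume \<omega>: "\<omega> \<in> space M"
      obtain n where n: "N i \<omega> = real n" using nat[of i \<omega>] by (auto elim: Nats_cases)
      have "(\<Sum>j\<le>k. (-1) ^ j / fact j * ffact (N i \<omega>) j) = (\<Sum>j\<le>k. (-1) ^ j * real (n choose j))"
        by (simp add: n ffact_of_nat)
      moreover have "ffact (N i \<omega>) k / fact k = real (n choose k)"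
        by (simp add: n ffact_of_nat)
      moreover have "indicator {\<omega>\<in>space M. N i \<omega> = 0} \<omega> = (of_bool (n = 0) :: real)"
        using \<omega> by (simp add: n indicator_def)
      ultimately show "\<bar>indicator {\<omega>\<in>space M. N i \<omega> = 0} \<omega> - (\<Sum>j\<le>k. (-1) ^ j / fact j * ffact (N i \<omega>) j)\<bar> \<le> ffact (N i \<omega>) k / fact k"
        using zero_indicator_binomial_approx[of n k] by simp
    qed
    finally show ?thesis by simp
  qed
  define T where "T k = (\<Sum>j\<le>k. (- l) ^ j / fact j)" for k
  have "(\<lambda>n. (- l) ^ n /\<^sub>R fact n) sums exp (- l)" by (rule exp_converges)
  then have T: "T \<longlonglongrightarrow> exp (- l)"
    unfolding T_def sums_def' by (simp add: divide_inverse mult.commute atMost_atLeast0 sums_def_le flip: sums_def_le)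
  have "(\<lambda>k. l ^ k / fact k) \<longlonglongrightarrow> 0"
    using summable_LIMSEQ_zero[OF summable_exp[of l]] by (simp add: divide_inverse mult.commute)
  then have "(\<lambda>k. \<bar>T k - exp (- l)\<bar> + l ^ k / fact k) \<longlonglongrightarrow> \<bar>exp (- l) - exp (- l)\<bar> + 0"
    by (intro tendsto_intros T)
  then have "eventually (\<lambda>k. \<bar>T k - exp (- l)\<bar> + l ^ k / fact k < \<epsilon>) sequentially"
    using \<open>\<epsilon> > 0\<close> by (intro order_tendstoD) auto
  then obtain k where k: "\<bar>T k - exp (- l)\<bar> + l ^ k / fact k < \<epsilon>"
    by (auto simp: eventually_sequentially)
  have "((\<lambda>i. S k i) \<longlongrightarrow> (\<Sum>j\<le>k. (-1) ^ j / fact j * l ^ j)) F"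
    unfolding S_def by (intro tendsto_intros lim)
  moreover have "(\<Sum>j\<le>k. (-1) ^ j / fact j * l ^ j) = T k"
    by (simp add: T_def power_minus[of l])
  ultimately have "((\<lambda>i. \<bar>S k i - exp (- l)\<bar> + (\<integral>\<omega>. ffact (N i \<omega>) k \<partial>M) / fact k) \<longlongrightarrow> \<bar>T k - exp (- l)\<bar> + l ^ k / fact k) F"
    by (intro tendsto_intros lim) auto
  then have "eventually (\<lambda>i. \<bar>S k i - exp (- l)\<bar> + (\<integral>\<omega>. ffact (N i \<omega>) k \<partial>M) / fact k < \<epsilon>) F"
    using k by (rule order_tendstoD)
  then show "eventually (\<lambda>i. dist (measure M {\<omega>\<in>space M. N i \<omega> = 0}) (exp (- l)) < \<epsilon>) F"
    by eventually_elim (use approx[of _ k] in \<open>smt (verit) dist_real_def\<close>)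
qed

section \<open>Compactness and lattice approximation of configurations\<close>

text \<open>Preimages commute with intersections and unions, so continuity may be tested on the
  subbasis, that is, on the integrals of test functions.\<close>

lemma continuous_on_confI:
  fixes g :: "'b::topological_space \<Rightarrow> 'a::locally_compact_polish_space conf"
  assumes "\<And>f :: 'a \<Rightarrow> real. continuous_on UNIV f \<Longrightarrow> compact (closure {x. f x \<noteq> 0}) \<Longrightarrow>
    continuous_on S (\<lambda>q. \<integral>x. f x \<partial>conf_measure (g q))"
  shows "continuous_on S g"
  unfolding continuous_on_open_invariant
proof (intro allI impI)
  fix B :: "'a conf set" assume "open B"
  then have "generate_topology
     {{\<xi>. (\<integral>x. f x \<partial>conf_measure \<xi>) \<in> U} | (f :: 'a \<Rightarrow> real) U.
        continuous_on UNIV f \<and> compact (closure {x. f x \<noteq> 0}) \<and> open U} B"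
    by (simp add: open_conf_def)
  then show "\<exists>A. open A \<and> A \<inter> S = g -` B \<inter> S"
  proof induction
    case UNIV
    then show ?case by (intro exI[of _ UNIV]) auto
  next
    case (Int a b)
    then obtain A A' where "open A" "A \<inter> S = g -` a \<inter> S" "open A'" "A' \<inter> S = g -` b \<inter> S" by blast
    then show ?case by (intro exI[of _ "A \<inter> A'"]) (auto intro: open_Int)
  next
    case (UN K)
    then obtain A where A: "\<And>k. k \<in> K \<Longrightarrow> open (A k) \<and> A k \<inter> S = g -` k \<inter> S" by metis
    have "(\<Union>k\<in>K. A k) \<inter> S = (\<Union>k\<in>K. A k \<inter> S)" by blast
    also have "\<dots> = (\<Union>k\<in>K. g -` k \<inter> S)" using A by (intro SUP_cong) auto
    also have "\<dots> = g -` \<Union>K \<inter> S" by blast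
    finally show ?case using A by (intro exI[of _ "\<Union>k\<in>K. A k"]) auto
  next
    case (Basis s)
    then obtain f :: "'a \<Rightarrow> real" and U where f: "s = {\<xi>. (\<integral>x. f x \<partial>conf_measure \<xi>) \<in> U}"
      "continuous_on UNIV f" "compact (closure {x. f x \<noteq> 0})" "open U" by blast
    obtain A where "open A" "A \<inter> S = (\<lambda>q. \<integral>x. f x \<partial>conf_measure (g q)) -` U \<inter> S"
      using assms[OF f(2,3)] f(4) unfolding continuous_on_open_invariant by blast
    then show ?case unfolding f(1) by (intro exI[of _ A]) auto
  qed
qed

text \<open>Configurations with at most \<open>c j\<close> points in \<open>[j, j + 1)\<close> are coded by families: the entry
  with index \<open>(j, l)\<close> holds the \<open>l\<close>-th point of \<open>[j, j + 1)\<close> and a flag in \<open>{0, 1}\<close> that tells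
  whether this point is present. The codes form a compact metric space, on which a continuous
  function of the configuration is uniformly continuous.\<close>

definition codes :: "(int \<Rightarrow> nat) \<Rightarrow> (int \<times> nat \<Rightarrow> real \<times> real) set" where
  "codes c = {q. \<forall>j l. q (j, l) \<in> {real_of_int j..real_of_int j + 1} \<times> (if l < c j then {0, 1} else {0})}"

definition decode :: "(int \<times> nat \<Rightarrow> real \<times> real) \<Rightarrow> real conf" where
  "decode q = points_conf {k. snd (q k) = 1} (\<lambda>k. fst (q k))"

lemma codesD:
  assumes "q \<in> codes c"
  shows "real_of_int (fst k) \<le> fst (q k)" "fst (q k) \<le> real_of_int (fst k) + 1"
    "snd (q k) = 0 \<or> snd (q k) = 1" "snd (q k) = 1 \<Longrightarrow> snd k < c (fst k)"
proof -
  have "q (fst k, snd k) \<in> {real_of_int (fst k)..real_of_int (fst k) + 1} \<times> (if snd k < c (fst k) then {0, 1} else {0})"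
    using assms unfolding codes_def mem_Collect_eq by blast
  then have *: "fst (q k) \<in> {real_of_int (fst k)..real_of_int (fst k) + 1}"
    "snd (q k) \<in> (if snd k < c (fst k) then {0, 1} else {0})"
    unfolding prod.collapse mem_Times_iff by blast+
  show "real_of_int (fst k) \<le> fst (q k)" "fst (q k) \<le> real_of_int (fst k) + 1"
    using *(1) unfolding atLeastAtMost_iff by blast+
  show "snd (q k) = 0 \<or> snd (q k) = 1" "snd (q k) = 1 \<Longrightarrow> snd k < c (fst k)"
    using *(2) by (cases "snd k < c (fst k)"; simp)+
qed

lemma codesI:
  assumes "\<And>j l. real_of_int j \<le> fst (q (j, l))" "\<And>j l. fst (q (j, l)) \<le> real_of_int j + 1"
    "\<And>j l. snd (q (j, l)) = 0 \<or> l < c j \<and> snd (q (j, l)) = 1"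
  shows "q \<in> codes c"
  unfolding codes_def mem_Collect_eq mem_Times_iff
proof (intro allI conjI)
  fix j l
  show "fst (q (j, l)) \<in> {real_of_int j..real_of_int j + 1}" using assms(1,2) by simp
  show "snd (q (j, l)) \<in> (if l < c j then {0, 1} else {0})" using assms(3)[where j=j and l=l] by (cases "l < c j"; simp)
qed

text \<open>Tychonoff's theorem; this is why the intervals in \<open>codes\<close> are closed at
  both ends.\<close>

lemma compact_codes: "compact (codes c)"
proof -
  let ?S = "\<lambda>(j, l). {real_of_int j..real_of_int j + 1} \<times> (if l < c j then {0, 1} else {0 :: real})"
  have "compactin (product_topology (\<lambda>_. euclidean) UNIV) (Pi\<^sub>E UNIV ?S)"
    unfolding compactin_PiE by (auto intro!: compact_Times)
  moreover have "Pi\<^sub>E UNIV ?S = codes c"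
    unfolding codes_def PiE_UNIV_domain Pi_def by (simp only: split_paired_All UNIV_I simp_thms case_prod_conv)
  ultimately show ?thesis by (simp add: euclidean_product_topology)
qed

lemma locally_finite_code:
  assumes q: "q \<in> codes c"
  shows "locally_finite_points {k. snd (q k) = 1} (\<lambda>k. fst (q k))"
  unfolding locally_finite_points_def
proof (intro allI impI)
  fix B :: "real set" assume "precompact_borel B"
  then obtain b where b: "\<And>x. x \<in> B \<Longrightarrow> \<bar>x\<bar> \<le> b"
    by (auto simp: precompact_borel_bounded bounded_iff)
  have "{k \<in> {k. snd (q k) = 1}. fst (q k) \<in> B} \<subseteq> Sigma {\<lfloor>- b\<rfloor> - 1..\<lceil>b\<rceil>} (\<lambda>j. {..<c j})"
  proof
    fix k assume k: "k \<in> {k \<in> {k. snd (q k) = 1}. fst (q k) \<in> B}"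
    then have "\<bar>fst (q k)\<bar> \<le> b" using b by blast
    then have "\<lfloor>- b\<rfloor> - 1 \<le> fst k" "fst k \<le> \<lceil>b\<rceil>"
      using codesD(1,2)[OF q, of k] by linarith+
    then show "k \<in> Sigma {\<lfloor>- b\<rfloor> - 1..\<lceil>b\<rceil>} (\<lambda>j. {..<c j})"
      using codesD(4)[OF q, of k] k by (cases k) auto
  qed
  then show "finite {k \<in> {k. snd (q k) = 1}. fst (q k) \<in> B}"
    by (rule finite_subset) auto
qed

text \<open>The support of a test function meets only finitely many blocks, each with finitely many
  admissible entries. With the flags as weights, the integral is a fixed finite sum of continuous
  functions of the entries.\<close>

lemma continuous_on_decode: "continuous_on (codes c) decode"
proof (rule continuous_on_confI)
  fix f :: "real \<Rightarrow> real" assume f: "continuous_on UNIV f" "compact (closure {x. f x \<noteq> 0})"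
  then obtain b where b: "\<And>x. f x \<noteq> 0 \<Longrightarrow> \<bar>x\<bar> \<le> b"
    using bounded_subset[OF compact_imp_bounded[OF f(2)] closure_subset] by (auto simp: bounded_iff)
  define K where "K = Sigma {\<lfloor>- b\<rfloor> - 1..\<lceil>b\<rceil>} (\<lambda>j. {..<c j})"
  have K: "finite K" by (simp add: K_def)
  have "(\<integral>x. f x \<partial>conf_measure (decode q)) = (\<Sum>k\<in>K. snd (q k) * f (fst (q k)))" if q: "q \<in> codes c" for q
  proof -
    have "{k \<in> {k. snd (q k) = 1}. f (fst (q k)) \<noteq> 0} \<subseteq> {k\<in>K. snd (q k) = 1}"
    proof
      fix k assume k: "k \<in> {k \<in> {k. snd (q k) = 1}. f (fst (q k)) \<noteq> 0}"
      then have "\<bar>fst (q k)\<bar> \<le> b" using b by blast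
      then have "\<lfloor>- b\<rfloor> - 1 \<le> fst k" "fst k \<le> \<lceil>b\<rceil>"
        using codesD(1,2)[OF q, of k] by linarith+
      then show "k \<in> {k\<in>K. snd (q k) = 1}"
        using codesD(4)[OF q, of k] k by (cases k) (auto simp: K_def)
    qed
    then have "(\<integral>x. f x \<partial>conf_measure (decode q)) = (\<Sum>k\<in>{k\<in>K. snd (q k) = 1}. f (fst (q k)))"
      unfolding decode_def using K by (intro integral_points_conf locally_finite_code[OF q] f) auto
    also have "\<dots> = (\<Sum>k\<in>{k\<in>K. snd (q k) = 1}. snd (q k) * f (fst (q k)))"
      by (intro sum.cong) auto
    also have "\<dots> = (\<Sum>k\<in>K. snd (q k) * f (fst (q k)))"
      using K codesD(3)[OF q] by (intro sum.mono_neutral_left) auto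
    finally show ?thesis .
  qed
  moreover have "continuous_on (codes c) (\<lambda>q. \<Sum>k\<in>K. snd (q k) * f (fst (q k)))"
  proof (intro continuous_on_sum continuous_on_mult)
    fix k
    have q: "continuous_on (codes c) (\<lambda>q. q k)"
      by (rule continuous_on_subset[OF continuous_on_product_coordinates]) simp
    show "continuous_on (codes c) (\<lambda>q. snd (q k))" by (intro continuous_intros q)
    show "continuous_on (codes c) (\<lambda>q. f (fst (q k)))"
      by (rule continuous_on_compose2[OF f(1)]) (auto intro!: continuous_intros q)
  qed
  ultimately show "continuous_on (codes c) (\<lambda>q. \<integral>x. f x \<partial>conf_measure (decode q))"
    by (simp cong: continuous_on_cong)
qed

text \<open>Codes allow points at the right end of a block for the sake of compactness. The code
  found here avoids that end, so the block of a present point is the floor of its position.\<close>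

lemma code_exists:
  assumes c: "\<And>j. num_points \<xi> {real_of_int j..<real_of_int j + 1} \<le> real (c j)"
  shows "\<exists>q\<in>codes c. \<xi> = decode q \<and> (\<forall>k. snd (q k) = 1 \<longrightarrow> fst (q k) < real_of_int (fst k) + 1)"
proof -
  obtain I :: "nat set" and x where I: "locally_finite_points I x" and \<xi>: "\<xi> = points_conf I x"
    by (rule conf_exhaust)
  define A where "A j = {i\<in>I. x i \<in> {real_of_int j..<real_of_int j + 1}}" for j
  have pc: "precompact_borel {real_of_int j..<real_of_int j + 1}" for j
    by (simp add: precompact_borel_bounded)
  have fin: "finite (A j)" for j
    unfolding A_def using I pc unfolding locally_finite_points_def by blast
  have card: "card (A j) \<le> c j" for j
    using c[of j] num_points_points_conf[OF I pc[of j]] by (simp add: \<xi> A_def)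
  have "\<exists>e. bij_betw e {..<card (A j)} (A j)" for j
    using ex_bij_betw_nat_finite[OF fin[of j]] by (simp add: atLeast0LessThan)
  then obtain e where e: "\<And>j. bij_betw (e j) {..<card (A j)} (A j)" by metis
  define q where "q = (\<lambda>(j, l). if l < card (A j) then (x (e j l), 1 :: real) else (real_of_int j, 0))"
  have eA: "e j l \<in> I" "real_of_int j \<le> x (e j l)" "x (e j l) < real_of_int j + 1" if "l < card (A j)" for j l
    using bij_betw_apply[OF e[of j], of l] that by (auto simp: A_def)
  have K: "{k. snd (q k) = 1} = {(j, l). l < card (A j)}"
    by (auto simp: q_def split: if_splits)
  have "q \<in> codes c"
  proof (rule codesI)
    fix j l
    show "real_of_int j \<le> fst (q (j, l))" "fst (q (j, l)) \<le> real_of_int j + 1"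
      "snd (q (j, l)) = 0 \<or> l < c j \<and> snd (q (j, l)) = 1"
      using eA(2,3)[of l j] card[of j] by (auto simp: q_def)
  qed
  moreover have "\<xi> = decode q"
  proof -
    have "bij_betw (\<lambda>(j, l). e j l) {(j, l). l < card (A j)} I"
      unfolding bij_betw_def
    proof
      show "inj_on (\<lambda>(j, l). e j l) {(j, l). l < card (A j)}"
      proof (rule inj_onI, clarify)
        fix j l j' l' assume l: "l < card (A j)" "l' < card (A j')" and eq: "e j l = e j' l'"
        have "j = j'" using eA(2,3)[OF l(1)] eA(2,3)[OF l(2)] unfolding eq by linarith
        then show "j = j' \<and> l = l'"
          using bij_betw_imp_inj_on[OF e[of j]] l eq by (auto dest: inj_onD)
      qed
      show "(\<lambda>(j, l). e j l) ` {(j, l). l < card (A j)} = I"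
      proof
        show "(\<lambda>(j, l). e j l) ` {(j, l). l < card (A j)} \<subseteq> I" using eA(1) by auto
        show "I \<subseteq> (\<lambda>(j, l). e j l) ` {(j, l). l < card (A j)}"
        proof
          fix i assume "i \<in> I"
          then have "i \<in> A \<lfloor>x i\<rfloor>" by (simp add: A_def)
          then obtain l where "l < card (A \<lfloor>x i\<rfloor>)" "i = e \<lfloor>x i\<rfloor> l"
            using bij_betw_imp_surj_on[OF e[of "\<lfloor>x i\<rfloor>"]] by (metis imageE lessThan_iff)
          then show "i \<in> (\<lambda>(j, l). e j l) ` {(j, l). l < card (A j)}"
            by (intro image_eqI[of _ _ "(\<lfloor>x i\<rfloor>, l)"]) auto
        qed
      qed
    qed
    then have "points_conf {k. snd (q k) = 1} (\<lambda>k. fst (q k)) = points_conf I x"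
      unfolding K by (rule points_conf_cong_bij) (auto simp: q_def)
    then show ?thesis by (simp add: decode_def \<xi>)
  qed
  moreover have "fst (q k) < real_of_int (fst k) + 1" if "snd (q k) = 1" for k
    using that eA(3) by (auto simp: q_def split: prod.splits if_splits)
  ultimately show ?thesis by blast
qed

section \<open>Rounding configurations to a lattice\<close>

definition cell :: "nat \<Rightarrow> int \<Rightarrow> real set" where
  "cell m p = {real_of_int p / real m..<(real_of_int p + 1) / real m}"

text \<open>For positive \<open>m\<close>, these are the indices of the cells that make up
  \<open>[-n, n)\<close>.\<close>

definition window :: "nat \<Rightarrow> nat \<Rightarrow> int set" where
  "window n m = {- int (n * m)..<int (n * m)}"

definition occupied :: "nat \<Rightarrow> nat \<Rightarrow> real conf \<Rightarrow> int set" where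
  "occupied n m \<xi> = {p \<in> window n m. num_points \<xi> (cell m p) \<noteq> 0}"

definition lattice_conf :: "nat \<Rightarrow> int set \<Rightarrow> real conf" where
  "lattice_conf m S = points_conf S (\<lambda>p. real_of_int p / real m)"

lemma cell_iff: "0 < m \<Longrightarrow> x \<in> cell m p \<longleftrightarrow> \<lfloor>real m * x\<rfloor> = p"
  by (auto simp: cell_def floor_eq_iff field_simps)

lemma precompact_cell: "precompact_borel (cell m p)"
  by (simp add: cell_def precompact_borel_bounded)

text \<open>Entries of the blocks in \<open>[-n, n)\<close> move to the left ends of their cells.
  All others keep their position and only lose the flag, so that a code results whose decoded
  configuration is finite.\<close>

definition round_code :: "nat \<Rightarrow> nat \<Rightarrow> (int \<times> nat \<Rightarrow> real \<times> real) \<Rightarrow> int \<times> nat \<Rightarrow> real \<times> real" where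
  "round_code n m q k = (if - int n \<le> fst k \<and> fst k < int n
     then (real_of_int \<lfloor>real m * fst (q k)\<rfloor> / real m, snd (q k)) else (fst (q k), 0))"

text \<open>Rounding down to a multiple of \<open>1 / m\<close> cannot cross the left end
  \<open>j\<close> of a block, because \<open>j\<close> is itself such a multiple.\<close>

lemma round_code_in_codes:
  assumes q: "q \<in> codes c" and m: "0 < m"
  shows "round_code n m q \<in> codes c"
proof (rule codesI)
  fix j :: int and l :: nat
  have "real m * real_of_int j \<le> real m * fst (q (j, l))"
    using codesD(1)[OF q, of "(j, l)"] by (intro mult_left_mono) auto
  then have "int m * j \<le> \<lfloor>real m * fst (q (j, l))\<rfloor>" by (subst le_floor_iff) simp
  then have "real_of_int (int m * j) \<le> real_of_int \<lfloor>real m * fst (q (j, l))\<rfloor>"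
    by (simp only: of_int_le_iff)
  then have 1: "real_of_int j \<le> real_of_int \<lfloor>real m * fst (q (j, l))\<rfloor> / real m"
    using m by (simp add: field_simps)
  have "real_of_int \<lfloor>real m * fst (q (j, l))\<rfloor> \<le> real m * fst (q (j, l))" by simp
  then have 2: "real_of_int \<lfloor>real m * fst (q (j, l))\<rfloor> / real m \<le> fst (q (j, l))"
    using m by (simp add: field_simps)
  note q' = codesD[OF q, of "(j, l)"]
  show "real_of_int j \<le> fst (round_code n m q (j, l))" using 1 q' by (simp add: round_code_def)
  show "fst (round_code n m q (j, l)) \<le> real_of_int j + 1" using 2 q' by (auto simp: round_code_def)
  show "snd (round_code n m q (j, l)) = 0 \<or> l < c j \<and> snd (round_code n m q (j, l)) = 1"
    using q' by (auto simp: round_code_def)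
qed

text \<open>Rounding could put several points on one lattice site, while \<open>lattice_conf\<close>
  puts exactly one there. Under \<open>le1\<close> the map \<open>g\<close> matches the points in
  the window with the occupied cells one to one.\<close>

lemma decode_round_code:
  assumes q: "q \<in> codes c" "\<And>k. snd (q k) = 1 \<Longrightarrow> fst (q k) < real_of_int (fst k) + 1" and m: "0 < m"
    and le1: "\<And>p. p \<in> window n m \<Longrightarrow> num_points (decode q) (cell m p) \<le> 1"
  shows "decode (round_code n m q) = lattice_conf m (occupied n m (decode q))"
proof -
  define P where "P p = {k. snd (q k) = 1 \<and> fst (q k) \<in> cell m p}" for p
  have finP: "finite (P p)" for p
    using locally_finite_code[OF q(1)] precompact_cell[of m p] unfolding locally_finite_points_def P_def by auto
  have num: "num_points (decode q) (cell m p) = real (card (P p))" for p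
    unfolding decode_def by (subst num_points_points_conf[OF locally_finite_code[OF q(1)] precompact_cell]) (simp add: P_def)
  define K where "K = {k. snd (q k) = 1 \<and> - int n \<le> fst k \<and> fst k < int n}"
  define g where "g k = \<lfloor>real m * fst (q k)\<rfloor>" for k
  have gP: "k \<in> P (g k)" if "snd (q k) = 1" for k
    using that m by (simp add: P_def cell_iff g_def)
  \<comment> \<open>The cut by blocks and the cut by cells agree because both describe the points of
    \<open>[-n, n)\<close>; the strict upper bound on positions is used here.\<close>
  have win: "g k \<in> window n m \<longleftrightarrow> - int n \<le> fst k \<and> fst k < int n" if "snd (q k) = 1" for k
  proof -
    have "\<lfloor>fst (q k)\<rfloor> = fst k"
      using codesD(1)[OF q(1), of k] q(2)[OF that] by (intro floor_unique) auto
    then have "- int n \<le> fst k \<and> fst k < int n \<longleftrightarrow> - real n \<le> fst (q k) \<and> fst (q k) < real n"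
      by linarith
    also have "- real n \<le> fst (q k) \<longleftrightarrow> real m * (- real n) \<le> real m * fst (q k)"
      using m by (intro mult_le_cancel_left_pos[symmetric]) simp
    also have "fst (q k) < real n \<longleftrightarrow> real m * fst (q k) < real m * real n"
      using m by (intro mult_less_cancel_left_pos[symmetric]) simp
    also have "real m * (- real n) = real_of_int (- int (n * m))" by simp
    also have "real m * real n = real_of_int (int (n * m))" by simp
    also have "real_of_int (- int (n * m)) \<le> real m * fst (q k) \<and> real m * fst (q k) < real_of_int (int (n * m)) \<longleftrightarrow> g k \<in> window n m"
      unfolding g_def window_def atLeastLessThan_iff le_floor_iff floor_less_iff ..
    finally show ?thesis by blast
  qed
  have "bij_betw g K (occupied n m (decode q))"
    unfolding bij_betw_def
  proof
    show "inj_on g K"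
    proof (rule inj_onI)
      fix k k' assume k: "k \<in> K" "k' \<in> K" "g k = g k'"
      then have "k \<in> P (g k)" "k' \<in> P (g k)" using gP[of k] gP[of k'] by (simp_all add: K_def)
      moreover have "card (P (g k)) \<le> Suc 0"
        using le1[of "g k"] k win by (simp add: num K_def)
      ultimately show "k = k'" using card_le_Suc0_iff_eq[OF finP] by blast
    qed
    show "g ` K = occupied n m (decode q)"
    proof (intro equalityI subsetI)
      fix p assume "p \<in> g ` K"
      then obtain k where k: "k \<in> K" "p = g k" by blast
      then have "k \<in> P p" "p \<in> window n m" using gP win by (auto simp: K_def)
      then show "p \<in> occupied n m (decode q)" using finP[of p] card_gt_0_iff[of "P p"] by (auto simp: occupied_def num)
    next
      fix p assume p: "p \<in> occupied n m (decode q)"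
      then have "P p \<noteq> {}" by (auto simp: occupied_def num)
      then obtain k where k: "snd (q k) = 1" "fst (q k) \<in> cell m p" by (auto simp: P_def)
      then have "p = g k" using m by (simp add: cell_iff g_def)
      moreover have "k \<in> K" using p win[OF k(1)] k(1) unfolding \<open>p = g k\<close> by (simp add: K_def occupied_def)
      ultimately show "p \<in> g ` K" by blast
    qed
  qed
  then have "points_conf K (\<lambda>k. fst (round_code n m q k)) = lattice_conf m (occupied n m (decode q))"
    unfolding lattice_conf_def by (rule points_conf_cong_bij) (simp add: K_def round_code_def g_def)
  moreover have "{k. snd (round_code n m q k) = 1} = K"
    by (auto simp: round_code_def K_def)
  ultimately show ?thesis by (simp add: decode_def)
qed

text \<open>In the product metric late entries weigh little whatever their values are, so erasing
  far points is cheap, and near entries move by at most \<open>1 / m\<close>. Both effects are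
  uniform in \<open>q\<close>.\<close>

lemma round_code_close:
  assumes "\<delta> > 0"
  shows "\<exists>n m0. 0 < m0 \<and> (\<forall>m\<ge>m0. \<forall>q. dist (round_code n m q) q < \<delta>)"
proof -
  obtain N where N: "(1 / 2) ^ N < \<delta> / 2"
    using real_arch_pow_inv[of "\<delta> / 2" "1 / 2"] assms by auto
  \<comment> \<open>Large enough for the blocks of the entries numbered \<open>0\<close> to
    \<open>N\<close> to lie in \<open>[-n, n)\<close>; the sum is a crude bound for all of
    them.\<close>
  define n where "n = (\<Sum>i\<le>N. nat \<bar>fst (from_nat i :: int \<times> nat)\<bar>) + 1"
  have n: "- int n \<le> fst (from_nat i :: int \<times> nat) \<and> fst (from_nat i :: int \<times> nat) < int n" if "i \<le> N" for i
  proof -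
    have "nat \<bar>fst (from_nat i :: int \<times> nat)\<bar> \<le> (\<Sum>i\<le>N. nat \<bar>fst (from_nat i :: int \<times> nat)\<bar>)"
      using that by (intro member_le_sum) auto
    then show ?thesis unfolding n_def by linarith
  qed
  \<comment> \<open>The rounding error \<open>1 / m\<close> becomes at most
    \<open>\<delta> / 8\<close>; the metric estimate doubles it and adds a tail below
    \<open>\<delta> / 2\<close>.\<close>
  obtain m0 :: nat where m0: "8 / \<delta> < real m0" using reals_Archimedean2 by blast
  have "0 < m0" using m0 assms by (cases m0) auto
  moreover have "dist (round_code n m q) q < \<delta>" if "m0 \<le> m" for m q
  proof -
    have m: "0 < m" "8 / \<delta> < real m" using \<open>0 < m0\<close> that m0 by auto
    have "dist (round_code n m q (from_nat i)) (q (from_nat i)) \<le> \<delta> / 8" if "i \<le> N" for i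
    proof -
      let ?k = "from_nat i :: int \<times> nat"
      have "\<bar>real_of_int \<lfloor>real m * fst (q ?k)\<rfloor> / real m - fst (q ?k)\<bar> = \<bar>real_of_int \<lfloor>real m * fst (q ?k)\<rfloor> - real m * fst (q ?k)\<bar> / real m"
        using m by (simp add: field_simps abs_divide[symmetric] del: abs_divide)
      also have "\<dots> \<le> 1 / real m"
        by (intro divide_right_mono) (linarith | simp)+
      also have "\<dots> \<le> \<delta> / 8"
        using m assms by (simp add: field_simps)
      finally show ?thesis
        using n[OF that] by (simp add: round_code_def dist_prod_def dist_real_def)
    qed
    then have "Max {dist (round_code n m q (from_nat i)) (q (from_nat i)) |i. i \<le> N} \<le> \<delta> / 8"
      by (subst Max_le_iff) auto
    then show ?thesis
      using dist_fun_le_dist_first_terms[of "round_code n m q" q N] N assms by linarith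
  qed
  ultimately show ?thesis by blast
qed

text \<open>On the compact set of codes, \<open>h\<close> after \<open>decode\<close> is uniformly
  continuous. Hence one \<open>n\<close> and one \<open>m0\<close> serve all configurations
  dominated by \<open>c\<close>.\<close>

lemma lattice_approximation:
  fixes h :: "real conf \<Rightarrow> real"
  assumes h: "continuous_on UNIV h" and "\<epsilon> > 0"
  shows "\<exists>n m0. 0 < m0 \<and> (\<forall>m\<ge>m0. \<forall>\<xi>.
    (\<forall>j. num_points \<xi> {real_of_int j..<real_of_int j + 1} \<le> real (c j)) \<longrightarrow>
    (\<forall>p\<in>window n m. num_points \<xi> (cell m p) \<le> 1) \<longrightarrow>
    \<bar>h (lattice_conf m (occupied n m \<xi>)) - h \<xi>\<bar> < \<epsilon>)"
proof -
  have "continuous_on (codes c) (\<lambda>q. h (decode q))"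
    by (rule continuous_on_compose2[OF h continuous_on_decode]) auto
  then have "uniformly_continuous_on (codes c) (\<lambda>q. h (decode q))"
    using compact_codes by (rule compact_uniformly_continuous)
  then obtain \<delta> where \<delta>: "\<delta> > 0"
    "\<And>q q'. q \<in> codes c \<Longrightarrow> q' \<in> codes c \<Longrightarrow> dist q' q < \<delta> \<Longrightarrow> dist (h (decode q')) (h (decode q)) < \<epsilon>"
    using \<open>\<epsilon> > 0\<close> unfolding uniformly_continuous_on_def by metis
  obtain n m0 where nm: "0 < m0" "\<And>m q. m0 \<le> m \<Longrightarrow> dist (round_code n m q) q < \<delta>"
    using round_code_close[OF \<delta>(1)] by metis
  have "\<bar>h (lattice_conf m (occupied n m \<xi>)) - h \<xi>\<bar> < \<epsilon>"
    if m: "m0 \<le> m" and c: "\<And>j. num_points \<xi> {real_of_int j..<real_of_int j + 1} \<le> real (c j)"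
      and le1: "\<And>p. p \<in> window n m \<Longrightarrow> num_points \<xi> (cell m p) \<le> 1" for m \<xi>
  proof -
    obtain q where q: "q \<in> codes c" "\<xi> = decode q" "\<And>k. snd (q k) = 1 \<Longrightarrow> fst (q k) < real_of_int (fst k) + 1"
      using code_exists[OF c] by metis
    have m': "0 < m" using m nm(1) by simp
    have "dist (h (decode (round_code n m q))) (h (decode q)) < \<epsilon>"
      by (rule \<delta>(2)[OF q(1) round_code_in_codes[OF q(1) m'] nm(2)[OF m]])
    moreover have "decode (round_code n m q) = lattice_conf m (occupied n m \<xi>)"
      unfolding q(2) by (rule decode_round_code[OF q(1,3) m' le1[unfolded q(2)]])
    ultimately show ?thesis by (simp add: q(2) dist_real_def)
  qed
  then show ?thesis using nm(1) by metis
qed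

text \<open>Moebius inversion over finite subsets, with coefficients that do not depend on
  \<open>S\<close>.\<close>

lemma set_function_expansion:
  fixes \<phi> :: "'c set \<Rightarrow> real"
  shows "\<exists>a. \<forall>S. finite S \<longrightarrow> \<phi> S = (\<Sum>T\<in>Pow S. a T)"
proof -
  define g where "g S = (\<Sum>T\<in>Pow S. (-1) ^ card T * \<phi> T)" for S
  have "\<phi> S = (\<Sum>T\<in>Pow S. (-1) ^ card T * g T)" if "finite S" for S
    by (rule inclusion_exclusion_symmetric[OF _ that]) (simp add: g_def)
  then show ?thesis by blast
qed

lemma num_points_Union_cells_eq_0:
  assumes m: "0 < m" and T: "finite T"
  shows "num_points \<xi> (\<Union>p\<in>T. cell m p) = 0 \<longleftrightarrow> (\<forall>p\<in>T. num_points \<xi> (cell m p) = 0)"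
proof -
  have "disjoint_family_on (cell m) T"
    using m by (auto simp: disjoint_family_on_def cell_iff)
  then have "num_points \<xi> (\<Union>p\<in>T. cell m p) = (\<Sum>p\<in>T. num_points \<xi> (cell m p))"
    using T precompact_cell by (intro num_points_UN)
  also have "\<dots> = 0 \<longleftrightarrow> (\<forall>p\<in>T. num_points \<xi> (cell m p) = 0)"
    using T by (intro sum_nonneg_eq_0_iff) (auto simp: num_points_def)
  finally show ?thesis .
qed

lemma precompact_Union_cells: "finite T \<Longrightarrow> precompact_borel (\<Union>p\<in>T. cell m p)"
  using precompact_cell[of m] unfolding precompact_borel_bounded by (auto intro!: sets.finite_UN)

lemma finite_window: "finite (window n m)"
  by (simp add: window_def)

text \<open>The expansion is made in the set \<open>S\<close> of empty cells, not in the occupied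
  ones, because \<open>T \<subseteq> S\<close> says that the union of the cells of \<open>T\<close>
  is void. The coefficients are the same for all configurations.\<close>

lemma lattice_conf_expansion:
  fixes h :: "real conf \<Rightarrow> real"
  assumes m: "0 < m"
  shows "\<exists>a. \<forall>\<xi>. h (lattice_conf m (occupied n m \<xi>)) =
    (\<Sum>T\<in>Pow (window n m). a T * of_bool (num_points \<xi> (\<Union>p\<in>T. cell m p) = 0))"
proof -
  obtain a where a: "\<And>S. finite S \<Longrightarrow> h (lattice_conf m (window n m - S)) = (\<Sum>T\<in>Pow S. a T)"
    using set_function_expansion[of "\<lambda>S. h (lattice_conf m (window n m - S))"] by metis
  have "h (lattice_conf m (occupied n m \<xi>)) =
    (\<Sum>T\<in>Pow (window n m). a T * of_bool (num_points \<xi> (\<Union>p\<in>T. cell m p) = 0))" for \<xi>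
  proof -
    define S where "S = {p\<in>window n m. num_points \<xi> (cell m p) = 0}"
    have S: "finite S" "S \<subseteq> window n m" by (auto simp: S_def finite_window)
    have "occupied n m \<xi> = window n m - S" by (auto simp: S_def occupied_def)
    then have "h (lattice_conf m (occupied n m \<xi>)) = (\<Sum>T\<in>Pow S. a T)" using a[OF S(1)] by simp
    also have "\<dots> = (\<Sum>T\<in>Pow S. a T * of_bool (num_points \<xi> (\<Union>p\<in>T. cell m p) = 0))"
    proof (intro sum.cong refl)
      fix T assume T: "T \<in> Pow S"
      then have "finite T" using S finite_subset by blast
      then have "num_points \<xi> (\<Union>p\<in>T. cell m p) = 0"
        unfolding num_points_Union_cells_eq_0[OF m \<open>finite T\<close>] using T by (auto simp: S_def)
      then show "a T = a T * of_bool (num_points \<xi> (\<Union>p\<in>T. cell m p) = 0)" by simp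
    qed
    also have "\<dots> = (\<Sum>T\<in>Pow (window n m). a T * of_bool (num_points \<xi> (\<Union>p\<in>T. cell m p) = 0))"
    proof (rule sum.mono_neutral_left)
      show "\<forall>T\<in>Pow (window n m) - Pow S. a T * of_bool (num_points \<xi> (\<Union>p\<in>T. cell m p) = 0) = 0"
      proof
        fix T assume T: "T \<in> Pow (window n m) - Pow S"
        then have fin: "finite T" using finite_window finite_subset by blast
        obtain p where "p \<in> T" "p \<notin> S" using T by blast
        then have "num_points \<xi> (\<Union>p\<in>T. cell m p) \<noteq> 0"
          unfolding num_points_Union_cells_eq_0[OF m fin] using T by (auto simp: S_def)
        then show "a T * of_bool (num_points \<xi> (\<Union>p\<in>T. cell m p) = 0) = 0" by simp
      qed
    qed (use S finite_window in auto)
    finally show ?thesis .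
  qed
  then show ?thesis by blast
qed

section \<open>Expectations of lattice approximations\<close>

lemma (in prob_space) abs_integral_diff_le:
  fixes f g :: "'a \<Rightarrow> real"
  assumes [measurable]: "f \<in> borel_measurable M" "g \<in> borel_measurable M" "B \<in> events"
    and bd: "\<And>x. \<bar>f x\<bar> \<le> H" "\<And>x. \<bar>g x\<bar> \<le> H"
    and close: "\<And>x. x \<in> space M \<Longrightarrow> x \<notin> B \<Longrightarrow> \<bar>f x - g x\<bar> \<le> e" and "0 \<le> e"
    and B: "prob B \<le> \<beta>"
  shows "\<bar>(\<integral>x. f x \<partial>M) - (\<integral>x. g x \<partial>M)\<bar> \<le> e + 2 * H * \<beta>"
proof -
  have H: "0 \<le> H" using order_trans[OF abs_ge_zero bd(1)] .
  have int: "integrable M f" "integrable M g"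
    using bd by (auto intro!: integrable_const_bound[where B=H])
  have intB: "integrable M (\<lambda>x. e + 2 * H * indicator B x)"
    by (intro Bochner_Integration.integrable_add integrable_mult_right integrable_real_indicator)
      (auto simp: emeasure_eq_measure)
  have "\<bar>(\<integral>x. f x \<partial>M) - (\<integral>x. g x \<partial>M)\<bar> = \<bar>\<integral>x. f x - g x \<partial>M\<bar>"
    using int by simp
  also have "\<dots> \<le> (\<integral>x. \<bar>f x - g x\<bar> \<partial>M)" by (rule integral_abs_bound)
  also have "\<dots> \<le> (\<integral>x. e + 2 * H * indicator B x \<partial>M)"
  proof (rule integral_mono[OF _ intB])
    show "integrable M (\<lambda>x. \<bar>f x - g x\<bar>)" using int by auto
    fix x assume x: "x \<in> space M"
    show "\<bar>f x - g x\<bar> \<le> e + 2 * H * indicator B x"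
    proof (cases "x \<in> B")
      case True
      have "\<bar>f x - g x\<bar> \<le> H + H" using bd(1)[of x] bd(2)[of x] by linarith
      then show ?thesis using True \<open>0 \<le> e\<close> by simp
    next
      case False
      then show ?thesis using close[OF x] by simp
    qed
  qed
  also have "\<dots> = e + 2 * H * prob B"
    using intB by (subst Bochner_Integration.integral_add) (auto simp: prob_space emeasure_eq_measure intro!: integrable_mult_right integrable_real_indicator)
  also have "\<dots> \<le> e + 2 * H * \<beta>"
    using B H by (intro add_left_mono mult_left_mono) auto
  finally show ?thesis .
qed

lemma (in prob_space) prob_UN_geometric_le:
  assumes A: "\<And>k. A k \<in> events" and le: "\<And>k. prob (A k) \<le> e * (1 / 2) ^ Suc k"
  shows "prob (\<Union>k::nat. A k) \<le> e"
proof -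
  have sums: "(\<lambda>k. e * (1 / 2) ^ Suc k) sums (e * 1)"
    by (intro sums_mult power_half_series)
  have summ: "summable (\<lambda>k. prob (A k))"
    using le by (intro summable_comparison_test[OF _ sums_summable[OF sums]] exI[of _ 0]) simp
  have "prob (\<Union>k. A k) \<le> (\<Sum>k. prob (A k))"
    using A by (intro finite_measure_subadditive_countably summ) auto
  also have "\<dots> \<le> (\<Sum>k. e * (1 / 2) ^ Suc k)"
    using le by (intro suminf_le summ sums_summable[OF sums])
  also have "\<dots> = e" using sums_unique[OF sums] by simp
  finally show ?thesis .
qed

text \<open>Continuity from above, as the events decrease to the empty set. This controls the blocks
  of the limit process; the approximating processes are controlled by Markov's inequality.\<close>

lemma (in prob_space) tail_probability_small:
  fixes f :: "'a \<Rightarrow> real"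
  assumes [measurable]: "f \<in> borel_measurable M" and "0 < e"
  shows "\<exists>c0 :: nat. \<forall>c\<ge>c0. prob {x\<in>space M. f x > real c} \<le> e"
proof -
  have "(\<lambda>c. prob {x\<in>space M. f x > real c}) \<longlonglongrightarrow> prob (\<Inter>c. {x\<in>space M. f x > real c})"
    by (rule finite_Lim_measure_decseq) (auto simp: decseq_def)
  also have "(\<Inter>c. {x\<in>space M. f x > real c}) = {}"
  proof -
    have "\<exists>c. \<not> f x > real c" for x using real_arch_simple[of "f x"] by (auto simp: not_less)
    then show ?thesis by blast
  qed
  finally have "(\<lambda>c. prob {x\<in>space M. f x > real c}) \<longlonglongrightarrow> 0" by simp
  then have "eventually (\<lambda>c. prob {x\<in>space M. f x > real c} < e) sequentially"
    using \<open>0 < e\<close> by (rule order_tendstoD)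
  then show ?thesis unfolding eventually_sequentially by (meson less_imp_le)
qed

text \<open>The approximation fails only on an exceptional event, consisting of overfull blocks,
  with geometric weights along the enumeration \<open>int_decode\<close> of the integers, and of
  window cells with several points. Each of the two kinds has probability at most \<open>e\<close>,
  hence the factor \<open>2 * e\<close>.\<close>

lemma (in prob_space) lattice_expectation_close:
  fixes h :: "real conf \<Rightarrow> real" and Z :: "'a \<Rightarrow> real conf"
  assumes m: "0 < m"
    and h: "(\<lambda>x. h (Z x)) \<in> borel_measurable M" "\<And>\<xi>. \<bar>h \<xi>\<bar> \<le> H"
    and Z: "\<And>B. precompact_borel B \<Longrightarrow> (\<lambda>x. num_points (Z x) B) \<in> borel_measurable M"
    and approx: "\<And>\<xi>. (\<forall>j. num_points \<xi> {real_of_int j..<real_of_int j + 1} \<le> real (c j)) \<Longrightarrow>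
      (\<forall>p\<in>window n m. num_points \<xi> (cell m p) \<le> 1) \<Longrightarrow>
      \<bar>h (lattice_conf m (occupied n m \<xi>)) - h \<xi>\<bar> < e"
    and tail: "\<And>k. prob {x\<in>space M. num_points (Z x) {real_of_int (int_decode k)..<real_of_int (int_decode k) + 1} > real (c (int_decode k))}
      \<le> e * (1 / 2) ^ Suc k"
    and multi: "(\<Sum>p\<in>window n m. prob {x\<in>space M. num_points (Z x) (cell m p) > 1}) \<le> e"
    and e: "0 < e"
  shows "\<bar>(\<integral>x. h (lattice_conf m (occupied n m (Z x))) \<partial>M) - (\<integral>x. h (Z x) \<partial>M)\<bar> \<le> e + 2 * H * (2 * e)"
proof (rule abs_integral_diff_le[OF _ h(1)])
  define A where "A k = {x\<in>space M. num_points (Z x) {real_of_int (int_decode k)..<real_of_int (int_decode k) + 1} > real (c (int_decode k))}" for k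
  define D where "D p = {x\<in>space M. num_points (Z x) (cell m p) > 1}" for p
  have [measurable]: "(\<lambda>x. num_points (Z x) {real_of_int j..<real_of_int j + 1}) \<in> borel_measurable M" for j
    by (rule Z) (simp add: precompact_borel_bounded)
  have [measurable]: "(\<lambda>x. num_points (Z x) (cell m p)) \<in> borel_measurable M" for p
    by (rule Z) (rule precompact_cell)
  have A: "A k \<in> events" for k unfolding A_def by measurable
  have D: "D p \<in> events" for p unfolding D_def by measurable
  show "(\<Union>k. A k) \<union> (\<Union>p\<in>window n m. D p) \<in> events"
    using A D finite_window by (intro sets.Un sets.countable_UN sets.finite_UN) auto
  have "prob ((\<Union>k. A k) \<union> (\<Union>p\<in>window n m. D p)) \<le> prob (\<Union>k. A k) + prob (\<Union>p\<in>window n m. D p)"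
    using A D finite_window by (intro measure_Un_le sets.countable_UN sets.finite_UN) auto
  also have "prob (\<Union>k. A k) \<le> e"
    by (rule prob_UN_geometric_le[OF A]) (unfold A_def, rule tail)
  also have "prob (\<Union>p\<in>window n m. D p) \<le> (\<Sum>p\<in>window n m. prob (D p))"
    using D finite_window by (intro finite_measure_subadditive_finite) auto
  also have "\<dots> \<le> e" using multi by (simp add: D_def)
  finally show "prob ((\<Union>k. A k) \<union> (\<Union>p\<in>window n m. D p)) \<le> 2 * e" by simp
  show "\<bar>h (lattice_conf m (occupied n m (Z x))) - h (Z x)\<bar> \<le> e"
    if x: "x \<in> space M" "x \<notin> (\<Union>k. A k) \<union> (\<Union>p\<in>window n m. D p)" for x
  proof (rule less_imp_le, rule approx)
    show "\<forall>j. num_points (Z x) {real_of_int j..<real_of_int j + 1} \<le> real (c j)"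
    proof
      fix j
      have "x \<notin> A (int_encode j)" using x(2) by blast
      then show "num_points (Z x) {real_of_int j..<real_of_int j + 1} \<le> real (c j)"
        using x(1) by (simp add: A_def not_less)
    qed
    show "\<forall>p\<in>window n m. num_points (Z x) (cell m p) \<le> 1"
      using x by (auto simp: D_def not_less)
  qed
  \<comment> \<open>Measurability follows from the expansion into finitely many indicators of void
    events.\<close>
  obtain a where a: "\<And>\<xi>. h (lattice_conf m (occupied n m \<xi>)) =
    (\<Sum>T\<in>Pow (window n m). a T * of_bool (num_points \<xi> (\<Union>p\<in>T. cell m p) = 0))"
    using lattice_conf_expansion[OF m, of h n] by metis
  show "(\<lambda>x. h (lattice_conf m (occupied n m (Z x)))) \<in> borel_measurable M"
    unfolding a
  proof (intro borel_measurable_sum borel_measurable_times borel_measurable_const)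
    fix T assume "T \<in> Pow (window n m)"
    then have "finite T" using finite_window finite_subset by blast
    then have [measurable]: "(\<lambda>x. num_points (Z x) (\<Union>p\<in>T. cell m p)) \<in> borel_measurable M"
      by (intro Z precompact_Union_cells)
    show "(\<lambda>x. of_bool (num_points (Z x) (\<Union>p\<in>T. cell m p) = 0)) \<in> borel_measurable M"
      unfolding of_bool_def by measurable
  qed
qed (use h e in auto)

lemma (in prob_space) lattice_expectation:
  assumes a: "\<And>\<xi>. h (lattice_conf m (occupied n m \<xi>)) =
    (\<Sum>T\<in>Pow (window n m). a T * of_bool (num_points \<xi> (\<Union>p\<in>T. cell m p) = 0))"
    and Z: "\<And>B. precompact_borel B \<Longrightarrow> (\<lambda>x. num_points (Z x) B) \<in> borel_measurable M"
  shows "(\<integral>x. h (lattice_conf m (occupied n m (Z x))) \<partial>M) =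
    (\<Sum>T\<in>Pow (window n m). a T * prob {x\<in>space M. num_points (Z x) (\<Union>p\<in>T. cell m p) = 0})"
proof -
  have int: "integrable M (\<lambda>x. of_bool (num_points (Z x) (\<Union>p\<in>T. cell m p) = 0) :: real)"
    and val: "(\<integral>x. of_bool (num_points (Z x) (\<Union>p\<in>T. cell m p) = 0) \<partial>M)
      = prob {x\<in>space M. num_points (Z x) (\<Union>p\<in>T. cell m p) = 0}" if T: "T \<in> Pow (window n m)" for T
  proof -
    have "finite T" using T finite_window finite_subset by blast
    then have [measurable]: "(\<lambda>x. num_points (Z x) (\<Union>p\<in>T. cell m p)) \<in> borel_measurable M"
      by (intro Z precompact_Union_cells)
    define V where "V = {x\<in>space M. num_points (Z x) (\<Union>p\<in>T. cell m p) = 0}"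
    have V: "V \<in> events" unfolding V_def by measurable
    have eq: "of_bool (num_points (Z x) (\<Union>p\<in>T. cell m p) = 0) = (indicator V x :: real)" if "x \<in> space M" for x
      using that by (simp add: V_def indicator_def)
    show "integrable M (\<lambda>x. of_bool (num_points (Z x) (\<Union>p\<in>T. cell m p) = 0) :: real)"
      using V by (subst Bochner_Integration.integrable_cong[OF refl eq]) (auto intro!: integrable_real_indicator simp: emeasure_eq_measure)
    have "(\<integral>x. of_bool (num_points (Z x) (\<Union>p\<in>T. cell m p) = 0) \<partial>M) = (\<integral>x. (indicator V x :: real) \<partial>M)"
      by (rule Bochner_Integration.integral_cong[OF refl eq])
    also have "\<dots> = prob V" using V by simp
    finally show "(\<integral>x. of_bool (num_points (Z x) (\<Union>p\<in>T. cell m p) = 0) \<partial>M) = prob {x\<in>space M. num_points (Z x) (\<Union>p\<in>T. cell m p) = 0}"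
      by (simp add: V_def)
  qed
  have "(\<integral>x. h (lattice_conf m (occupied n m (Z x))) \<partial>M)
      = (\<Sum>T\<in>Pow (window n m). \<integral>x. a T * of_bool (num_points (Z x) (\<Union>p\<in>T. cell m p) = 0) \<partial>M)"
    unfolding a by (rule Bochner_Integration.integral_sum) (rule integrable_mult_right, rule int)
  also have "\<dots> = (\<Sum>T\<in>Pow (window n m). a T * prob {x\<in>space M. num_points (Z x) (\<Union>p\<in>T. cell m p) = 0})"
  proof (intro sum.cong refl)
    fix T assume T: "T \<in> Pow (window n m)"
    show "(\<integral>x. a T * of_bool (num_points (Z x) (\<Union>p\<in>T. cell m p) = 0) \<partial>M) = a T * prob {x\<in>space M. num_points (Z x) (\<Union>p\<in>T. cell m p) = 0}"
      unfolding val[OF T, symmetric] by (rule integral_mult_right_zero)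
  qed
  finally show ?thesis .
qed

text \<open>Turns \<open>l - 1 + exp (- l)\<close>, the bound from
  \<open>multiple_point_probability_le\<close> for a count with mean \<open>l\<close> and void
  probability \<open>exp (- l)\<close>, into the square of \<open>l\<close>.\<close>

lemma exp_minus_le: "0 \<le> x \<Longrightarrow> exp (- x) \<le> 1 - x + x\<^sup>2" for x :: real
proof -
  assume x: "0 \<le> x"
  have "1 + x ^ 3 = (1 - x + x\<^sup>2) * (1 + x)" by (simp add: algebra_simps power2_eq_square power3_eq_cube)
  also have "\<dots> \<le> (1 - x + x\<^sup>2) * exp x"
  proof (rule mult_left_mono[OF exp_ge_add_one_self])
    have "0 \<le> (1 - x)\<^sup>2 + x" using x by simp
    then show "0 \<le> 1 - x + x\<^sup>2" using x by (simp add: power2_eq_square algebra_simps)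
  qed
  finally have "1 \<le> (1 - x + x\<^sup>2) * exp x" using x zero_le_power[OF x, of 3] by linarith
  then show "exp (- x) \<le> 1 - x + x\<^sup>2" by (simp add: exp_minus field_simps)
qed

text \<open>For a natural number \<open>n\<close>, the indicator of \<open>n > 1\<close> is at most
  \<open>n - 1\<close> plus the indicator of \<open>n = 0\<close>.\<close>

lemma (in prob_space) multiple_point_probability_le:
  fixes f :: "'a \<Rightarrow> real"
  assumes f: "integrable M f" "\<And>x. f x \<in> \<nat>"
  shows "prob {x\<in>space M. f x > 1} \<le> (\<integral>x. f x \<partial>M) - 1 + prob {x\<in>space M. f x = 0}"
proof -
  have [measurable]: "f \<in> borel_measurable M" using f(1) by simp
  have A: "{x\<in>space M. f x > 1} \<in> events" and B: "{x\<in>space M. f x = 0} \<in> events" by measurable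
  have int: "integrable M (\<lambda>x. indicator {x\<in>space M. f x > 1} x :: real)" "integrable M (\<lambda>x. indicator {x\<in>space M. f x = 0} x :: real)"
    using A B by (auto intro!: integrable_real_indicator simp: emeasure_eq_measure)
  have "prob {x\<in>space M. f x > 1} = (\<integral>x. indicator {x\<in>space M. f x > 1} x \<partial>M)" using A by simp
  also have "\<dots> \<le> (\<integral>x. f x - 1 + indicator {x\<in>space M. f x = 0} x \<partial>M)"
  proof (rule integral_mono)
    show "integrable M (\<lambda>x. f x - 1 + indicator {x\<in>space M. f x = 0} x)" using f(1) int by simp
    fix x assume x: "x \<in> space M"
    obtain n where n: "f x = real n" using f(2)[of x] by (auto elim: Nats_cases)
    show "indicator {x\<in>space M. f x > 1} x \<le> f x - 1 + indicator {x\<in>space M. f x = 0} x"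
      using x by (cases n rule: nat.exhaust) (auto simp: n indicator_def)
  qed (rule int)
  also have "\<dots> = (\<integral>x. f x \<partial>M) - 1 + prob {x\<in>space M. f x = 0}"
    using f(1) int B by (simp add: prob_space)
  finally show ?thesis .
qed

text \<open>There are \<open>2 * n * m\<close> cells, each contributing order
  \<open>1 / m ^ 2\<close>, so the sum vanishes for fine lattices.\<close>

lemma window_multi_bound:
  "(\<Sum>p\<in>window n m. (r / real m)\<^sup>2) \<le> 2 * real n * r\<^sup>2 / real m"
  by (cases "m = 0") (simp_all add: window_def power2_eq_square)

text \<open>A variant of Kallenberg's criterion. The void probabilities of the unions of lattice cells
  determine the joint law of the occupied cells, and the intensities exclude cells with several
  points.\<close>

lemma converges_in_law_if_void_probabilities:
  fixes X :: "'i \<Rightarrow> 'w \<Rightarrow> real conf" and Y :: "'v \<Rightarrow> real conf" and r :: real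
  assumes M: "prob_space M" and N: "prob_space N" and r: "0 \<le> r"
    and X: "eventually (\<lambda>i. X i \<in> M \<rightarrow>\<^sub>M borel) F" and Y: "Y \<in> N \<rightarrow>\<^sub>M borel"
    and Xint: "eventually (\<lambda>i. \<forall>B. precompact_borel B \<longrightarrow> integrable M (\<lambda>\<omega>. num_points (X i \<omega>) B)) F"
    and Ymeas: "\<And>B. precompact_borel B \<Longrightarrow> (\<lambda>\<omega>. num_points (Y \<omega>) B) \<in> borel_measurable N"
    and Xmean: "eventually (\<lambda>i. \<forall>j. (\<integral>\<omega>. num_points (X i \<omega>) {real_of_int j..<real_of_int j + 1} \<partial>M) \<le> b j) F"
    and Xcell: "\<And>m p. 0 < m \<Longrightarrow> ((\<lambda>i. \<integral>\<omega>. num_points (X i \<omega>) (cell m p) \<partial>M) \<longlongrightarrow> r / real m) F"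
    and Xvoid: "\<And>m T. 0 < m \<Longrightarrow> finite T \<Longrightarrow> ((\<lambda>i. measure M {\<omega>\<in>space M. num_points (X i \<omega>) (\<Union>p\<in>T. cell m p) = 0})
      \<longlongrightarrow> exp (- (r * real (card T) / real m))) F"
    and Yvoid: "\<And>m T. 0 < m \<Longrightarrow> finite T \<Longrightarrow> measure N {\<omega>\<in>space N. num_points (Y \<omega>) (\<Union>p\<in>T. cell m p) = 0}
      = exp (- (r * real (card T) / real m))"
    and Ymulti: "\<And>m p. 0 < m \<Longrightarrow> measure N {\<omega>\<in>space N. num_points (Y \<omega>) (cell m p) > 1} \<le> (r / real m)\<^sup>2"
  shows "converges_in_law (\<lambda>_. M) X N Y F"
  unfolding converges_in_law_def
proof (intro conjI allI impI)
  interpret M: prob_space M by fact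
  interpret N: prob_space N by fact
  show "eventually (\<lambda>i. prob_space M \<and> X i \<in> M \<rightarrow>\<^sub>M borel) F" using X M by simp
  show "prob_space N" "Y \<in> N \<rightarrow>\<^sub>M borel" by fact+
  fix h :: "real conf \<Rightarrow> real"
  assume "continuous_on UNIV h \<and> bounded (range h)"
  then have h: "continuous_on UNIV h" "bounded (range h)" by auto
  then obtain H where H: "\<And>\<xi>. \<bar>h \<xi>\<bar> \<le> H" by (auto simp: bounded_iff)
  have H0: "0 \<le> H" using order_trans[OF abs_ge_zero H] .
  have hm: "h \<in> borel_measurable borel" using h(1) by (rule borel_measurable_continuous_onI)
  show "((\<lambda>i. \<integral>\<omega>. h (X i \<omega>) \<partial>M) \<longlongrightarrow> (\<integral>\<omega>. h (Y \<omega>) \<partial>N)) F"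
  proof (rule tendstoI)
    fix \<delta> :: real assume "\<delta> > 0"
    \<comment> \<open>Two replacement errors of \<open>e + 4 * H * e\<close> and one error
      \<open>e\<close> between the lattice expectations stay within
      \<open>e * (4 + 8 * H)\<close>.\<close>
    define e where "e = \<delta> / (4 + 8 * H)"
    have e: "0 < e" using \<open>\<delta> > 0\<close> H0 by (simp add: e_def)
    \<comment> \<open>One bound has to serve all processes, since \<open>n\<close> and
      \<open>m0\<close> below depend on it: the tails of \<open>Y\<close> directly, those of
      \<open>X i\<close> through the means \<open>b\<close>.\<close>
    have "\<exists>c :: nat. N.prob {\<omega>\<in>space N. num_points (Y \<omega>) {real_of_int (int_decode k)..<real_of_int (int_decode k) + 1} > real c} \<le> e * (1 / 2) ^ Suc k
        \<and> b (int_decode k) \<le> real c * (e * (1 / 2) ^ Suc k) \<and> 0 < c" for k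
    proof -
      let ?d = "e * (1 / 2) ^ Suc k"
      have d: "0 < ?d" using e by simp
      have "(\<lambda>\<omega>. num_points (Y \<omega>) {real_of_int (int_decode k)..<real_of_int (int_decode k) + 1}) \<in> borel_measurable N"
        by (rule Ymeas) (simp add: precompact_borel_bounded)
      from N.tail_probability_small[OF this d] obtain c0 :: nat
        where c0: "\<And>c. c \<ge> c0 \<Longrightarrow> N.prob {\<omega>\<in>space N. num_points (Y \<omega>) {real_of_int (int_decode k)..<real_of_int (int_decode k) + 1} > real c} \<le> ?d"
        by blast
      obtain c1 :: nat where c1: "b (int_decode k) / ?d \<le> real c1" using real_arch_simple by blast
      define c where "c = Suc (max c0 c1)"
      have "b (int_decode k) / ?d \<le> real c" using c1 by (simp add: c_def)
      then have "b (int_decode k) \<le> real c * ?d" using d by (simp only: pos_divide_le_eq)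
      moreover have "c0 \<le> c" "0 < c" by (auto simp: c_def)
      ultimately show ?thesis using c0[of c] by blast
    qed
    then have "\<exists>c'. \<forall>k. N.prob {\<omega>\<in>space N. num_points (Y \<omega>) {real_of_int (int_decode k)..<real_of_int (int_decode k) + 1} > real (c' k)} \<le> e * (1 / 2) ^ Suc k
        \<and> b (int_decode k) \<le> real (c' k) * (e * (1 / 2) ^ Suc k) \<and> 0 < c' k"
      by (intro choice allI)
    then obtain c' where c'_all: "\<forall>k. N.prob {\<omega>\<in>space N. num_points (Y \<omega>) {real_of_int (int_decode k)..<real_of_int (int_decode k) + 1} > real (c' k)} \<le> e * (1 / 2) ^ Suc k
        \<and> b (int_decode k) \<le> real (c' k) * (e * (1 / 2) ^ Suc k) \<and> 0 < c' k"
      by (elim exE)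
    have c': "N.prob {\<omega>\<in>space N. num_points (Y \<omega>) {real_of_int (int_decode k)..<real_of_int (int_decode k) + 1} > real (c' k)} \<le> e * (1 / 2) ^ Suc k"
        "b (int_decode k) \<le> real (c' k) * (e * (1 / 2) ^ Suc k)" "0 < c' k" for k
      using spec[OF c'_all, of k] by blast+
    define c where "c j = c' (int_encode j)" for j
    have c_dec: "c (int_decode k) = c' k" for k by (simp add: c_def)
    obtain n m0 where nm: "0 < m0" "\<And>m \<xi>. m0 \<le> m \<Longrightarrow>
      (\<forall>j. num_points \<xi> {real_of_int j..<real_of_int j + 1} \<le> real (c j)) \<Longrightarrow>
      (\<forall>p\<in>window n m. num_points \<xi> (cell m p) \<le> 1) \<Longrightarrow>
      \<bar>h (lattice_conf m (occupied n m \<xi>)) - h \<xi>\<bar> < e"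
      using lattice_approximation[OF h(1) e, of c] by metis
    \<comment> \<open>As \<open>n\<close> is fixed by now, refining the lattice brings the bound for
      cells with several points below \<open>e\<close>.\<close>
    obtain m1 :: nat where m1: "2 * real n * r\<^sup>2 / e < real m1" using reals_Archimedean2 by blast
    define m where "m = max m0 m1"
    have m: "0 < m" "m0 \<le> m" using nm(1) by (auto simp: m_def)
    have multi: "(\<Sum>p\<in>window n m. (r / real m)\<^sup>2) < e"
    proof -
      have "2 * real n * r\<^sup>2 / e < real m" using m1 by (simp add: m_def)
      then have "2 * real n * r\<^sup>2 < real m * e" using e by (simp only: pos_divide_less_eq)
      then have "2 * real n * r\<^sup>2 / real m < e" using m(1) by (simp add: pos_divide_less_eq mult.commute)
      then show ?thesis using window_multi_bound[of r m n] by linarith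
    qed
    note approx = nm(2)[OF m(2)]
    have Yclose: "\<bar>(\<integral>\<omega>. h (lattice_conf m (occupied n m (Y \<omega>))) \<partial>N) - (\<integral>\<omega>. h (Y \<omega>) \<partial>N)\<bar> \<le> e + 2 * H * (2 * e)"
    proof (rule N.lattice_expectation_close[OF m(1) measurable_compose[OF Y hm] H Ymeas approx])
      show "N.prob {\<omega>\<in>space N. num_points (Y \<omega>) {real_of_int (int_decode k)..<real_of_int (int_decode k) + 1} > real (c (int_decode k))} \<le> e * (1 / 2) ^ Suc k" for k
        unfolding c_dec by (rule c'(1))
      have "(\<Sum>p\<in>window n m. N.prob {\<omega>\<in>space N. num_points (Y \<omega>) (cell m p) > 1}) \<le> (\<Sum>p\<in>window n m. (r / real m)\<^sup>2)"
        by (intro sum_mono Ymulti m)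
      then show "(\<Sum>p\<in>window n m. N.prob {\<omega>\<in>space N. num_points (Y \<omega>) (cell m p) > 1}) \<le> e"
        using multi by linarith
    qed (use e in auto)
    obtain a where a: "\<And>\<xi>. h (lattice_conf m (occupied n m \<xi>)) =
      (\<Sum>T\<in>Pow (window n m). a T * of_bool (num_points \<xi> (\<Union>p\<in>T. cell m p) = 0))"
      using lattice_conf_expansion[OF m(1), of h n] by metis
    have "((\<lambda>i. \<Sum>T\<in>Pow (window n m). a T * M.prob {\<omega>\<in>space M. num_points (X i \<omega>) (\<Union>p\<in>T. cell m p) = 0})
      \<longlongrightarrow> (\<Sum>T\<in>Pow (window n m). a T * exp (- (r * real (card T) / real m)))) F"
      using finite_subset[OF _ finite_window] by (intro tendsto_intros Xvoid m(1)) auto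
    also have "(\<Sum>T\<in>Pow (window n m). a T * exp (- (r * real (card T) / real m)))
      = (\<Sum>T\<in>Pow (window n m). a T * N.prob {\<omega>\<in>space N. num_points (Y \<omega>) (\<Union>p\<in>T. cell m p) = 0})"
      using finite_subset[OF _ finite_window] by (intro sum.cong refl, subst Yvoid[OF m(1)]) auto
    also have "\<dots> = (\<integral>\<omega>. h (lattice_conf m (occupied n m (Y \<omega>))) \<partial>N)"
      using N.lattice_expectation[OF a Ymeas] by simp
    finally have lat: "eventually (\<lambda>i. dist (\<Sum>T\<in>Pow (window n m). a T * M.prob {\<omega>\<in>space M. num_points (X i \<omega>) (\<Union>p\<in>T. cell m p) = 0})
      (\<integral>\<omega>. h (lattice_conf m (occupied n m (Y \<omega>))) \<partial>N) < e) F"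
      using e by (rule tendstoD)
    \<comment> \<open>The summands bound the probabilities of several points in a cell, and the
      limit is strictly below \<open>e\<close>. The union over \<open>{p}\<close> gives the void
      event the form of \<open>Xvoid\<close>.\<close>
    have "((\<lambda>i. \<Sum>p\<in>window n m. (\<integral>\<omega>. num_points (X i \<omega>) (cell m p) \<partial>M) - 1
        + M.prob {\<omega>\<in>space M. num_points (X i \<omega>) (\<Union>p\<in>{p}. cell m p) = 0})
      \<longlongrightarrow> (\<Sum>p\<in>window n m. r / real m - 1 + exp (- (r * real (card {p}) / real m)))) F"
      by (intro tendsto_intros Xcell Xvoid m(1)) auto
    moreover have "(\<Sum>p\<in>window n m. r / real m - 1 + exp (- (r * real (card {p}) / real m))) < e"
    proof -
      have "(\<Sum>p\<in>window n m. r / real m - 1 + exp (- (r * real (card {p}) / real m))) \<le> (\<Sum>p\<in>window n m. (r / real m)\<^sup>2)"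
        using exp_minus_le[of "r / real m"] r by (intro sum_mono) simp
      then show ?thesis using multi by linarith
    qed
    ultimately have Xmulti: "eventually (\<lambda>i. (\<Sum>p\<in>window n m. (\<integral>\<omega>. num_points (X i \<omega>) (cell m p) \<partial>M) - 1
        + M.prob {\<omega>\<in>space M. num_points (X i \<omega>) (\<Union>p\<in>{p}. cell m p) = 0}) < e) F"
      by (rule order_tendstoD)
    show "eventually (\<lambda>i. dist (\<integral>\<omega>. h (X i \<omega>) \<partial>M) (\<integral>\<omega>. h (Y \<omega>) \<partial>N) < \<delta>) F"
      using X Xint Xmean lat Xmulti
    proof eventually_elim
      fix i
      assume Xi: "X i \<in> M \<rightarrow>\<^sub>M borel" and int: "\<forall>B. precompact_borel B \<longrightarrow> integrable M (\<lambda>\<omega>. num_points (X i \<omega>) B)"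
        and mean: "\<forall>j. (\<integral>\<omega>. num_points (X i \<omega>) {real_of_int j..<real_of_int j + 1} \<partial>M) \<le> b j"
        and lat: "dist (\<Sum>T\<in>Pow (window n m). a T * M.prob {\<omega>\<in>space M. num_points (X i \<omega>) (\<Union>p\<in>T. cell m p) = 0})
          (\<integral>\<omega>. h (lattice_conf m (occupied n m (Y \<omega>))) \<partial>N) < e"
        and mult: "(\<Sum>p\<in>window n m. (\<integral>\<omega>. num_points (X i \<omega>) (cell m p) \<partial>M) - 1
          + M.prob {\<omega>\<in>space M. num_points (X i \<omega>) (\<Union>p\<in>{p}. cell m p) = 0}) < e"
      have meas: "(\<lambda>\<omega>. num_points (X i \<omega>) B) \<in> borel_measurable M" if "precompact_borel B" for B
        using int that by (blast intro: borel_measurable_integrable)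
      have Xclose: "\<bar>(\<integral>\<omega>. h (lattice_conf m (occupied n m (X i \<omega>))) \<partial>M) - (\<integral>\<omega>. h (X i \<omega>) \<partial>M)\<bar> \<le> e + 2 * H * (2 * e)"
      proof (rule M.lattice_expectation_close[OF m(1) measurable_compose[OF Xi hm] H meas approx])
        fix k
        let ?I = "{real_of_int (int_decode k)..<real_of_int (int_decode k) + 1}"
        have I: "integrable M (\<lambda>\<omega>. num_points (X i \<omega>) ?I)"
          using int by (simp add: precompact_borel_bounded)
        have [measurable]: "(\<lambda>\<omega>. num_points (X i \<omega>) ?I) \<in> borel_measurable M"
          using I by (rule borel_measurable_integrable)
        \<comment> \<open>Markov's inequality; positivity of \<open>c' k\<close> makes the quotient
          meaningful, and \<open>c'\<close> was chosen to bring it below the geometric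
          weight.\<close>
        have "M.prob {\<omega>\<in>space M. num_points (X i \<omega>) ?I > real (c' k)} \<le> M.prob {\<omega>\<in>space M. num_points (X i \<omega>) ?I \<ge> real (c' k)}"
          by (intro M.finite_measure_mono) auto
        also have "\<dots> \<le> (\<integral>\<omega>. num_points (X i \<omega>) ?I \<partial>M) / real (c' k)"
          using c'(3)[of k] by (intro integral_Markov_inequality_measure[OF I, where A="{}"]) (auto simp: num_points_def)
        also have "\<dots> \<le> b (int_decode k) / real (c' k)"
          using mean by (intro divide_right_mono) auto
        also have "\<dots> \<le> e * (1 / 2) ^ Suc k"
          using c'(2)[of k] c'(3)[of k] by (simp only: pos_divide_le_eq of_nat_0_less_iff mult.commute)
        finally show "M.prob {\<omega>\<in>space M. num_points (X i \<omega>) ?I > real (c (int_decode k))} \<le> e * (1 / 2) ^ Suc k"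
          unfolding c_dec .
      next
        have "(\<Sum>p\<in>window n m. M.prob {\<omega>\<in>space M. num_points (X i \<omega>) (cell m p) > 1})
          \<le> (\<Sum>p\<in>window n m. (\<integral>\<omega>. num_points (X i \<omega>) (cell m p) \<partial>M) - 1
          + M.prob {\<omega>\<in>space M. num_points (X i \<omega>) (\<Union>p\<in>{p}. cell m p) = 0})"
        proof (rule sum_mono)
          fix p
          have "num_points (X i \<omega>) (cell m p) \<in> \<nat>" for \<omega>
            by (rule num_points_nat[OF precompact_cell[of m p], of "X i \<omega>"]) simp
          then show "M.prob {\<omega>\<in>space M. num_points (X i \<omega>) (cell m p) > 1} \<le> (\<integral>\<omega>. num_points (X i \<omega>) (cell m p) \<partial>M) - 1
            + M.prob {\<omega>\<in>space M. num_points (X i \<omega>) (\<Union>p\<in>{p}. cell m p) = 0}"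
            using M.multiple_point_probability_le[of "\<lambda>\<omega>. num_points (X i \<omega>) (cell m p)"] int precompact_cell by simp
        qed
        then show "(\<Sum>p\<in>window n m. M.prob {\<omega>\<in>space M. num_points (X i \<omega>) (cell m p) > 1}) \<le> e"
          using mult by linarith
      qed (use e in auto)
      have "\<bar>(\<integral>\<omega>. h (lattice_conf m (occupied n m (X i \<omega>))) \<partial>M) - (\<integral>\<omega>. h (lattice_conf m (occupied n m (Y \<omega>))) \<partial>N)\<bar> < e"
        using lat unfolding dist_real_def by (subst M.lattice_expectation[OF a meas])
      moreover have "\<bar>x - y\<bar> < 2 * w + e" if "\<bar>u - v\<bar> < e" "\<bar>u - x\<bar> \<le> w" "\<bar>v - y\<bar> \<le> w" for x y u v w :: real
        using that by linarith
      ultimately have "\<bar>(\<integral>\<omega>. h (X i \<omega>) \<partial>M) - (\<integral>\<omega>. h (Y \<omega>) \<partial>N)\<bar> < 2 * (e + 2 * H * (2 * e)) + e"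
        using Xclose Yclose by metis
      also have "\<dots> \<le> e * (4 + 8 * H)" using e by (simp add: algebra_simps)
      also have "\<dots> = \<delta>" using H0 by (simp add: e_def)
      finally show "dist (\<integral>\<omega>. h (X i \<omega>) \<partial>M) (\<integral>\<omega>. h (Y \<omega>) \<partial>N) < \<delta>" by (simp add: dist_real_def)
    qed
  qed
qed

section \<open>The radial image of the Ginibre ensemble\<close>

lemma continuous_on_integral_conf:
  fixes f :: "'a::locally_compact_polish_space \<Rightarrow> real"
  assumes "continuous_on UNIV f" "compact (closure {x. f x \<noteq> 0})"
  shows "continuous_on UNIV (\<lambda>\<xi>. \<integral>x. f x \<partial>conf_measure \<xi>)"
  unfolding continuous_on_open_vimage[OF open_UNIV]
proof (intro allI impI)
  fix U :: "real set" assume "open U"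
  then have "open {\<xi>. (\<integral>x. f x \<partial>conf_measure \<xi>) \<in> U}"
    unfolding open_conf_def using assms by (intro generate_topology.Basis) blast
  then show "open ((\<lambda>\<xi>. \<integral>x. f x \<partial>conf_measure \<xi>) -` U \<inter> UNIV)"
    by (simp add: vimage_def)
qed

text \<open>Properness keeps the image family locally finite, which is where
  \<open>push_conf\<close> is specified.\<close>

lemma conf_measure_push_conf:
  fixes T :: "'a::locally_compact_polish_space \<Rightarrow> 'b::locally_compact_polish_space"
  assumes [measurable]: "T \<in> borel_measurable borel"
    and proper: "\<And>B. precompact_borel B \<Longrightarrow> precompact_borel (T -` B)"
  shows "conf_measure (push_conf T \<xi>) = distr (conf_measure \<xi>) borel T"
proof -
  obtain I :: "nat set" and x where I: "locally_finite_points I x" and \<xi>: "\<xi> = points_conf I x"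
    by (rule conf_exhaust)
  have "locally_finite_points I (T \<circ> x)"
    unfolding locally_finite_points_def
  proof (intro allI impI)
    fix B :: "'b set" assume "precompact_borel B"
    then have "finite {i\<in>I. x i \<in> T -` B}"
      using I proper unfolding locally_finite_points_def by blast
    then show "finite {i\<in>I. (T \<circ> x) i \<in> B}" by simp
  qed
  then show ?thesis
    unfolding \<xi> push_points_conf[OF I assms(1)] conf_measure_points_conf[OF I]
    by (simp add: conf_measure_points_conf distr_distr)
qed

lemma num_points_push_conf:
  fixes T :: "'a::locally_compact_polish_space \<Rightarrow> 'b::locally_compact_polish_space"
  assumes [measurable]: "T \<in> borel_measurable borel"
    and proper: "\<And>B. precompact_borel B \<Longrightarrow> precompact_borel (T -` B)" and "B \<in> sets borel"
  shows "num_points (push_conf T \<xi>) B = num_points \<xi> (T -` B)"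
proof -
  have eq: "conf_measure (push_conf T \<xi>) = distr (conf_measure \<xi>) borel T"
    by (rule conf_measure_push_conf[OF assms(1)]) (rule proper)
  have "space (conf_measure \<xi>) = UNIV" using sets_eq_imp_space_eq[OF sets_conf_measure[of \<xi>]] by simp
  then show ?thesis
    using assms(3) by (simp add: num_points_def eq measure_distr)
qed

text \<open>Testing the image against \<open>f\<close> is testing the original against
  \<open>f\<close> after \<open>T\<close>, and properness keeps the support compact. Measurability
  of the radial image process follows.\<close>

lemma continuous_on_push_conf:
  fixes T :: "'a::locally_compact_polish_space \<Rightarrow> 'b::locally_compact_polish_space"
  assumes T: "continuous_on UNIV T"
    and proper: "\<And>B. precompact_borel B \<Longrightarrow> precompact_borel (T -` B)"
  shows "continuous_on UNIV (push_conf T)"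
proof (rule continuous_on_confI)
  fix f :: "'b \<Rightarrow> real" assume f: "continuous_on UNIV f" "compact (closure {x. f x \<noteq> 0})"
  have Tm[measurable]: "T \<in> borel_measurable borel" using T by (rule borel_measurable_continuous_onI)
  have fm[measurable]: "f \<in> borel_measurable borel" using f(1) by (rule borel_measurable_continuous_onI)
  have "conf_measure (push_conf T \<xi>) = distr (conf_measure \<xi>) borel T" for \<xi>
    by (rule conf_measure_push_conf[OF Tm]) (rule proper)
  then have eq: "(\<integral>x. f x \<partial>conf_measure (push_conf T \<xi>)) = (\<integral>x. f (T x) \<partial>conf_measure \<xi>)" for \<xi>
    by (simp add: integral_distr)
  have "continuous_on UNIV (\<lambda>\<xi>. \<integral>x. f (T x) \<partial>conf_measure \<xi>)"
  proof (rule continuous_on_integral_conf)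
    show "continuous_on UNIV (\<lambda>x. f (T x))" by (rule continuous_on_compose2[OF f(1) T]) auto
    have "precompact_borel {x. f x \<noteq> 0}"
      using f(2) by (simp add: precompact_borel_def)
    then have "precompact_borel (T -` {x. f x \<noteq> 0})" by (rule proper)
    then show "compact (closure {x. f (T x) \<noteq> 0})"
      by (simp add: precompact_borel_def)
  qed
  then show "continuous_on UNIV (\<lambda>\<xi>. \<integral>x. f x \<partial>conf_measure (push_conf T \<xi>))" unfolding eq .
qed

section \<open>The radial map and the areas of annuli\<close>

definition radial :: "real \<Rightarrow> complex \<Rightarrow> real" where
  "radial R z = R * (cmod z - R)"

lemma continuous_on_radial: "continuous_on UNIV (radial R)"
  unfolding radial_def[abs_def] by (intro continuous_intros)

lemma radial_measurable [measurable]: "radial R \<in> borel_measurable borel"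
  by (rule borel_measurable_continuous_onI[OF continuous_on_radial])

lemma cmod_of_radial:
  assumes "0 < R" "a \<le> radial R z" "radial R z \<le> b"
  shows "R + a / R \<le> cmod z" "cmod z \<le> R + b / R"
proof -
  have "a / R \<le> cmod z - R" "cmod z - R \<le> b / R"
    using assms by (simp_all add: radial_def pos_divide_le_eq pos_le_divide_eq mult.commute)
  then show "R + a / R \<le> cmod z" "cmod z \<le> R + b / R" by linarith+
qed

lemma precompact_radial_vimage:
  assumes "0 < R" and B: "precompact_borel B"
  shows "precompact_borel (radial R -` B)"
proof -
  obtain A where A: "\<And>x. x \<in> B \<Longrightarrow> \<bar>x\<bar> \<le> A"
    using B by (auto simp: precompact_borel_bounded bounded_iff)
  have "radial R -` B \<in> sets borel"
    using measurable_sets[OF radial_measurable, of B R] B by (simp add: precompact_borel_def)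
  moreover have "bounded (radial R -` B)"
    unfolding bounded_iff
  proof (intro exI ballI)
    fix z assume "z \<in> radial R -` B"
    then have "\<bar>radial R z\<bar> \<le> A" using A by simp
    then show "cmod z \<le> R + A / R" by (intro cmod_of_radial(2)[OF assms(1) order_refl]) auto
  qed
  ultimately show ?thesis by (simp add: precompact_borel_bounded)
qed

lemma measure_ball_complex: "measure lborel (ball (0 :: complex) r) = pi * (max 0 r)\<^sup>2"
proof (cases "0 \<le> r")
  case True
  then show ?thesis using content_ball[OF True, of "0 :: complex"] by (simp add: unit_ball_vol_2)
qed simp

text \<open>The preimage of a half-open interval is a difference of open balls. The truncation at 0
  accounts for negative radii, where the ball is empty.\<close>

lemma measure_radial_interval:
  assumes R: "0 < R" and ab: "a \<le> b"
  shows "measure lborel (radial R -` {a..<b}) = pi * ((max 0 (R + b / R))\<^sup>2 - (max 0 (R + a / R))\<^sup>2)"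
proof -
  have eq: "radial R -` {a..<b} = ball 0 (R + b / R) - ball 0 (R + a / R)"
    using R by (auto simp: radial_def field_simps)
  have "R + a / R \<le> R + b / R" using R ab by (simp add: divide_right_mono)
  then have sub: "ball (0 :: complex) (R + a / R) \<subseteq> ball 0 (R + b / R)" by (rule subset_ball)
  show ?thesis
    unfolding eq using sub emeasure_bounded_finite[of "ball (0 :: complex) (R + b / R)"]
    by (subst measure_Diff) (auto simp: measure_ball_complex right_diff_distrib)
qed

text \<open>The bound is uniform in \<open>R\<close> and linear in the position; it keeps the mean
  number of image points in each block bounded.\<close>

lemma measure_radial_interval_le:
  assumes R: "1 \<le> R"
  shows "measure lborel (radial R -` {x..<x + 1}) \<le> pi * (3 + 2 * \<bar>x\<bar>)"
proof -
  define u where "u = R + x / R"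
  have eq: "R + (x + 1) / R = u + 1 / R" by (simp add: u_def add_divide_distrib)
  have R1: "0 < 1 / R" "1 / R \<le> 1" using R by auto
  have "(max 0 (u + 1 / R))\<^sup>2 - (max 0 u)\<^sup>2 \<le> 3 + 2 * \<bar>x\<bar>"
  proof (cases "0 \<le> u")
    case True
    have "(u + 1 / R)\<^sup>2 - u\<^sup>2 = 2 + 2 * (x / R / R) + (1 / R)\<^sup>2"
      using R by (simp add: u_def power2_eq_square field_simps)
    moreover have "(1 / R)\<^sup>2 \<le> 1" using R1 by (intro power_le_one) auto
    moreover have "x / R / R \<le> \<bar>x\<bar>"
    proof -
      have "x / R / R \<le> \<bar>x / R / R\<bar>" by (rule abs_ge_self)
      also have "\<dots> = \<bar>x\<bar> * ((1 / R) * (1 / R))" using R by (simp add: abs_divide abs_mult)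
      also have "\<dots> \<le> \<bar>x\<bar>" using R1 by (intro mult_left_le mult_le_one) auto
      finally show ?thesis .
    qed
    ultimately show ?thesis using True R1 by (simp add: max_def)
  next
    case False
    \<comment> \<open>The inner ball is empty, and the outer radius is at most
      \<open>1 / R\<close>.\<close>
    then have "max 0 (u + 1 / R) \<le> 1" using R1(2) by (simp only: max_def split: if_split) linarith
    then have "(max 0 (u + 1 / R))\<^sup>2 \<le> 1" by (intro power_le_one) auto
    then show ?thesis using False by (simp add: max_def)
  qed
  then have "pi * ((max 0 (u + 1 / R))\<^sup>2 - (max 0 u)\<^sup>2) \<le> pi * (3 + 2 * \<bar>x\<bar>)"
    by (rule mult_left_mono) simp
  then show ?thesis using R by (subst measure_radial_interval) (auto simp: eq u_def[symmetric])
qed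

text \<open>Once both radii are nonnegative, the difference of their squares is
  \<open>2 * (b - a)\<close> plus a term of order \<open>1 / R ^ 2\<close>. Division by
  \<open>pi\<close> gives the intensity 2.\<close>

lemma tendsto_measure_radial_interval:
  assumes "a \<le> b"
  shows "((\<lambda>R. measure lborel (radial R -` {a..<b})) \<longlongrightarrow> 2 * pi * (b - a)) at_top"
proof (rule Lim_transform_eventually)
  show "((\<lambda>R. pi * ((R + b / R)\<^sup>2 - (R + a / R)\<^sup>2)) \<longlongrightarrow> 2 * pi * (b - a)) at_top"
    by (real_asymp simp: algebra_simps)
  have "filterlim (\<lambda>R. R + b / R) at_top at_top" "filterlim (\<lambda>R. R + a / R) at_top at_top"
    by real_asymp+
  then have "eventually (\<lambda>R. 0 \<le> R + b / R) at_top" "eventually (\<lambda>R. 0 \<le> R + a / R) at_top"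
    by (auto simp: filterlim_at_top)
  then show "eventually (\<lambda>R. pi * ((R + b / R)\<^sup>2 - (R + a / R)\<^sup>2) = measure lborel (radial R -` {a..<b})) at_top"
    using eventually_gt_at_top[of 0]
    by eventually_elim (use assms in \<open>simp add: measure_radial_interval max_def\<close>)
qed

text \<open>For \<open>k = 1\<close> there are no pairs, so the error in
  \<open>ginibre_product_moment\<close> is 0.\<close>

lemma ginibre_mean:
  assumes G: "ginibre_ensemble M G" and D: "precompact_borel D"
  shows "integrable M (\<lambda>\<omega>. num_points (G \<omega>) D)"
    and "(\<integral>\<omega>. num_points (G \<omega>) D \<partial>M) = measure lborel D / pi"
proof -
  have disj: "disjoint_family_on (\<lambda>_. D) {..<1::nat}" by (simp add: disjoint_family_on_def)
  show "integrable M (\<lambda>\<omega>. num_points (G \<omega>) D)"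
    using ginibre_product_moment(1)[OF G order_refl D disj] by simp
  have "gauss_pairs 1 x = 0" for x by (simp add: gauss_pairs_def)
  then have "ennreal \<bar>(\<integral>\<omega>. num_points (G \<omega>) D \<partial>M) - measure lborel D / pi\<bar> \<le> 0"
    using ginibre_product_moment(2)[OF G order_refl D disj] by simp
  then show "(\<integral>\<omega>. num_points (G \<omega>) D \<partial>M) = measure lborel D / pi"
    by (simp add: ennreal_eq_0_iff)
qed

text \<open>The Gaussian weight is at most 1, so the area of \<open>D\<close> serves as
  \<open>s\<close>. This crude value gives finiteness; the limit uses the decaying bound for
  annuli.\<close>

lemma ginibre_ffact_integrable:
  assumes G: "ginibre_ensemble M G" and D: "precompact_borel D"
  shows "integrable M (\<lambda>\<omega>. ffact (num_points (G \<omega>) D) k)"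
proof (rule ginibre_factorial_moment(1)[OF G D])
  show "0 \<le> measure lborel D" by simp
  fix z
  have D': "D \<in> sets lborel" "emeasure lborel D < \<infinity>"
    using D emeasure_bounded_finite[of D] by (auto simp: precompact_borel_bounded)
  have "(\<integral>\<^sup>+w. ennreal (exp (- (cmod (z - w))\<^sup>2 / 2)) * indicator D w \<partial>lborel) \<le> (\<integral>\<^sup>+w. indicator D w \<partial>lborel)"
    by (intro nn_integral_mono) (auto simp: indicator_def)
  also have "\<dots> = emeasure lborel D" using D' by simp
  also have "\<dots> = ennreal (measure lborel D)" using D' by (simp add: emeasure_eq_ennreal_measure less_top)
  finally show "(\<integral>\<^sup>+w. ennreal (exp (- (cmod (z - w))\<^sup>2 / 2)) * indicator D w \<partial>lborel) \<le> ennreal (measure lborel D)" .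
qed

text \<open>The preimage of \<open>U\<close> lies in an annulus of bounded area with Gaussian bound
  \<open>s R\<close> of order \<open>1 / R\<close>. The errors vanish, and the factorial moments
  tend to \<open>l ^ k\<close>, those of a Poisson variable.\<close>

lemma ginibre_radial_void_probability:
  assumes G: "ginibre_ensemble M G" and U: "precompact_borel U"
    and lim: "((\<lambda>R. measure lborel (radial R -` U)) \<longlongrightarrow> pi * l) at_top"
  shows "((\<lambda>R. measure M {\<omega>\<in>space M. num_points (G \<omega>) (radial R -` U) = 0}) \<longlongrightarrow> exp (- l)) at_top"
proof -
  have M: "prob_space M"
    using G by (simp add: ginibre_ensemble_def determinantal_def simple_point_process_def point_process_def)
  obtain A where A: "0 < A" "\<And>x. x \<in> U \<Longrightarrow> \<bar>x\<bar> \<le> A"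
    using U by (auto simp: precompact_borel_bounded bounded_pos)
  \<comment> \<open>Replacing \<open>R\<close> by \<open>max R 1\<close> makes \<open>D R\<close>
    precompact for every real \<open>R\<close>, as \<open>void_probability_limit\<close> asks for
    measurability and integrability at all indices.\<close>
  define D where "D R = radial (max R 1) -` U" for R
  have D: "precompact_borel (D R)" for R
    unfolding D_def by (rule precompact_radial_vimage[OF _ U]) simp
  have D_eq: "eventually (\<lambda>R. D R = radial R -` U) at_top"
    using eventually_ge_at_top[of 1] by eventually_elim (simp add: D_def max_def)
  have D_lim: "((\<lambda>R. measure lborel (D R)) \<longlongrightarrow> pi * l) at_top"
    by (rule Lim_transform_eventually[OF lim]) (use D_eq in eventually_elim, simp)
  \<comment> \<open>The bound of \<open>nn_integral_gaussian_annulus_le\<close> for radii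
    \<open>R - A / R\<close> and \<open>R + A / R\<close>, whose squares differ by
    \<open>4 * A\<close>.\<close>
  define s where "s R = 4 * sqrt (2 * pi) * ((R + A / R)\<^sup>2 - (R - A / R)\<^sup>2) / sqrt ((R - A / R)\<^sup>2 / 2)" for R
  have s_lim: "(s \<longlongrightarrow> 0) at_top"
    unfolding s_def[abs_def] using A(1) by real_asymp
  have "((\<lambda>R. \<integral>\<omega>. ffact (num_points (G \<omega>) (D R)) k \<partial>M) \<longlongrightarrow> l ^ k) at_top" for k
  proof -
    define E where "E R = fact k / pi ^ k * (real k * real k * measure lborel (D R) ^ (k - 1) * s R)" for R
    have "(E \<longlongrightarrow> fact k / pi ^ k * (real k * real k * (pi * l) ^ (k - 1) * 0)) at_top"
      unfolding E_def[abs_def] by (intro tendsto_intros D_lim s_lim)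
    then have E: "(E \<longlongrightarrow> 0) at_top" by simp
    have "filterlim (\<lambda>R. R - A / R) at_top at_top" using A(1) by real_asymp
    then have "eventually (\<lambda>R. 0 < R - A / R) at_top" unfolding filterlim_at_top_dense by (rule spec)
    then have "eventually (\<lambda>R. norm ((\<integral>\<omega>. ffact (num_points (G \<omega>) (D R)) k \<partial>M) - (measure lborel (D R) / pi) ^ k) \<le> E R) at_top"
      using eventually_ge_at_top[of 1]
    proof eventually_elim
      fix R assume R: "0 < R - A / R" "1 \<le> R"
      have ge: "(R - A / R)\<^sup>2 \<le> (R + A / R)\<^sup>2"
        using R A(1) by (intro power_mono) auto
      have "D R \<subseteq> {w. (R - A / R)\<^sup>2 \<le> (cmod w)\<^sup>2 \<and> (cmod w)\<^sup>2 \<le> (R + A / R)\<^sup>2}"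
      proof
        fix w assume "w \<in> D R"
        then have "\<bar>radial R w\<bar> \<le> A" using A(2) R(2) by (simp add: D_def max_def)
        then have "R + (- A) / R \<le> cmod w" "cmod w \<le> R + A / R"
          using R(2) cmod_of_radial[of R "- A" w A] by auto
        then show "w \<in> {w. (R - A / R)\<^sup>2 \<le> (cmod w)\<^sup>2 \<and> (cmod w)\<^sup>2 \<le> (R + A / R)\<^sup>2}"
          using R(1) by (auto intro!: power_mono)
      qed
      then have "(\<integral>\<^sup>+w. ennreal (exp (- (cmod (z - w))\<^sup>2 / 2)) * indicator (D R) w \<partial>lborel)
        \<le> (\<integral>\<^sup>+w. ennreal (exp (- (cmod (z - w))\<^sup>2 / 2)) * indicator {w. (R - A / R)\<^sup>2 \<le> (cmod w)\<^sup>2 \<and> (cmod w)\<^sup>2 \<le> (R + A / R)\<^sup>2} w \<partial>lborel)" for z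
        by (intro nn_integral_mono mult_left_mono indicator_leI) auto
      also have "\<dots> z \<le> ennreal (s R)" for z
        unfolding s_def using R(1) ge by (intro nn_integral_gaussian_annulus_le) auto
      finally have "(\<integral>\<^sup>+w. ennreal (exp (- (cmod (z - w))\<^sup>2 / 2)) * indicator (D R) w \<partial>lborel) \<le> ennreal (s R)" for z .
      moreover have "0 \<le> s R" using R ge by (simp add: s_def)
      ultimately show "norm ((\<integral>\<omega>. ffact (num_points (G \<omega>) (D R)) k \<partial>M) - (measure lborel (D R) / pi) ^ k) \<le> E R"
        unfolding E_def real_norm_def by (intro ginibre_factorial_moment(2)[OF G D])
    qed
    then have "((\<lambda>R. (\<integral>\<omega>. ffact (num_points (G \<omega>) (D R)) k \<partial>M) - (measure lborel (D R) / pi) ^ k) \<longlongrightarrow> 0) at_top"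
      using E by (rule Lim_null_comparison)
    moreover have "((\<lambda>R. (measure lborel (D R) / pi) ^ k) \<longlongrightarrow> (pi * l / pi) ^ k) at_top"
      by (intro tendsto_intros D_lim) simp
    ultimately have "((\<lambda>R. ((\<integral>\<omega>. ffact (num_points (G \<omega>) (D R)) k \<partial>M) - (measure lborel (D R) / pi) ^ k) + (measure lborel (D R) / pi) ^ k)
      \<longlongrightarrow> 0 + (pi * l / pi) ^ k) at_top"
      by (rule tendsto_add)
    then show ?thesis by simp
  qed
  then have "((\<lambda>R. measure M {\<omega>\<in>space M. num_points (G \<omega>) (D R) = 0}) \<longlongrightarrow> exp (- l)) at_top"
  proof (intro void_probability_limit[OF M])
    show "(\<lambda>\<omega>. num_points (G \<omega>) (D R)) \<in> borel_measurable M" for R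
      by (rule ginibre_num_points_measurable[OF G D])
    show "num_points (G \<omega>) (D R) \<in> \<nat>" for R \<omega>
      by (rule num_points_nat[OF D[of R], of "G \<omega>"]) simp
    show "integrable M (\<lambda>\<omega>. ffact (num_points (G \<omega>) (D R)) k)" for R k
      by (rule ginibre_ffact_integrable[OF G D])
  qed
  then show ?thesis
    by (rule Lim_transform_eventually) (use D_eq in eventually_elim, simp)
qed

lemma vimage_Union_cells: "T -` (\<Union>p\<in>S. cell m p) = (\<Union>p\<in>S. T -` cell m p)"
  by auto

lemma tendsto_measure_radial_Union_cells:
  assumes m: "0 < m" and S: "finite S"
  shows "((\<lambda>R. measure lborel (radial R -` (\<Union>p\<in>S. cell m p))) \<longlongrightarrow> pi * (2 * real (card S) / real m)) at_top"
proof (rule Lim_transform_eventually)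
  have "((\<lambda>R. \<Sum>p\<in>S. measure lborel (radial R -` cell m p)) \<longlongrightarrow> (\<Sum>p\<in>S. 2 * pi * ((real_of_int p + 1) / real m - real_of_int p / real m))) at_top"
    unfolding cell_def by (intro tendsto_sum tendsto_measure_radial_interval divide_right_mono) auto
  also have "(\<Sum>p\<in>S. 2 * pi * ((real_of_int p + 1) / real m - real_of_int p / real m)) = pi * (2 * real (card S) / real m)"
    by (simp add: add_divide_distrib)
  finally show "((\<lambda>R. \<Sum>p\<in>S. measure lborel (radial R -` cell m p)) \<longlongrightarrow> pi * (2 * real (card S) / real m)) at_top" .
  show "eventually (\<lambda>R. (\<Sum>p\<in>S. measure lborel (radial R -` cell m p)) = measure lborel (radial R -` (\<Union>p\<in>S. cell m p))) at_top"
    using eventually_gt_at_top[of 0]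
  proof eventually_elim
    fix R :: real assume R: "0 < R"
    have pre: "precompact_borel (radial R -` cell m p)" for p
      by (rule precompact_radial_vimage[OF R precompact_cell])
    have fm: "radial R -` cell m p \<in> fmeasurable lborel" for p
      using pre[of p] emeasure_bounded_finite[of "radial R -` cell m p"]
      by (auto simp: precompact_borel_bounded fmeasurable_def)
    have "disjoint_family_on (\<lambda>p. radial R -` cell m p) S"
      using m by (auto simp: disjoint_family_on_def cell_iff)
    then have "measure lborel (\<Union>p\<in>S. radial R -` cell m p) = (\<Sum>p\<in>S. measure lborel (radial R -` cell m p))"
      using S fm by (intro measure_UNION') (auto simp: disjoint_family_on_def pairwise_def disjnt_def)
    then show "(\<Sum>p\<in>S. measure lborel (radial R -` cell m p)) = measure lborel (radial R -` (\<Union>p\<in>S. cell m p))"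
      unfolding vimage_Union_cells by (rule sym)
  qed
qed

lemma measure_Union_cells:
  assumes m: "0 < m" and S: "finite S"
  shows "measure lborel (\<Union>p\<in>S. cell m p) = real (card S) / real m"
proof -
  have fm: "cell m p \<in> fmeasurable lborel" for p
    using precompact_cell[of m p] emeasure_bounded_finite[of "cell m p"]
    by (auto simp: precompact_borel_bounded fmeasurable_def)
  have "disjoint_family_on (cell m) S" using m by (auto simp: disjoint_family_on_def cell_iff)
  then have "measure lborel (\<Union>p\<in>S. cell m p) = (\<Sum>p\<in>S. measure lborel (cell m p))"
    using S fm by (intro measure_UNION') (auto simp: disjoint_family_on_def pairwise_def disjnt_def)
  also have "\<dots> = (\<Sum>p\<in>S. 1 / real m)"
    by (intro sum.cong refl) (simp add: cell_def divide_right_mono flip: diff_divide_distrib)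
  finally show ?thesis by simp
qed

lemma measure_density_two: "B \<in> sets borel \<Longrightarrow> measure (density lborel (\<lambda>_. 2)) B = 2 * measure lborel B" for B :: "real set"
  by (simp add: measure_def emeasure_density_const enn2real_mult)

text \<open>The probability is \<open>1 - (1 + l) * exp (- l)\<close>, and
  \<open>exp (- l) \<ge> 1 - l\<close> bounds it by the square of \<open>l\<close>.\<close>

lemma poisson_multiple_points_le:
  assumes P: "poisson_process N P \<Lambda>" and B: "precompact_borel B"
  shows "measure N {\<omega>\<in>space N. num_points (P \<omega>) B > 1} \<le> (measure \<Lambda> B)\<^sup>2"
proof -
  interpret prob_space N using P by (simp add: poisson_process_def point_process_def)
  define l where "l = measure \<Lambda> B"
  have l: "0 \<le> l" by (simp add: l_def)
  have pr: "prob {\<omega>\<in>space N. num_points (P \<omega>) B = real n} = l ^ n / fact n * exp (- l)" for n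
    using P B unfolding poisson_process_def l_def by blast
  \<comment> \<open>Independence of a family with one member carries the measurability of the
    count.\<close>
  have "indep_vars (\<lambda>_. borel) (\<lambda>i \<omega>. num_points (P \<omega>) ((\<lambda>_. B) i)) {..<1::nat}"
    using P B unfolding poisson_process_def by (auto simp: disjoint_family_on_def)
  then have [measurable]: "(\<lambda>\<omega>. num_points (P \<omega>) B) \<in> borel_measurable N"
    by (auto simp: indep_vars_def)
  have "prob {\<omega>\<in>space N. num_points (P \<omega>) B > 1}
      \<le> prob (space N - ({\<omega>\<in>space N. num_points (P \<omega>) B = real 0} \<union> {\<omega>\<in>space N. num_points (P \<omega>) B = real 1}))"
    by (intro finite_measure_mono) auto
  also have "\<dots> = 1 - prob ({\<omega>\<in>space N. num_points (P \<omega>) B = real 0} \<union> {\<omega>\<in>space N. num_points (P \<omega>) B = real 1})"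
    by (rule prob_compl) measurable
  also have "prob ({\<omega>\<in>space N. num_points (P \<omega>) B = real 0} \<union> {\<omega>\<in>space N. num_points (P \<omega>) B = real 1})
      = prob {\<omega>\<in>space N. num_points (P \<omega>) B = real 0} + prob {\<omega>\<in>space N. num_points (P \<omega>) B = real 1}"
    by (intro finite_measure_Union) auto
  also have "\<dots> = (1 + l) * exp (- l)" unfolding pr by (simp add: algebra_simps)
  also have "1 - (1 + l) * exp (- l) \<le> l\<^sup>2"
  proof -
    have "(1 + l) * (1 + (- l)) \<le> (1 + l) * exp (- l)"
      using l by (intro mult_left_mono exp_ge_add_one_self) auto
    then show ?thesis by (simp add: algebra_simps power2_eq_square)
  qed
  finally show ?thesis by (simp add: l_def)
qed

theorem theorem1p6:
  fixes M :: "'w measure" and G :: "'w \<Rightarrow> complex conf"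
    and N :: "'v measure" and P :: "'v \<Rightarrow> real conf"
  assumes "ginibre_ensemble M G"
    and "poisson_process N P (density lborel (\<lambda>_. 2))"
  shows "converges_in_law (\<lambda>R :: real. M) (\<lambda>R \<omega>. push_conf (\<lambda>z. R * (cmod z - R)) (G \<omega>)) N P at_top"
proof -
  note G = assms(1) and P = assms(2)
  have GM: "G \<in> M \<rightarrow>\<^sub>M borel" and M: "prob_space M"
    using G by (simp_all add: ginibre_ensemble_def determinantal_def simple_point_process_def point_process_def)
  have N: "prob_space N" and PM: "P \<in> N \<rightarrow>\<^sub>M borel"
    using P by (simp_all add: poisson_process_def point_process_def)
  define X where "X R \<omega> = push_conf (radial R) (G \<omega>)" for R \<omega>
  \<comment> \<open>For \<open>R > 0\<close> the radial map is proper; for \<open>R = 0\<close> it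
    is constant, and the push-forward may be unspecified.\<close>
  have num: "num_points (X R \<omega>) B = num_points (G \<omega>) (radial R -` B)" if "0 < R" "precompact_borel B" for R \<omega> B
    unfolding X_def using that(2)
    by (intro num_points_push_conf[OF radial_measurable precompact_radial_vimage[OF that(1)]]) (simp_all add: precompact_borel_def)
  have pre: "precompact_borel {x..<x + 1 :: real}" for x by (simp add: precompact_borel_bounded)
  have cell_Union: "(\<Union>p\<in>{p}. cell m p) = cell m p" for m p by simp
  have "converges_in_law (\<lambda>_. M) X N P at_top"
  \<comment> \<open>\<open>r\<close> is the intensity, and \<open>b j\<close> is the bound of
    \<open>measure_radial_interval_le\<close> divided by \<open>pi\<close>, valid for all
    \<open>R \<ge> 1\<close>.\<close>
  proof (rule converges_in_law_if_void_probabilities[OF M N, where r = 2 and b = "\<lambda>j. 3 + 2 * \<bar>real_of_int j\<bar>"])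
    show "eventually (\<lambda>R. X R \<in> M \<rightarrow>\<^sub>M borel) at_top"
      using eventually_gt_at_top[of 0]
    proof eventually_elim
      fix R :: real assume R: "0 < R"
      have "continuous_on UNIV (push_conf (radial R))"
        by (rule continuous_on_push_conf[OF continuous_on_radial]) (rule precompact_radial_vimage[OF R])
      then show "X R \<in> M \<rightarrow>\<^sub>M borel"
        unfolding X_def[abs_def] by (rule measurable_compose[OF GM borel_measurable_continuous_onI])
    qed
    show "eventually (\<lambda>R. \<forall>B. precompact_borel B \<longrightarrow> integrable M (\<lambda>\<omega>. num_points (X R \<omega>) B)) at_top"
      using eventually_gt_at_top[of 0]
    proof eventually_elim
      fix R :: real assume R: "0 < R"
      show "\<forall>B. precompact_borel B \<longrightarrow> integrable M (\<lambda>\<omega>. num_points (X R \<omega>) B)"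
      proof (intro allI impI)
        fix B :: "real set" assume B: "precompact_borel B"
        show "integrable M (\<lambda>\<omega>. num_points (X R \<omega>) B)"
          unfolding num[OF R B] by (rule ginibre_mean(1)[OF G precompact_radial_vimage[OF R B]])
      qed
    qed
    show "(\<lambda>\<omega>. num_points (P \<omega>) B) \<in> borel_measurable N" if B: "precompact_borel B" for B
    proof -
      have "prob_space.indep_vars N (\<lambda>_. borel) (\<lambda>i \<omega>. num_points (P \<omega>) ((\<lambda>_. B) i)) {..<1::nat}"
        using P B unfolding poisson_process_def by (auto simp: disjoint_family_on_def)
      then show ?thesis by (auto simp: prob_space.indep_vars_def[OF N])
    qed
    show "eventually (\<lambda>R. \<forall>j. (\<integral>\<omega>. num_points (X R \<omega>) {real_of_int j..<real_of_int j + 1} \<partial>M) \<le> 3 + 2 * \<bar>real_of_int j\<bar>) at_top"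
      using eventually_ge_at_top[of 1]
    proof eventually_elim
      fix R :: real assume R: "1 \<le> R"
      then have R0: "0 < R" by simp
      show "\<forall>j. (\<integral>\<omega>. num_points (X R \<omega>) {real_of_int j..<real_of_int j + 1} \<partial>M) \<le> 3 + 2 * \<bar>real_of_int j\<bar>"
      proof
        fix j
        show "(\<integral>\<omega>. num_points (X R \<omega>) {real_of_int j..<real_of_int j + 1} \<partial>M) \<le> 3 + 2 * \<bar>real_of_int j\<bar>"
          unfolding num[OF R0 pre] ginibre_mean(2)[OF G precompact_radial_vimage[OF R0 pre]]
          using measure_radial_interval_le[OF R, of "real_of_int j"] by (simp only: pos_divide_le_eq[OF pi_gt_zero] mult.commute)
      qed
    qed
    show "((\<lambda>R. \<integral>\<omega>. num_points (X R \<omega>) (cell m p) \<partial>M) \<longlongrightarrow> 2 / real m) at_top" if m: "0 < m" for m p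
    proof (rule Lim_transform_eventually)
      have "((\<lambda>R. measure lborel (radial R -` cell m p) / pi) \<longlongrightarrow> pi * (2 * real (card {p}) / real m) / pi) at_top"
        using tendsto_measure_radial_Union_cells[OF m, of "{p}"] unfolding cell_Union
        by (intro tendsto_divide tendsto_const) auto
      then show "((\<lambda>R. measure lborel (radial R -` cell m p) / pi) \<longlongrightarrow> 2 / real m) at_top" by simp
      show "eventually (\<lambda>R. measure lborel (radial R -` cell m p) / pi = (\<integral>\<omega>. num_points (X R \<omega>) (cell m p) \<partial>M)) at_top"
        using eventually_gt_at_top[of 0]
      proof eventually_elim
        fix R :: real assume R: "0 < R"
        show "measure lborel (radial R -` cell m p) / pi = (\<integral>\<omega>. num_points (X R \<omega>) (cell m p) \<partial>M)"
          unfolding num[OF R precompact_cell] ginibre_mean(2)[OF G precompact_radial_vimage[OF R precompact_cell]] ..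
      qed
    qed
    show "((\<lambda>R. measure M {\<omega>\<in>space M. num_points (X R \<omega>) (\<Union>p\<in>T. cell m p) = 0}) \<longlongrightarrow> exp (- (2 * real (card T) / real m))) at_top"
      if m: "0 < m" and T: "finite T" for m T
    proof (rule Lim_transform_eventually)
      show "((\<lambda>R. measure M {\<omega>\<in>space M. num_points (G \<omega>) (radial R -` (\<Union>p\<in>T. cell m p)) = 0}) \<longlongrightarrow> exp (- (2 * real (card T) / real m))) at_top"
        by (rule ginibre_radial_void_probability[OF G precompact_Union_cells[OF T] tendsto_measure_radial_Union_cells[OF m T]])
      show "eventually (\<lambda>R. measure M {\<omega>\<in>space M. num_points (G \<omega>) (radial R -` (\<Union>p\<in>T. cell m p)) = 0}
        = measure M {\<omega>\<in>space M. num_points (X R \<omega>) (\<Union>p\<in>T. cell m p) = 0}) at_top"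
        using eventually_gt_at_top[of 0]
      proof eventually_elim
        fix R :: real assume R: "0 < R"
        show "measure M {\<omega>\<in>space M. num_points (G \<omega>) (radial R -` (\<Union>p\<in>T. cell m p)) = 0}
          = measure M {\<omega>\<in>space M. num_points (X R \<omega>) (\<Union>p\<in>T. cell m p) = 0}"
          unfolding num[OF R precompact_Union_cells[OF T]] ..
      qed
    qed
    show "measure N {\<omega>\<in>space N. num_points (P \<omega>) (\<Union>p\<in>T. cell m p) = 0} = exp (- (2 * real (card T) / real m))"
      if m: "0 < m" and T: "finite T" for m T
    proof -
      have pc: "precompact_borel (\<Union>p\<in>T. cell m p)" by (rule precompact_Union_cells[OF T])
      then have "measure N {\<omega>\<in>space N. num_points (P \<omega>) (\<Union>p\<in>T. cell m p) = real 0}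
        = measure (density lborel (\<lambda>_. 2)) (\<Union>p\<in>T. cell m p) ^ 0 / fact 0 * exp (- measure (density lborel (\<lambda>_. 2)) (\<Union>p\<in>T. cell m p))"
        using P unfolding poisson_process_def by blast
      moreover have "measure (density lborel (\<lambda>_. 2)) (\<Union>p\<in>T. cell m p) = 2 * (real (card T) / real m)"
        using pc by (subst measure_density_two) (simp_all only: precompact_borel_def measure_Union_cells[OF m T])
      ultimately show ?thesis by simp
    qed
    show "measure N {\<omega>\<in>space N. num_points (P \<omega>) (cell m p) > 1} \<le> (2 / real m)\<^sup>2" if m: "0 < m" for m p
    proof -
      have "measure (density lborel (\<lambda>_. 2)) (cell m p) = 2 * (real (card {p}) / real m)"
        using measure_Union_cells[OF m, of "{p}"] precompact_cell[of m p] unfolding cell_Union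
        by (subst measure_density_two) (simp_all add: precompact_borel_def)
      then show ?thesis using poisson_multiple_points_le[OF P precompact_cell[of m p]] by simp
    qed
  qed (use PM in auto)
  then show ?thesis by (simp add: X_def[abs_def] radial_def[abs_def])
qed

end
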